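(* Consider the system with no input noise ($u=0$) described in the context, and the estimates $\hat z_{T,n}=\mathbb{E}\big(z(T)\,|\,\{y(iT/n)\}_{i=1}^n\big)$ and $\hat z(T)=\mathbb{E}\big(z(T)\,|\,\{y(s),\,s\le T\}\big)$. Assume that $A$ is the generator of an analytic $C_0$-semigroup and assume either (i) $C\in\mathcal{L}(\mathcal{X},\mathcal{Y})$, or (ii) $C\in\mathcal{L}(\mathscr{D}(A),\mathcal{Y})$ and $x\in\mathscr{D}(A)$ almost surely. Then $$\mathbb{E}\big(\|\hat z_{T,n}-\hat z(T)\|_{\mathcal{X}}^2\big)\le\frac{MT}{n},$$ where $$M=\frac{2\|C\|_{\mathcal{L}(\mathcal{V},\mathcal{Y})}^2}{\min(\mathrm{eig}(R))}\Big(\mu^2+\frac{c(1)^2\pi^2}{96}\Big)\mathbb{E}\big(\|z(T)-\hat z_{T,n}\|_{\mathcal{X}}^2\big)\,\mathbb{E}\big(\|x\|_{\mathcal{V}}^2\big),$$ with $\mathcal{V}=\mathcal{X}$ in case (i) and $\mathcal{V}=\mathscr{D}(A)$ in case (ii), and where $c(1)$ is the constant, for $\kappa=1$, in the analytic semigroup estimate $\|A^{\kappa}e^{At}\|_{\mathcal{L}(\mathcal{X})}\le c(\kappa)/t^{\kappa}$, $t>0$, $\kappa\in\mathbb{N}$.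
   Context: Setting. $\mathcal{X}$ is a separable Hilbert space (state space), $\mathcal{Y}=\mathbb{R}^r$ (output space). $A$ generates a $C_0$-semigroup $e^{At}$ on $\mathcal{X}$ with domain $\mathscr{D}(A)$, which carries the graph norm $\|\xi\|_{\mathscr{D}(A)}^2=\|\xi\|_{\mathcal{X}}^2+\|A\xi\|_{\mathcal{X}}^2$. $C$ is the observation operator. $T>0$ is the final time, $n$ is a positive integer, and $\mu$ is a constant with $\|e^{At}\|_{\mathcal{L}(\mathcal{X})}\le\mu$ for $t\in[0,T]$. The initial state $x\sim N(m,P_0)$ is an $\mathcal{X}$-valued Gaussian random variable, $w$ is an $r$-dimensional Brownian motion with incremental covariance $R>0$, and $x$ and $w$ are independent. There is no input noise: the state is $z(t)=e^{At}x$ and the output is $y(t)=C\int_0^te^{As}x\,ds+w(t)$, i.e. $dz=Az\,dt$, $dy=Cz\,dt+dw$, $z(0)=x$. $\min(\mathrm{eig}(R))$ is the smallest eigenvalue of $R$. If $x\in\mathscr{D}(A)$ almost surely then $x$ is a $\mathscr{D}(A)$-valued Gaussian random variable, so $\mathbb{E}(\|x\|^2_{\mathscr{D}(A)})<\infty$. *)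

theory Defs
  imports "HOL-Probability.Probability"
begin

section \<open>Operator semigroups on a Hilbert space\<close>

text \<open>
  A semigroup is a family \<open>S :: real \<Rightarrow> 'a \<Rightarrow>\<^sub>L 'a\<close> of which only the values at times \<open>t \<ge> 0\<close>
  matter; \<open>S t\<close> plays the role of \<open>e\<^sup>A\<^sup>t\<close>, with \<open>A = generator S\<close>.
\<close>

definition C0_semigroup :: "(real \<Rightarrow> ('a::real_normed_vector \<Rightarrow>\<^sub>L 'a)) \<Rightarrow> bool" where
  "C0_semigroup S \<longleftrightarrow>
     S 0 = id_blinfun \<and>
     (\<forall>s\<ge>0. \<forall>t\<ge>0. S (s + t) = S s o\<^sub>L S t) \<and>
     (\<forall>\<xi>. ((\<lambda>t. S t \<xi>) \<longlongrightarrow> \<xi>) (at_right 0))"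

definition generator_domain :: "(real \<Rightarrow> ('a::real_normed_vector \<Rightarrow>\<^sub>L 'a)) \<Rightarrow> 'a set" where
  "generator_domain S = {\<xi>. \<exists>\<eta>. ((\<lambda>h. (S h \<xi> - \<xi>) /\<^sub>R h) \<longlongrightarrow> \<eta>) (at_right 0)}"

text \<open>
  The value \<open>0\<close> outside the domain is a convention. It makes \<open>generator S\<close> a Borel function on
  the whole space, so that expectations of \<open>\<parallel>x\<parallel>\<^sup>2\<close> in the graph norm make sense for a random
  variable \<open>x\<close> that is only almost surely in the domain.
\<close>

definition generator :: "(real \<Rightarrow> ('a::real_normed_vector \<Rightarrow>\<^sub>L 'a)) \<Rightarrow> 'a \<Rightarrow> 'a" where
  "generator S \<xi> =
     (if \<xi> \<in> generator_domain S then Lim (at_right 0) (\<lambda>h. (S h \<xi> - \<xi>) /\<^sub>R h) else 0)"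

definition graph_norm :: "('a::real_normed_vector \<Rightarrow> 'a) \<Rightarrow> 'a \<Rightarrow> real" where
  "graph_norm A \<xi> = sqrt ((norm \<xi>)\<^sup>2 + (norm (A \<xi>))\<^sup>2)"

text \<open>
  Analyticity of a semigroup on a real space refers to the complexification, realised on
  \<open>'a \<times> 'a\<close> with the pair \<open>(a, b)\<close> standing for \<open>a + \<i> b\<close>. (If the space already carries a complex
  structure, its complexification as a real space is the direct sum of the space and its
  conjugate, so the notion below agrees with the usual one for complex-linear semigroups.)
\<close>

definition cscale :: "complex \<Rightarrow> 'a::real_vector \<times> 'a \<Rightarrow> 'a \<times> 'a" where
  "cscale \<zeta> p =
     (Re \<zeta> *\<^sub>R fst p - Im \<zeta> *\<^sub>R snd p, Re \<zeta> *\<^sub>R snd p + Im \<zeta> *\<^sub>R fst p)"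

definition sector :: "real \<Rightarrow> complex set" where
  "sector \<theta> = {z. z \<noteq> 0 \<and> \<bar>Arg z\<bar> < \<theta>}"

text \<open>
  Complex differentiability of the extension \<open>U\<close> is required in the strong sense; for
  operator-valued functions this is equivalent to differentiability in the operator norm.
\<close>

definition analytic_semigroup :: "(real \<Rightarrow> ('a::real_normed_vector \<Rightarrow>\<^sub>L 'a)) \<Rightarrow> bool" where
  "analytic_semigroup S \<longleftrightarrow>
     C0_semigroup S \<and>
     (\<exists>\<theta>. 0 < \<theta> \<and> \<theta> \<le> pi / 2 \<and>
       (\<exists>U :: complex \<Rightarrow> (('a \<times> 'a) \<Rightarrow>\<^sub>L ('a \<times> 'a)).
          (\<forall>z\<in>sector \<theta>. \<forall>\<zeta> p. blinfun_apply (U z) (cscale \<zeta> p) = cscale \<zeta> (blinfun_apply (U z) p)) \<and>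
          (\<forall>t>0. \<forall>\<xi>. blinfun_apply (U (complex_of_real t)) (\<xi>, 0) = (S t \<xi>, 0)) \<and>
          (\<forall>z\<in>sector \<theta>. \<forall>z'\<in>sector \<theta>. U (z + z') = U z o\<^sub>L U z') \<and>
          (\<forall>p. ((\<lambda>z. blinfun_apply (U z) p) \<longlongrightarrow> p) (at 0 within sector \<theta>)) \<and>
          (\<forall>z\<in>sector \<theta>. \<forall>p. \<exists>q.
             ((\<lambda>h. cscale (inverse h) (blinfun_apply (U (z + h)) p - blinfun_apply (U z) p)) \<longlongrightarrow> q) (at 0))))"

section \<open>Bounded operators on a subspace with its own norm\<close>

definition bounded_operator_on ::
    "'a::real_vector set \<Rightarrow> ('a \<Rightarrow> real) \<Rightarrow> ('a \<Rightarrow> 'b::real_normed_vector) \<Rightarrow> bool" where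
  "bounded_operator_on V normV C \<longleftrightarrow>
     (\<forall>\<xi>\<in>V. \<forall>\<eta>\<in>V. C (\<xi> + \<eta>) = C \<xi> + C \<eta>) \<and>
     (\<forall>a. \<forall>\<xi>\<in>V. C (a *\<^sub>R \<xi>) = a *\<^sub>R C \<xi>) \<and>
     (\<exists>K. \<forall>\<xi>\<in>V. norm (C \<xi>) \<le> K * normV \<xi>)"

text \<open>For \<open>V = UNIV\<close> and \<open>normV = norm\<close> this is \<^const>\<open>onorm\<close>.\<close>

definition operator_norm_on ::
    "'a::real_vector set \<Rightarrow> ('a \<Rightarrow> real) \<Rightarrow> ('a \<Rightarrow> 'b::real_normed_vector) \<Rightarrow> real" where
  "operator_norm_on V normV C = (SUP \<xi>\<in>V. norm (C \<xi>) / normV \<xi>)"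

section \<open>Matrices\<close>

definition positive_definite :: "real^'r^'r \<Rightarrow> bool" where
  "positive_definite R \<longleftrightarrow> transpose R = R \<and> (\<forall>v. v \<noteq> 0 \<longrightarrow> 0 < v \<bullet> (R *v v))"

definition min_eigenvalue :: "real^'r^'r \<Rightarrow> real" where
  "min_eigenvalue R = Min {l. \<exists>v. v \<noteq> 0 \<and> R *v v = l *\<^sub>R v}"

section \<open>Gaussian random variables and Brownian motion\<close>

definition real_gaussian :: "'w measure \<Rightarrow> ('w \<Rightarrow> real) \<Rightarrow> real \<Rightarrow> real \<Rightarrow> bool" where
  "real_gaussian M X m v \<longleftrightarrow>
     (if v = 0 then X \<in> borel_measurable M \<and> (AE \<omega> in M. X \<omega> = m)
      else 0 < v \<and> distributed M lborel X (\<lambda>u. ennreal (normal_density m (sqrt v) u)))"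

text \<open>
  \<open>X \<sim> N(m, P)\<close> in a separable Hilbert space: all scalar marginals are (possibly degenerate)
  normal with mean \<open>\<langle>m, h\<rangle>\<close> and variance \<open>\<langle>P h, h\<rangle>\<close>. That the covariance operator has finite
  trace is a consequence.
\<close>

definition gaussian ::
    "'w measure \<Rightarrow> ('w \<Rightarrow> 'a::{real_inner, second_countable_topology}) \<Rightarrow> 'a \<Rightarrow> ('a \<Rightarrow> 'a) \<Rightarrow> bool"
  where
  "gaussian M X m P \<longleftrightarrow>
     X \<in> borel_measurable M \<and>
     bounded_linear P \<and> (\<forall>h k. P h \<bullet> k = h \<bullet> P k) \<and> (\<forall>h. 0 \<le> P h \<bullet> h) \<and>
     (\<forall>h. real_gaussian M (\<lambda>\<omega>. X \<omega> \<bullet> h) (m \<bullet> h) (P h \<bullet> h))"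

definition brownian_motion :: "'w measure \<Rightarrow> real^'r^'r \<Rightarrow> (real \<Rightarrow> 'w \<Rightarrow> real^'r) \<Rightarrow> bool" where
  "brownian_motion M R w \<longleftrightarrow>
     (\<forall>t\<ge>0. w t \<in> borel_measurable M) \<and>
     (AE \<omega> in M. w 0 \<omega> = 0) \<and>
     (AE \<omega> in M. continuous_on {0..} (\<lambda>t. w t \<omega>)) \<and>
     (\<forall>s t. 0 \<le> s \<and> s \<le> t \<longrightarrow>
        gaussian M (\<lambda>\<omega>. w t \<omega> - w s \<omega>) 0 (\<lambda>v. (t - s) *\<^sub>R (R *v v))) \<and>
     (\<forall>k. \<forall>\<tau> :: nat \<Rightarrow> real. 0 \<le> \<tau> 0 \<and> mono \<tau> \<longrightarrow>
        prob_space.indep_vars M (\<lambda>_. borel) (\<lambda>i \<omega>. w (\<tau> (Suc i)) \<omega> - w (\<tau> i) \<omega>) {..<k})"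

section \<open>Generated sigma-algebras and conditional expectation\<close>

definition generated_sigma ::
    "'w measure \<Rightarrow> 'i set \<Rightarrow> ('i \<Rightarrow> 'w \<Rightarrow> 'b::topological_space) \<Rightarrow> 'w measure" where
  "generated_sigma M I X =
     sigma (space M) (\<Union>i\<in>I. {X i -` B \<inter> space M | B. B \<in> sets borel})"

text \<open>
  \<open>Z\<close> is a version of \<open>E(X | F)\<close>. The library's \<^const>\<open>real_cond_exp\<close> covers only real-valued
  random variables.
\<close>

definition is_cond_exp ::
    "'w measure \<Rightarrow> 'w measure \<Rightarrow> ('w \<Rightarrow> 'a::{banach, second_countable_topology}) \<Rightarrow> ('w \<Rightarrow> 'a) \<Rightarrow> bool"
  where
  "is_cond_exp M F X Z \<longleftrightarrow>
     subalgebra M F \<and> integrable M X \<and> integrable M Z \<and> Z \<in> borel_measurable F \<and>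
     (\<forall>B\<in>sets F. set_lebesgue_integral M B Z = set_lebesgue_integral M B X)"

section \<open>The system without input noise\<close>

definition state :: "(real \<Rightarrow> ('a::real_normed_vector \<Rightarrow>\<^sub>L 'a)) \<Rightarrow> ('w \<Rightarrow> 'a) \<Rightarrow> real \<Rightarrow> 'w \<Rightarrow> 'a" where
  "state S x t \<omega> = S t (x \<omega>)"

text \<open>
  The integral always lies in the domain of the generator, so the output is defined also when
  \<open>C\<close> is meaningful on that domain only.
\<close>

definition observation ::
    "(real \<Rightarrow> ('a::real_normed_vector \<Rightarrow>\<^sub>L 'a)) \<Rightarrow> ('a \<Rightarrow> real^'r) \<Rightarrow> ('w \<Rightarrow> 'a) \<Rightarrow>
      (real \<Rightarrow> 'w \<Rightarrow> real^'r) \<Rightarrow> real \<Rightarrow> 'w \<Rightarrow> real^'r" where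
  "observation S C x w t \<omega> = C (integral {0..t} (\<lambda>s. S s (x \<omega>))) + w t \<omega>"

end

(* The vector e = z(T) - zn is orthogonal to the sampled outputs. Subtracting from a linear functional
   of the output path its grid interpolation leaves the integral of a step function alpha with zero mean on
   every grid cell, and such an integral has a signal part, the pairing of alpha with C e^{At} x, and a
   noise part that is uncorrelated with x and with the sampled noise. The noise part has variance at least
   min(eig R) |alpha|^2, while, alpha having zero cell means, only the oscillation of C e^{At} x
   within the cells contributes to the signal part; the latter is controlled by |A e^{At}| <= c(1)/t through
   the midpoint rule and the sum of 1/i^2. So linear estimators of <e, k> from the refined observations
   gain at most a factor O(T/n), and by Gaussianity linear estimators are optimal. Summing over an orthonormal
   basis gives the vector-valued bound. *)
theory Submission
  imports Defs
begin

section \<open>Real Gaussian random variables\<close>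

text \<open>The estimate from the whole output path depends on uncountably many variables, so the
  difference of the two estimates is bounded by duality: it is enough to pair <e, k> with functions
  of finitely many outputs, and there the best estimator is an explicit affine projection. If such
  an estimator q has signal part l and noise part b, the quantity to bound is (E(<e, k> l))^2 / E
  q^2. Both E l^2 and E b^2 are compared with the energy of the same step function, one from above
  and one from below, so this energy cancels. The estimate c(1)/t is useless on the first cell,
  where the bound mu replaces it; this is the origin of mu^2. On the other cells the midpoint rule
  contributes 1/12 and the sum of 1/i^2 contributes pi^2/6, hence pi^2/72. The stated constant, with
  2 mu^2 and 2 pi^2/96 = pi^2/48, is at least as large. A separate obstacle is integrability: x is
  Gaussian through its scalar marginals and, in case (ii), lies in the domain only almost surely, so
  finite second moments of |x| and |A x| have to be derived from fourth moments of scalar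
  marginals.\<close>

lemma (in prob_space) real_gaussian_standard:
  assumes "real_gaussian M X m v"
  shows "0 \<le> v" and "X \<in> borel_measurable M" and "v = 0 \<Longrightarrow> AE \<omega> in M. X \<omega> = m"
    and "v \<noteq> 0 \<Longrightarrow> distributed M lborel (\<lambda>\<omega>. (X \<omega> - m) / sqrt v) std_normal_density"
proof -
  show "0 \<le> v" using assms by (auto simp: real_gaussian_def split: if_splits)
  show "X \<in> borel_measurable M"
    using assms by (auto simp: real_gaussian_def distributed_def split: if_splits)
  show "v = 0 \<Longrightarrow> AE \<omega> in M. X \<omega> = m"
    using assms by (auto simp: real_gaussian_def)
  show "v \<noteq> 0 \<Longrightarrow> distributed M lborel (\<lambda>\<omega>. (X \<omega> - m) / sqrt v) std_normal_density"
    using assms normal_standard_normal_convert[of "sqrt v" X m]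
    by (auto simp: real_gaussian_def split: if_splits)
qed

lemma (in prob_space) std_normal_moments:
  assumes D: "distributed M lborel Z std_normal_density"
  shows "integrable M (\<lambda>\<omega>. Z \<omega> ^ k)"
    and "expectation Z = 0" and "expectation (\<lambda>\<omega>. Z \<omega> ^ 2) = 1"
    and "expectation (\<lambda>\<omega>. Z \<omega> ^ 3) = 0" and "expectation (\<lambda>\<omega>. Z \<omega> ^ 4) = 3"
proof -
  show "integrable M (\<lambda>\<omega>. Z \<omega> ^ k)"
    using distributed_integrable[OF D, of "\<lambda>x. x^k"] integrable_std_normal_moment[of k] by simp
  have *: "expectation (\<lambda>\<omega>. Z \<omega> ^ k) = (\<integral>x. std_normal_density x * x^k \<partial>lborel)" for k
    using distributed_integral[OF D, of "\<lambda>x. x^k"] by simp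
  show "expectation Z = 0" using *[of 1] integral_std_normal_moment_odd[of 0] by simp
  show "expectation (\<lambda>\<omega>. Z \<omega> ^ 2) = 1" using *[of 2] integral_std_normal_moment_even[of 1] by simp
  show "expectation (\<lambda>\<omega>. Z \<omega> ^ 3) = 0" using *[of 3] integral_std_normal_moment_odd[of 1]
    by (simp add: numeral_3_eq_3)
  show "expectation (\<lambda>\<omega>. Z \<omega> ^ 4) = 3" using *[of 4] integral_std_normal_moment_even[of 2]
    by (simp add: fact_numeral)
qed

lemma (in prob_space) std_normal_char:
  assumes D: "distributed M lborel Z std_normal_density"
  shows "(\<integral>\<omega>. iexp (t * Z \<omega>) \<partial>M) = exp (- of_real (t\<^sup>2 / 2))"
proof -
  have [measurable]: "Z \<in> borel_measurable M" using D by (auto simp: distributed_def)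
  have eq: "distr M lborel Z = density lborel std_normal_density" using D by (simp add: distributed_def)
  have "(\<integral>\<omega>. iexp (t * Z \<omega>) \<partial>M) = (\<integral>z. iexp (t * z) \<partial>(distr M lborel Z))"
    by (subst integral_distr) auto
  also have "\<dots> = char std_normal_distribution t"
    unfolding char_def eq by simp
  also have "\<dots> = exp (- of_real (t\<^sup>2 / 2))"
    by (simp add: char_std_normal_distribution exp_of_real[symmetric])
  finally show ?thesis .
qed

text \<open>Writing X = m + s Z with s^2 = v gives the fourth moment m^4 + 6 m^2 v + 3 v^2, which is
  at most 3 (m^2 + v)^2. This comparison survives a nonzero mean and v = 0, and later yields square
  integrability of vector-valued variables. The transform is recorded at frequency 1 because
  multiples of a variable are treated as variables of their own.\<close>

lemma (in prob_space) real_gaussian_moments: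
  assumes G: "real_gaussian M X m v"
  shows "integrable M (\<lambda>\<omega>. X \<omega> ^ 4)"
    and "expectation X = m" and "expectation (\<lambda>\<omega>. (X \<omega>)\<^sup>2) = m\<^sup>2 + v"
    and "expectation (\<lambda>\<omega>. X \<omega> ^ 4) \<le> 3 * (expectation (\<lambda>\<omega>. (X \<omega>)\<^sup>2))\<^sup>2"
    and "(\<integral>\<omega>. iexp (X \<omega>) \<partial>M) = exp (\<i> * of_real m - of_real (v / 2))"
proof -
  note [measurable] = real_gaussian_standard(2)[OF G]
  have "integrable M (\<lambda>\<omega>. X \<omega> ^ 4) \<and> expectation X = m \<and> expectation (\<lambda>\<omega>. (X \<omega>)\<^sup>2) = m\<^sup>2 + v
    \<and> expectation (\<lambda>\<omega>. X \<omega> ^ 4) \<le> 3 * (expectation (\<lambda>\<omega>. (X \<omega>)\<^sup>2))\<^sup>2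
    \<and> (\<integral>\<omega>. iexp (X \<omega>) \<partial>M) = exp (\<i> * of_real m - of_real (v / 2))"
  proof (cases "v = 0")
    case True
    then have ae: "AE \<omega> in M. X \<omega> = m" using real_gaussian_standard(3)[OF G] by simp
    have "integrable M (\<lambda>\<omega>. X \<omega> ^ 4) \<longleftrightarrow> integrable M (\<lambda>\<omega>. m ^ 4)"
      by (rule integrable_cong_AE) (use ae in auto)
    moreover have "expectation X = expectation (\<lambda>_. m)"
      by (rule integral_cong_AE) (use ae in auto)
    moreover have "expectation (\<lambda>\<omega>. (X \<omega>)\<^sup>2) = expectation (\<lambda>_. m\<^sup>2)"
      by (rule integral_cong_AE) (use ae in auto)
    moreover have "expectation (\<lambda>\<omega>. X \<omega> ^ 4) = expectation (\<lambda>_. m ^ 4)"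
      by (rule integral_cong_AE) (use ae in auto)
    moreover have "(\<integral>\<omega>. iexp (X \<omega>) \<partial>M) = (\<integral>\<omega>. iexp m \<partial>M)"
      by (rule integral_cong_AE) (use ae in auto)
    ultimately show ?thesis using True by (simp add: prob_space)
  next
    case False
    define Z where "Z \<omega> = (X \<omega> - m) / sqrt v" for \<omega>
    define s where "s = sqrt v"
    have s: "s > 0" "s\<^sup>2 = v" using False real_gaussian_standard(1)[OF G] by (auto simp: s_def)
    have D: "distributed M lborel Z std_normal_density"
      unfolding Z_def using real_gaussian_standard(4)[OF G False] .
    have X: "X \<omega> = m + s * Z \<omega>" for \<omega> using s(1) by (simp add: Z_def s_def)
    note Zi = std_normal_moments(1)[OF D] and Z = std_normal_moments(2-)[OF D]
    have Zi1: "integrable M Z" using Zi[of 1] by simp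
    have X2: "(X \<omega>)\<^sup>2 = m\<^sup>2 + 2 * m * s * Z \<omega> + s\<^sup>2 * Z \<omega> ^ 2" for \<omega>
      by (simp add: X power2_eq_square algebra_simps)
    have X4: "X \<omega> ^ 4 = m^4 + 4 * m^3 * s * Z \<omega> + 6 * m\<^sup>2 * s\<^sup>2 * Z \<omega> ^ 2
        + 4 * m * s^3 * Z \<omega> ^ 3 + s^4 * Z \<omega> ^ 4" for \<omega>
      by (simp add: X power2_eq_square power3_eq_cube power4_eq_xxxx algebra_simps)
    have i4: "integrable M (\<lambda>\<omega>. X \<omega> ^ 4)" unfolding X4 using Zi Zi1 by auto
    have e1: "expectation X = m" unfolding X using Zi1 Z(1) by (simp add: prob_space)
    have e2: "expectation (\<lambda>\<omega>. (X \<omega>)\<^sup>2) = m\<^sup>2 + v"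
      unfolding X2 using Zi Zi1 Z s(2) by (simp add: prob_space)
    have e4: "expectation (\<lambda>\<omega>. X \<omega> ^ 4) = m^4 + 6 * m\<^sup>2 * s\<^sup>2 + 3 * s^4"
      unfolding X4 using Zi Zi1 Z by (simp add: prob_space)
    have "expectation (\<lambda>\<omega>. X \<omega> ^ 4) \<le> 3 * (m\<^sup>2 + v)\<^sup>2"
      unfolding e4 s(2)[symmetric] using zero_le_power2[of "m\<^sup>2"]
      by (simp add: power2_eq_square power4_eq_xxxx algebra_simps)
    moreover have "(\<integral>\<omega>. iexp (X \<omega>) \<partial>M) = exp (\<i> * of_real m) * (\<integral>\<omega>. iexp (s * Z \<omega>) \<partial>M)"
      by (simp add: X exp_add distrib_left)
    ultimately show ?thesis using i4 e1 e2 std_normal_char[OF D, of s] s(2)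
      by (simp add: exp_add[symmetric])
  qed
  then show "integrable M (\<lambda>\<omega>. X \<omega> ^ 4)"
    and "expectation X = m" and "expectation (\<lambda>\<omega>. (X \<omega>)\<^sup>2) = m\<^sup>2 + v"
    and "expectation (\<lambda>\<omega>. X \<omega> ^ 4) \<le> 3 * (expectation (\<lambda>\<omega>. (X \<omega>)\<^sup>2))\<^sup>2"
    and "(\<integral>\<omega>. iexp (X \<omega>) \<partial>M) = exp (\<i> * of_real m - of_real (v / 2))"
    by blast+
qed

section \<open>Real square-integrable functions\<close>

definition square_integrable :: "'w measure \<Rightarrow> ('w \<Rightarrow> real) \<Rightarrow> bool" where
  "square_integrable M f \<longleftrightarrow> f \<in> borel_measurable M \<and> integrable M (\<lambda>\<omega>. (f \<omega>)\<^sup>2)"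

lemma square_integrable_measurable: "square_integrable M f \<Longrightarrow> f \<in> borel_measurable M"
  by (simp add: square_integrable_def)

lemma square_integrable_mult:
  assumes "square_integrable M f" "square_integrable M g"
  shows "integrable M (\<lambda>\<omega>. f \<omega> * g \<omega>)"
proof (rule Bochner_Integration.integrable_bound)
  show "integrable M (\<lambda>\<omega>. (f \<omega>)\<^sup>2 + (g \<omega>)\<^sup>2)"
    using assms by (simp add: square_integrable_def)
  show "(\<lambda>\<omega>. f \<omega> * g \<omega>) \<in> borel_measurable M"
    using assms by (auto simp: square_integrable_def)
  have "\<bar>a * b\<bar> \<le> a\<^sup>2 + b\<^sup>2" for a b :: real
  proof -
    have "2 * \<bar>a\<bar> * \<bar>b\<bar> \<le> a\<^sup>2 + b\<^sup>2" using sum_squares_bound[of "\<bar>a\<bar>" "\<bar>b\<bar>"] by simp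
    moreover have "0 \<le> \<bar>a\<bar> * \<bar>b\<bar>" by simp
    ultimately show ?thesis unfolding abs_mult by linarith
  qed
  then show "AE \<omega> in M. norm (f \<omega> * g \<omega>) \<le> norm ((f \<omega>)\<^sup>2 + (g \<omega>)\<^sup>2)"
    by (auto intro!: AE_I2)
qed

lemma square_integrable_add:
  assumes "square_integrable M f" "square_integrable M g"
  shows "square_integrable M (\<lambda>\<omega>. f \<omega> + g \<omega>)"
  using assms square_integrable_mult[OF assms]
  unfolding square_integrable_def power2_sum by (auto simp: mult.assoc)

lemma square_integrable_cmult:
  assumes "square_integrable M f"
  shows "square_integrable M (\<lambda>\<omega>. c * f \<omega>)"
  using assms unfolding square_integrable_def power_mult_distrib by auto

lemma square_integrable_diff:
  assumes "square_integrable M f" "square_integrable M g"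
  shows "square_integrable M (\<lambda>\<omega>. f \<omega> - g \<omega>)"
  using square_integrable_add[OF assms(1) square_integrable_cmult[OF assms(2), of "-1"]] by simp

lemma (in finite_measure) square_integrable_const: "square_integrable M (\<lambda>_. c)"
  by (simp add: square_integrable_def)

lemma square_integrable_sum:
  assumes "\<And>i. i \<in> I \<Longrightarrow> square_integrable M (f i)"
  shows "square_integrable M (\<lambda>\<omega>. \<Sum>i\<in>I. f i \<omega>)"
proof -
  have "square_integrable M (\<lambda>\<omega>. 0 :: real)" by (simp add: square_integrable_def)
  then show ?thesis using assms
    by (induction I rule: infinite_finite_induct) (auto intro: square_integrable_add)
qed

lemma (in finite_measure) square_integrable_integrable:
  assumes "square_integrable M f"
  shows "integrable M f"
  using square_integrable_mult[OF assms square_integrable_const[of 1]] by simp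

text \<open>The quadratic form in (s, t) given by the integral of (s f - t g)^2 is nonnegative; at s
  = 1 its minimum is attained at t = B/D.\<close>

lemma square_integrable_cauchy_schwarz:
  assumes "square_integrable M f" "square_integrable M g"
  shows "(\<integral>\<omega>. f \<omega> * g \<omega> \<partial>M)\<^sup>2 \<le> (\<integral>\<omega>. (f \<omega>)\<^sup>2 \<partial>M) * (\<integral>\<omega>. (g \<omega>)\<^sup>2 \<partial>M)"
proof -
  note i = square_integrable_mult[OF assms]
  define A B D where "A = (\<integral>\<omega>. (f \<omega>)\<^sup>2 \<partial>M)" and "B = (\<integral>\<omega>. f \<omega> * g \<omega> \<partial>M)" and "D = (\<integral>\<omega>. (g \<omega>)\<^sup>2 \<partial>M)"
  have q: "0 \<le> A * s\<^sup>2 - 2 * B * s * t + D * t\<^sup>2" for s t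
  proof -
    have "0 \<le> (\<integral>\<omega>. (s * f \<omega> - t * g \<omega>)\<^sup>2 \<partial>M)" by simp
    also have "(\<lambda>\<omega>. (s * f \<omega> - t * g \<omega>)\<^sup>2) =
        (\<lambda>\<omega>. s\<^sup>2 * (f \<omega>)\<^sup>2 - (2 * s * t) * (f \<omega> * g \<omega>) + t\<^sup>2 * (g \<omega>)\<^sup>2)"
      by (auto simp: power2_eq_square algebra_simps)
    also have "(\<integral>\<omega>. s\<^sup>2 * (f \<omega>)\<^sup>2 - (2 * s * t) * (f \<omega> * g \<omega>) + t\<^sup>2 * (g \<omega>)\<^sup>2 \<partial>M)
        = s\<^sup>2 * A - (2 * s * t) * B + t\<^sup>2 * D"
      using i assms by (simp add: square_integrable_def A_def B_def D_def)
    finally show ?thesis by (simp add: algebra_simps)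
  qed
  have A: "A \<ge> 0" and D: "D \<ge> 0" by (simp_all add: A_def D_def)
  show ?thesis
  proof (cases "D = 0")
    case True
    have "B = 0"
    proof (rule ccontr)
      assume "B \<noteq> 0"
      \<comment> \<open>With D = 0 this t turns the form into A - (A + 1) = -1.\<close>
      then show False using q[of 1 "(A + 1) / (2 * B)"] True by (simp add: field_simps)
    qed
    then show ?thesis using A D by (simp add: A_def B_def D_def)
  next
    case False
    then have "0 \<le> A - B\<^sup>2 / D" using q[of 1 "B / D"] by (simp add: power2_eq_square field_simps)
    moreover have "0 < D" using False D by simp
    ultimately have "B\<^sup>2 \<le> A * D" by (simp add: pos_divide_le_eq)
    then show ?thesis by (simp add: A_def B_def D_def)
  qed
qed

section \<open>Gaussian laws through characteristic functions\<close>

text \<open>The transform at frequency 1 with moments in place of parameters. For a single function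
  this is just one equation; demanded of every member of a linear span it amounts to joint
  Gaussianity, and degenerate laws are included without a case distinction.\<close>

definition gaussian_char :: "'w measure \<Rightarrow> ('w \<Rightarrow> real) \<Rightarrow> bool" where
  "gaussian_char M f \<longleftrightarrow> square_integrable M f \<and>
     (\<integral>\<omega>. iexp (f \<omega>) \<partial>M) = exp (\<i> * of_real (\<integral>\<omega>. f \<omega> \<partial>M)
        - of_real (((\<integral>\<omega>. (f \<omega>)\<^sup>2 \<partial>M) - (\<integral>\<omega>. f \<omega> \<partial>M)\<^sup>2) / 2))"

lemma (in prob_space) real_gaussian_square_integrable:
  assumes "real_gaussian M X m v"
  shows "square_integrable M X"
  unfolding square_integrable_def
proof
  show X[measurable]: "X \<in> borel_measurable M" using real_gaussian_standard(2)[OF assms] .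
  have "square_integrable M (\<lambda>\<omega>. (X \<omega>)\<^sup>2)"
    using real_gaussian_moments(1)[OF assms] by (simp add: square_integrable_def flip: power_mult)
  then show "integrable M (\<lambda>\<omega>. (X \<omega>)\<^sup>2)" by (rule square_integrable_integrable)
qed

lemma (in prob_space) real_gaussian_char:
  assumes "real_gaussian M X m v"
  shows "gaussian_char M X"
  unfolding gaussian_char_def
  using real_gaussian_square_integrable[OF assms] real_gaussian_moments[OF assms] by simp

lemma (in prob_space) gaussian_char_const: "gaussian_char M (\<lambda>_. c)"
  by (simp add: gaussian_char_def square_integrable_const prob_space)

lemma (in prob_space) gaussian_char_cong:
  assumes "AE \<omega> in M. f \<omega> = g \<omega>" "gaussian_char M f" "g \<in> borel_measurable M"
  shows "gaussian_char M g"
proof -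
  have [measurable]: "f \<in> borel_measurable M" "g \<in> borel_measurable M"
    using assms by (auto simp: gaussian_char_def square_integrable_def)
  have "(\<integral>\<omega>. iexp (f \<omega>) \<partial>M) = (\<integral>\<omega>. iexp (g \<omega>) \<partial>M)" "(\<integral>\<omega>. f \<omega> \<partial>M) = (\<integral>\<omega>. g \<omega> \<partial>M)"
    "(\<integral>\<omega>. (f \<omega>)\<^sup>2 \<partial>M) = (\<integral>\<omega>. (g \<omega>)\<^sup>2 \<partial>M)"
    by (rule integral_cong_AE; use assms(1) in auto)+
  moreover have "integrable M (\<lambda>\<omega>. (f \<omega>)\<^sup>2) \<longleftrightarrow> integrable M (\<lambda>\<omega>. (g \<omega>)\<^sup>2)"
    by (rule integrable_cong_AE; use assms(1) in auto)
  ultimately show ?thesis using assms by (simp add: gaussian_char_def square_integrable_def)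
qed

text \<open>Independence factorises the transform, and it factorises E(f g), so that the variances
  in the exponent add.\<close>

lemma (in prob_space) gaussian_char_add_indep:
  assumes ind: "indep_var borel f borel g" and f: "gaussian_char M f" and g: "gaussian_char M g"
  shows "gaussian_char M (\<lambda>\<omega>. f \<omega> + g \<omega>)"
proof -
  have L: "square_integrable M f" "square_integrable M g"
    using f g by (auto simp: gaussian_char_def)
  note i = L[THEN square_integrable_integrable]
  note [measurable] = L[THEN square_integrable_measurable]
  have fg: "(\<integral>\<omega>. f \<omega> * g \<omega> \<partial>M) = (\<integral>\<omega>. f \<omega> \<partial>M) * (\<integral>\<omega>. g \<omega> \<partial>M)"
    by (rule indep_var_lebesgue_integral[OF ind i])
  have e1: "(\<integral>\<omega>. f \<omega> + g \<omega> \<partial>M) = (\<integral>\<omega>. f \<omega> \<partial>M) + (\<integral>\<omega>. g \<omega> \<partial>M)" using i by simp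
  have "(\<integral>\<omega>. (f \<omega> + g \<omega>)\<^sup>2 \<partial>M) = (\<integral>\<omega>. (f \<omega>)\<^sup>2 + (g \<omega>)\<^sup>2 + 2 * (f \<omega> * g \<omega>) \<partial>M)"
    by (simp add: power2_sum mult.assoc)
  also have "\<dots> = (\<integral>\<omega>. (f \<omega>)\<^sup>2 \<partial>M) + (\<integral>\<omega>. (g \<omega>)\<^sup>2 \<partial>M) + 2 * ((\<integral>\<omega>. f \<omega> \<partial>M) * (\<integral>\<omega>. g \<omega> \<partial>M))"
    using L square_integrable_mult[OF L] by (simp add: square_integrable_def fg)
  finally have e2: "(\<integral>\<omega>. (f \<omega> + g \<omega>)\<^sup>2 \<partial>M) = \<dots>" .
  have "indep_var borel ((\<lambda>x. iexp x) \<circ> f) borel ((\<lambda>x. iexp x) \<circ> g)"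
    by (rule indep_var_compose[OF ind]) auto
  then have "(\<integral>\<omega>. iexp (f \<omega>) * iexp (g \<omega>) \<partial>M) = (\<integral>\<omega>. iexp (f \<omega>) \<partial>M) * (\<integral>\<omega>. iexp (g \<omega>) \<partial>M)"
    by (intro indep_var_lebesgue_integral)
       (auto simp: comp_def intro!: integrable_const_bound[of _ 1])
  moreover have "(\<integral>\<omega>. iexp (f \<omega> + g \<omega>) \<partial>M) = (\<integral>\<omega>. iexp (f \<omega>) * iexp (g \<omega>) \<partial>M)"
    by (simp add: distrib_left exp_add)
  ultimately have "(\<integral>\<omega>. iexp (f \<omega> + g \<omega>) \<partial>M) = (\<integral>\<omega>. iexp (f \<omega>) \<partial>M) * (\<integral>\<omega>. iexp (g \<omega>) \<partial>M)"
    by simp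
  also have "\<dots> = exp (\<i> * of_real (\<integral>\<omega>. f \<omega> + g \<omega> \<partial>M)
      - of_real (((\<integral>\<omega>. (f \<omega> + g \<omega>)\<^sup>2 \<partial>M) - (\<integral>\<omega>. f \<omega> + g \<omega> \<partial>M)\<^sup>2) / 2))"
    unfolding e1 e2 using f g
    by (simp add: gaussian_char_def mult_exp_exp power2_eq_square algebra_simps add_divide_distrib diff_divide_distrib)
  finally show ?thesis using square_integrable_add[OF L] by (simp add: gaussian_char_def)
qed

section \<open>Orthogonality implies a vanishing conditional expectation\<close>

text \<open>The positive and negative parts of W have a common mass c. Divided by c they are
  densities of probability measures whose images under Y have the same characteristic function, so
  these images agree by Levy's uniqueness theorem.\<close>

lemma (in prob_space) weighted_char_unique_real:
  fixes W Y :: "'a \<Rightarrow> real"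
  assumes W: "integrable M W" and [measurable]: "Y \<in> borel_measurable M"
    and char0: "\<And>\<theta>. (\<integral>\<omega>. complex_of_real (W \<omega>) * iexp (\<theta> * Y \<omega>) \<partial>M) = 0"
    and [measurable]: "B \<in> sets borel"
  shows "(\<integral>\<omega>. W \<omega> * indicator B (Y \<omega>) \<partial>M) = 0"
proof -
  have [measurable]: "W \<in> borel_measurable M" using W by simp
  define Wp Wm where "Wp \<omega> = max 0 (W \<omega>)" and "Wm \<omega> = max 0 (- W \<omega>)" for \<omega>
  have Wpm: "integrable M Wp" "integrable M Wm" using W by (auto simp: Wp_def[abs_def] Wm_def[abs_def])
  then have [measurable]: "Wp \<in> borel_measurable M" "Wm \<in> borel_measurable M" by auto
  have Weq: "W \<omega> = Wp \<omega> - Wm \<omega>" for \<omega> by (simp add: Wp_def Wm_def)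
  have pos: "0 \<le> Wp \<omega>" "0 \<le> Wm \<omega>" for \<omega> by (simp_all add: Wp_def Wm_def)
  define c where "c = (\<integral>\<omega>. Wp \<omega> \<partial>M)"
  \<comment> \<open>Frequency 0: the two parts of W have the same mass.\<close>
  have "complex_of_real (\<integral>\<omega>. W \<omega> \<partial>M) = 0"
    using char0[of 0] by (simp flip: integral_complex_of_real)
  then have c': "c = (\<integral>\<omega>. Wm \<omega> \<partial>M)"
    using Wpm by (simp add: Weq c_def)
  have ci: "integrable M (\<lambda>\<omega>. complex_of_real (U \<omega>) * iexp (\<theta> * Y \<omega>))" if "integrable M U" for U \<theta>
    by (rule Bochner_Integration.integrable_bound[OF that])
       (use that in \<open>auto simp: norm_mult\<close>)
  have bi: "integrable M (\<lambda>\<omega>. U \<omega> * indicator B (Y \<omega>))" if "integrable M U" for U :: "'a \<Rightarrow> real"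
    by (rule Bochner_Integration.integrable_bound[OF that])
       (use that in \<open>auto split: split_indicator\<close>)
  show ?thesis
  proof (cases "c = 0")
    \<comment> \<open>Here normalisation is impossible, but both parts vanish almost surely.\<close>
    case True
    have "expectation Wp = 0" "expectation Wm = 0" using True c' by (simp_all add: c_def)
    then have "AE \<omega> in M. Wp \<omega> = 0" "AE \<omega> in M. Wm \<omega> = 0"
      using Wpm pos by (simp_all add: integral_nonneg_eq_0_iff_AE)
    then have "AE \<omega> in M. W \<omega> * indicator B (Y \<omega>) = 0"
      by eventually_elim (simp add: Weq)
    then show ?thesis by (simp add: integral_eq_zero_AE)
  next
    case False
    have "c \<ge> 0" using pos by (simp add: c_def)
    with False have c: "c > 0" by simp
    define \<nu> where "\<nu> U = distr (density M (\<lambda>\<omega>. ennreal (U \<omega> / c))) borel Y" for U :: "'a \<Rightarrow> real"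
    { fix U assume U: "integrable M U" "\<And>\<omega>. 0 \<le> U \<omega>" "(\<integral>\<omega>. U \<omega> \<partial>M) = c"
      then have [measurable]: "U \<in> borel_measurable M" by auto
      have Up: "0 \<le> U \<omega> / c" for \<omega> using U c by simp
      have "emeasure (density M (\<lambda>\<omega>. ennreal (U \<omega> / c))) (space M) = (\<integral>\<^sup>+\<omega>. ennreal (U \<omega> / c) \<partial>M)"
        by (subst emeasure_density) (auto intro!: nn_integral_cong)
      also have "\<dots> = ennreal (\<integral>\<omega>. U \<omega> / c \<partial>M)"
        by (rule nn_integral_eq_integral) (use U c in auto)
      also have "\<dots> = 1" using U c by simp
      finally have "prob_space (density M (\<lambda>\<omega>. ennreal (U \<omega> / c)))"
        by (intro prob_spaceI) simp
      then have rd: "real_distribution (\<nu> U)"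
        unfolding \<nu>_def by (rule prob_space.real_distribution_distr) simp
      have ch: "char (\<nu> U) \<theta> = (\<integral>\<omega>. complex_of_real (U \<omega>) * iexp (\<theta> * Y \<omega>) \<partial>M) / c" for \<theta>
      proof -
        have "char (\<nu> U) \<theta> = (\<integral>\<omega>. iexp (\<theta> * Y \<omega>) \<partial>density M (\<lambda>\<omega>. ennreal (U \<omega> / c)))"
          unfolding char_def \<nu>_def by (subst integral_distr) auto
        also have "\<dots> = (\<integral>\<omega>. (U \<omega> / c) *\<^sub>R iexp (\<theta> * Y \<omega>) \<partial>M)"
          by (subst integral_density) (use Up in auto)
        also have "\<dots> = (\<integral>\<omega>. (complex_of_real (U \<omega>) * iexp (\<theta> * Y \<omega>)) / c \<partial>M)"
          by (simp add: scaleR_conv_of_real)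
        finally show ?thesis by simp
      qed
      have ms: "measure (\<nu> U) B = (\<integral>\<omega>. U \<omega> * indicator B (Y \<omega>) \<partial>M) / c"
      proof -
        interpret N: real_distribution "\<nu> U" by fact
        have "measure (\<nu> U) B = (\<integral>y. indicator B y \<partial>\<nu> U)" by simp
        also have "\<dots> = (\<integral>\<omega>. indicator B (Y \<omega>) \<partial>density M (\<lambda>\<omega>. ennreal (U \<omega> / c)))"
          unfolding \<nu>_def by (subst integral_distr) auto
        also have "\<dots> = (\<integral>\<omega>. (U \<omega> / c) *\<^sub>R indicator B (Y \<omega>) \<partial>M)"
          by (subst integral_density) (use Up in auto)
        finally show ?thesis by simp
      qed
      note rd ch ms }
    note N = this
    note Np = N[OF Wpm(1) pos(1) c_def[symmetric]] and Nm = N[OF Wpm(2) pos(2) c'[symmetric]]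
    have "char (\<nu> Wp) = char (\<nu> Wm)"
    proof
      fix \<theta>
      show "char (\<nu> Wp) \<theta> = char (\<nu> Wm) \<theta>"
        using char0[of \<theta>] ci[OF Wpm(1), of \<theta>] ci[OF Wpm(2), of \<theta>]
        unfolding Np(2) Nm(2) by (simp add: Weq left_diff_distrib)
    qed
    then have "\<nu> Wp = \<nu> Wm" by (rule Levy_uniqueness[OF Np(1) Nm(1)])
    then have "(\<integral>\<omega>. Wp \<omega> * indicator B (Y \<omega>) \<partial>M) = (\<integral>\<omega>. Wm \<omega> * indicator B (Y \<omega>) \<partial>M)"
      using Np(3) Nm(3) c by simp
    then show ?thesis
      using bi[OF Wpm(1)] bi[OF Wpm(2)] by (simp add: Weq left_diff_distrib)
  qed
qed

text \<open>Conjugating the hypothesis at frequency -\<theta> gives it for the conjugate weight at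
  \<theta>, so the real and imaginary parts of W satisfy it separately.\<close>

lemma (in prob_space) weighted_char_unique:
  fixes W :: "'a \<Rightarrow> complex" and Y :: "'a \<Rightarrow> real"
  assumes W: "integrable M W" and [measurable]: "Y \<in> borel_measurable M"
    and char0: "\<And>\<theta>. (\<integral>\<omega>. W \<omega> * iexp (\<theta> * Y \<omega>) \<partial>M) = 0"
    and [measurable]: "B \<in> sets borel"
  shows "(\<integral>\<omega>. W \<omega> * indicator B (Y \<omega>) \<partial>M) = 0"
proof -
  have [measurable]: "W \<in> borel_measurable M" using W by simp
  have ci: "integrable M (\<lambda>\<omega>. U \<omega> * iexp (\<theta> * Y \<omega>))" if "integrable M U" for U \<theta>
    by (rule Bochner_Integration.integrable_bound[OF that])
       (use that in \<open>auto simp: norm_mult\<close>)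
  have cW: "integrable M (\<lambda>\<omega>. cnj (W \<omega>))" using W by simp
  have cnj0: "(\<integral>\<omega>. cnj (W \<omega>) * iexp (\<theta> * Y \<omega>) \<partial>M) = 0" for \<theta>
  proof -
    have "(\<integral>\<omega>. cnj (W \<omega>) * iexp (\<theta> * Y \<omega>) \<partial>M) = (\<integral>\<omega>. cnj (W \<omega> * iexp ((-\<theta>) * Y \<omega>)) \<partial>M)"
      by (simp add: exp_cnj)
    also have "\<dots> = cnj (\<integral>\<omega>. W \<omega> * iexp ((-\<theta>) * Y \<omega>) \<partial>M)" 
      by (rule Bochner_Integration.integral_cnj)
    finally show ?thesis using char0[of "-\<theta>"] by simp
  qed
  have Re_eq: "complex_of_real (Re z) = (z + cnj z) / 2"
    and Im_eq: "complex_of_real (Im z) = (z - cnj z) / (2 * \<i>)" for z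
    by (simp_all add: complex_eq_iff)
  have re: "complex_of_real (Re z) * e = (z * e + cnj z * e) / 2"
    and im: "complex_of_real (Im z) * e = (z * e - cnj z * e) / (2 * \<i>)" for z e
    by (simp_all only: Re_eq Im_eq distrib_right left_diff_distrib times_divide_eq_left)
  have re0: "(\<integral>\<omega>. complex_of_real (Re (W \<omega>)) * iexp (\<theta> * Y \<omega>) \<partial>M) = 0"
    and im0: "(\<integral>\<omega>. complex_of_real (Im (W \<omega>)) * iexp (\<theta> * Y \<omega>) \<partial>M) = 0" for \<theta>
    unfolding re im using ci[OF W, of \<theta>] ci[OF cW, of \<theta>] char0[of \<theta>] cnj0[of \<theta>] by simp_all
  have "(\<integral>\<omega>. Re (W \<omega>) * indicator B (Y \<omega>) \<partial>M) = 0"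
    by (rule weighted_char_unique_real[OF _ _ re0]) (use W in simp_all)
  moreover have "(\<integral>\<omega>. Im (W \<omega>) * indicator B (Y \<omega>) \<partial>M) = 0"
    by (rule weighted_char_unique_real[OF _ _ im0]) (use W in simp_all)
  moreover have "integrable M (\<lambda>\<omega>. Re (W \<omega>) * indicator B (Y \<omega>))"
    "integrable M (\<lambda>\<omega>. Im (W \<omega>) * indicator B (Y \<omega>))"
    by (rule Bochner_Integration.integrable_bound[OF W];
        auto simp: abs_Re_le_cmod abs_Im_le_cmod split: split_indicator)+
  moreover have "W \<omega> * indicator B (Y \<omega>) = complex_of_real (Re (W \<omega>) * indicator B (Y \<omega>))
      + \<i> * complex_of_real (Im (W \<omega>) * indicator B (Y \<omega>))" for \<omega>
    by (auto simp: complex_eq_iff split: split_indicator)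
  ultimately show ?thesis
    by (simp del: of_real_mult)
qed

text \<open>The exponentials are replaced by indicators one coordinate at a time, so that the
  one-dimensional uniqueness theorem suffices.\<close>
lemma (in prob_space) weighted_char_unique_prod:
  fixes W :: "'a \<Rightarrow> complex" and Y :: "'i \<Rightarrow> 'a \<Rightarrow> real"
  assumes "finite I" and "integrable M W" and "\<And>i. i \<in> I \<Longrightarrow> Y i \<in> borel_measurable M"
    and "\<And>\<theta>. (\<integral>\<omega>. W \<omega> * iexp (\<Sum>i\<in>I. \<theta> i * Y i \<omega>) \<partial>M) = 0"
    and "\<And>i. B i \<in> sets borel"
  shows "(\<integral>\<omega>. W \<omega> * (\<Prod>i\<in>I. indicator (B i) (Y i \<omega>)) \<partial>M) = 0"
  using assms
proof (induction I arbitrary: W)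
  case empty
  then show ?case by simp
next
  case (insert k I)
  have [measurable]: "Y i \<in> borel_measurable M" if "i \<in> insert k I" for i using insert.prems(2) that .
  have [measurable]: "Y k \<in> borel_measurable M" using insert.prems(2) by simp
  have [measurable]: "W \<in> borel_measurable M" using insert.prems by simp
  note [measurable] = insert.prems(4)
  have iI: "integrable M (\<lambda>\<omega>. W \<omega> * (\<Prod>i\<in>I. indicator (B i) (Y i \<omega>)))"
  proof (rule Bochner_Integration.integrable_bound[OF insert.prems(1)])
    show "(\<lambda>\<omega>. W \<omega> * (\<Prod>i\<in>I. indicator (B i) (Y i \<omega>))) \<in> borel_measurable M"
      by measurable
    have "norm (\<Prod>i\<in>I. indicator (B i) (Y i \<omega>) :: complex) \<le> 1" for \<omega>
      unfolding prod_norm[symmetric] by (rule prod_le_1) (auto split: split_indicator)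
    then show "AE \<omega> in M. norm (W \<omega> * (\<Prod>i\<in>I. indicator (B i) (Y i \<omega>))) \<le> norm (W \<omega>)"
      by (auto simp: norm_mult mult_left_le)
  qed
  have *: "(\<integral>\<omega>. (W \<omega> * (\<Prod>i\<in>I. indicator (B i) (Y i \<omega>))) * iexp (t * Y k \<omega>) \<partial>M) = 0" for t
  proof -
    \<comment> \<open>The exponential of the new coordinate is absorbed into the weight before the
      induction hypothesis is used; this is why weights are complex and why W is generalised in the
      induction.\<close>
    have "(\<integral>\<omega>. (W \<omega> * iexp (t * Y k \<omega>)) * (\<Prod>i\<in>I. indicator (B i) (Y i \<omega>)) \<partial>M) = 0"
    proof (rule insert.IH)
      show "integrable M (\<lambda>\<omega>. W \<omega> * iexp (t * Y k \<omega>))"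
        by (rule Bochner_Integration.integrable_bound[OF insert.prems(1)]) (auto simp: norm_mult)
      fix \<theta> :: "'i \<Rightarrow> real"
      have "(\<Sum>i\<in>insert k I. (\<theta>(k := t)) i * Y i \<omega>) = t * Y k \<omega> + (\<Sum>i\<in>I. \<theta> i * Y i \<omega>)" for \<omega>
      proof -
        have "(\<Sum>i\<in>I. (\<theta>(k := t)) i * Y i \<omega>) = (\<Sum>i\<in>I. \<theta> i * Y i \<omega>)"
          by (rule sum.cong) (use insert.hyps in auto)
        then show ?thesis using insert.hyps by simp
      qed
      then show "(\<integral>\<omega>. (W \<omega> * iexp (t * Y k \<omega>)) * iexp (\<Sum>i\<in>I. \<theta> i * Y i \<omega>) \<partial>M) = 0"
        using insert.prems(3)[of "\<theta>(k := t)"] by (simp add: exp_add distrib_left mult.assoc)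
    qed (use insert.prems in auto)
    then show ?thesis by (simp add: mult_ac)
  qed
  have "(\<integral>\<omega>. (W \<omega> * (\<Prod>i\<in>I. indicator (B i) (Y i \<omega>))) * indicator (B k) (Y k \<omega>) \<partial>M) = 0"
    by (rule weighted_char_unique[OF iI _ *]) (use insert.prems in auto)
  then show ?case using insert.hyps by (simp add: mult_ac)
qed

section \<open>Generated sigma-algebras\<close>

lemma space_generated_sigma [simp]: "space (generated_sigma M I X) = space M"
  unfolding generated_sigma_def by (rule space_measure_of) auto

lemma sets_generated_sigma:
  "sets (generated_sigma M I X) = sigma_sets (space M) (\<Union>i\<in>I. {X i -` B \<inter> space M | B. B \<in> sets borel})"
  unfolding generated_sigma_def by (rule sets_measure_of) auto

lemma measurable_generated_sigma:
  fixes X :: "'i \<Rightarrow> 'w \<Rightarrow> 'b::topological_space"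
  assumes "i \<in> I"
  shows "X i \<in> borel_measurable (generated_sigma M I X)"
proof (rule measurableI)
  fix B :: "'b set" assume "B \<in> sets borel"
  then show "X i -` B \<inter> space (generated_sigma M I X) \<in> sets (generated_sigma M I X)"
    unfolding sets_generated_sigma space_generated_sigma using assms by (intro sigma_sets.Basic) auto
qed simp

lemma generated_sigma_least:
  assumes "space N = space M" and "\<And>i. i \<in> I \<Longrightarrow> X i \<in> borel_measurable N"
  shows "sets (generated_sigma M I X) \<subseteq> sets N"
  unfolding sets_generated_sigma assms(1)[symmetric]
  by (rule sets.sigma_sets_subset) (use assms(2) in \<open>auto intro: measurable_sets\<close>)

lemma generated_sigma_subalgebra:
  assumes "\<And>i. i \<in> I \<Longrightarrow> X i \<in> borel_measurable M"
  shows "subalgebra M (generated_sigma M I X)"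
  unfolding subalgebra_def using generated_sigma_least[of M M I X] assms by auto

lemma generated_sigma_mono:
  assumes "I \<subseteq> J"
  shows "sets (generated_sigma M I X) \<subseteq> sets (generated_sigma M J X)"
  by (rule generated_sigma_least) (use assms in \<open>auto intro: measurable_generated_sigma\<close>)

lemma measurable_generated_sigma_mono:
  assumes "f \<in> borel_measurable (generated_sigma M I X)" "I \<subseteq> J"
  shows "f \<in> borel_measurable (generated_sigma M J X)"
  using assms generated_sigma_mono[of I J M X] by (auto simp: measurable_def)

section \<open>From uncorrelated to orthogonal to all functions of the observations\<close>

text \<open>The transform \<phi>(s) of s u + V is explicit for every s. Since u is centred and
  uncorrelated with V, its exponent has no term linear in s, so \<phi>(s) = \<phi>(0) exp(-s^2 c /
  2) with c = E u^2. The claim is that the derivative at 0 vanishes; it is read off from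
  second-order remainders, without differentiating under the integral.\<close>

lemma (in prob_space) gaussian_char_orthogonal:
  assumes u: "square_integrable M u" and V: "square_integrable M V"
    and G: "\<And>s. gaussian_char M (\<lambda>\<omega>. s * u \<omega> + V \<omega>)"
    and u0: "expectation u = 0" and uV: "expectation (\<lambda>\<omega>. u \<omega> * V \<omega>) = 0"
  shows "(\<integral>\<omega>. complex_of_real (u \<omega>) * iexp (V \<omega>) \<partial>M) = 0"
proof -
  have [measurable]: "u \<in> borel_measurable M" "V \<in> borel_measurable M"
    using u V by (auto simp: square_integrable_def)
  define c where "c = expectation (\<lambda>\<omega>. (u \<omega>)\<^sup>2)"
  define \<phi> where "\<phi> s = (\<integral>\<omega>. iexp (s * u \<omega> + V \<omega>) \<partial>M)" for s
  define I where "I = (\<integral>\<omega>. complex_of_real (u \<omega>) * iexp (V \<omega>) \<partial>M)"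
  note ui = square_integrable_integrable[OF u] and Vi = square_integrable_integrable[OF V]
  have c0: "c \<ge> 0" by (simp add: c_def)
  have \<phi>: "\<phi> s = \<phi> 0 * exp (- of_real (s\<^sup>2 * c / 2))" for s
  proof -
    have 1: "\<phi> s = exp (\<i> * of_real (expectation V) - of_real ((s\<^sup>2 * c + expectation (\<lambda>\<omega>. (V \<omega>)\<^sup>2) - (expectation V)\<^sup>2) / 2))" for s
    proof -
      have "expectation (\<lambda>\<omega>. (s * u \<omega> + V \<omega>)\<^sup>2)
          = expectation (\<lambda>\<omega>. s\<^sup>2 * (u \<omega>)\<^sup>2 + (2 * s) * (u \<omega> * V \<omega>) + (V \<omega>)\<^sup>2)"
        by (simp add: power2_eq_square algebra_simps)
      also have "\<dots> = s\<^sup>2 * c + expectation (\<lambda>\<omega>. (V \<omega>)\<^sup>2)"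
        using u V square_integrable_mult[OF u V] uV by (simp add: square_integrable_def c_def)
      finally show ?thesis using G[of s] ui Vi u0
        by (simp add: gaussian_char_def \<phi>_def)
    qed
    show ?thesis unfolding 1[of s] 1[of 0]
      by (simp add: mult_exp_exp algebra_simps add_divide_distrib diff_divide_distrib)
  qed
  have \<phi>0: "norm (\<phi> 0) \<le> 1"
  proof -
    have "norm (\<phi> 0) \<le> (\<integral>\<omega>. norm (iexp (0 * u \<omega> + V \<omega>)) \<partial>M)" unfolding \<phi>_def
      by (rule integral_norm_bound)
    then show ?thesis by (simp add: prob_space)
  qed
  have ei: "integrable M (\<lambda>\<omega>. iexp (f \<omega>))" if [measurable]: "f \<in> borel_measurable M" for f
    by (rule integrable_const_bound[of _ 1]) auto
  have uei: "integrable M (\<lambda>\<omega>. complex_of_real (u \<omega>) * iexp (V \<omega>))"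
    by (rule Bochner_Integration.integrable_bound[OF ui]) (auto simp: norm_mult)
  \<comment> \<open>Both \<phi>(s) - \<phi>(0) and this difference minus i s I have modulus at most
    s^2 c / 2. Hence s |I| is at most s^2 c, and s can be made small.\<close>
  have main: "norm I \<le> s * c" if s: "s > 0" for s
  proof -
    have "norm (\<phi> s - \<phi> 0 - \<i> * s * I) \<le> s\<^sup>2 * c / 2"
    proof -
      have "\<phi> s - \<phi> 0 - \<i> * s * I
          = (\<integral>\<omega>. iexp (s * u \<omega> + V \<omega>) - iexp (V \<omega>) - \<i> * s * (complex_of_real (u \<omega>) * iexp (V \<omega>)) \<partial>M)"
        unfolding \<phi>_def I_def using uei ei[of "\<lambda>\<omega>. s * u \<omega> + V \<omega>"] ei[of V]
        by (simp del: of_real_add of_real_mult)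
      also have "norm \<dots> \<le> (\<integral>\<omega>. s\<^sup>2 * (u \<omega>)\<^sup>2 / 2 \<partial>M)"
      proof (rule order_trans[OF integral_norm_bound integral_mono])
        show "integrable M (\<lambda>\<omega>. norm (iexp (s * u \<omega> + V \<omega>) - iexp (V \<omega>) - \<i> * s * (complex_of_real (u \<omega>) * iexp (V \<omega>))))"
          using uei ei[of "\<lambda>\<omega>. s * u \<omega> + V \<omega>"] ei[of V]
          by (simp del: of_real_add of_real_mult)
        show "integrable M (\<lambda>\<omega>. s\<^sup>2 * (u \<omega>)\<^sup>2 / 2)" using u by (simp add: square_integrable_def)
        fix \<omega>
        have "iexp (s * u \<omega> + V \<omega>) - iexp (V \<omega>) - \<i> * s * (complex_of_real (u \<omega>) * iexp (V \<omega>))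
            = (iexp (s * u \<omega>) - (\<Sum>k\<le>1. (\<i> * (s * u \<omega>))^k / fact k)) * iexp (V \<omega>)"
          by (simp add: exp_add distrib_left algebra_simps)
        then show "norm (iexp (s * u \<omega> + V \<omega>) - iexp (V \<omega>) - \<i> * s * (complex_of_real (u \<omega>) * iexp (V \<omega>))) \<le> s\<^sup>2 * (u \<omega>)\<^sup>2 / 2"
          using iexp_approx1[of "s * u \<omega>" 1]
          by (simp add: norm_mult power_mult_distrib numeral_2_eq_2 mult_ac del: sum.atMost_Suc)
      qed
      also have "\<dots> = s\<^sup>2 * c / 2" by (simp add: c_def)
      finally show ?thesis .
    qed
    moreover have "norm (\<phi> s - \<phi> 0) \<le> s\<^sup>2 * c / 2"
    proof -
      have "\<phi> s - \<phi> 0 = - \<phi> 0 * of_real (1 - exp (- (s\<^sup>2 * c / 2)))"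
        unfolding \<phi>[of s] by (simp add: algebra_simps exp_of_real[symmetric] del: exp_of_real)
      then have "norm (\<phi> s - \<phi> 0) = norm (\<phi> 0) * \<bar>1 - exp (- (s\<^sup>2 * c / 2))\<bar>"
        by (metis norm_minus_cancel norm_mult norm_of_real)
      also have "\<dots> \<le> 1 * \<bar>1 - exp (- (s\<^sup>2 * c / 2))\<bar>" by (rule mult_right_mono[OF \<phi>0]) simp
      also have "\<dots> = 1 - exp (- (s\<^sup>2 * c / 2))" using c0 by simp
      also have "\<dots> \<le> s\<^sup>2 * c / 2" using exp_ge_add_one_self[of "- (s\<^sup>2 * c / 2)"] by simp
      finally show ?thesis .
    qed
    ultimately have "norm (\<i> * s * I) \<le> s\<^sup>2 * c"
      using norm_triangle_ineq4[of "\<phi> s - \<phi> 0" "\<phi> s - \<phi> 0 - \<i> * s * I"] by simp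
    then show ?thesis using s by (simp add: norm_mult power2_eq_square)
  qed
  have "norm I \<le> 0"
  proof (rule field_le_epsilon)
    fix e :: real assume e: "e > 0"
    have "norm I \<le> e / (c + 1) * c" using c0 e by (intro main) (auto intro: divide_pos_pos)
    also have "\<dots> \<le> e" using c0 e by (simp add: field_simps)
    finally show "norm I \<le> 0 + e" by simp
  qed
  then show ?thesis by (simp add: I_def)
qed

text \<open>The rectangles {Y_i in B_i for all i} are stable under intersection and generate the
  sigma-algebra. The indicator of a rectangle is a product of coordinate indicators, so
  orthogonality of u to all exponentials of linear combinations passes to rectangles by
  \<open>weighted_char_unique_prod\<close>; an induction over disjoint unions and complements
  reaches the remaining sets.\<close>

lemma (in prob_space) gaussian_orthogonal_sets:
  assumes fin: "finite I" and u: "square_integrable M u"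
    and Y: "\<And>i. i \<in> I \<Longrightarrow> square_integrable M (Y i)"
    and G: "\<And>s \<theta>. gaussian_char M (\<lambda>\<omega>. s * u \<omega> + (\<Sum>i\<in>I. \<theta> i * Y i \<omega>))"
    and u0: "expectation u = 0" and uY: "\<And>i. i \<in> I \<Longrightarrow> expectation (\<lambda>\<omega>. u \<omega> * Y i \<omega>) = 0"
    and A: "A \<in> sets (generated_sigma M I Y)"
  shows "expectation (\<lambda>\<omega>. u \<omega> * indicator A \<omega>) = 0"
proof -
  note ui = square_integrable_integrable[OF u]
  have Ym[measurable]: "Y i \<in> borel_measurable M" if "i \<in> I" for i
    using Y that by (auto simp: square_integrable_def)
  have um[measurable]: "u \<in> borel_measurable M" using u by (simp add: square_integrable_def)
  define G where "G = {{\<omega> \<in> space M. \<forall>i\<in>I. Y i \<omega> \<in> B i} | B. \<forall>i. B i \<in> sets (borel :: real measure)}"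
  have GM: "G \<subseteq> sets M"
  proof
    fix S assume "S \<in> G"
    then obtain B where S: "S = {\<omega> \<in> space M. \<forall>i\<in>I. Y i \<omega> \<in> B i}" and B: "\<And>i. B i \<in> sets borel"
      by (auto simp: G_def)
    have "{\<omega> \<in> space M. Y i \<omega> \<in> B i} \<in> sets M" if "i \<in> I" for i
      using measurable_sets[OF Ym[OF that] B[of i]] by (simp add: vimage_def Int_def conj_commute)
    then show "S \<in> sets M" unfolding S by (rule sets.sets_Collect_finite_All[OF _ fin])
  qed
  have 1: "expectation (\<lambda>\<omega>. u \<omega> * indicator S \<omega>) = 0" if "S \<in> G" for S
  proof -
    obtain B where S: "S = {\<omega> \<in> space M. \<forall>i\<in>I. Y i \<omega> \<in> B i}" and B: "\<And>i. B i \<in> sets borel"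
      using \<open>S \<in> G\<close> by (auto simp: G_def)
    have "(\<integral>\<omega>. complex_of_real (u \<omega>) * (\<Prod>i\<in>I. indicator (B i) (Y i \<omega>)) \<partial>M) = 0"
    proof (rule weighted_char_unique_prod[OF fin])
      fix \<theta> :: "'b \<Rightarrow> real"
      have uS: "expectation (\<lambda>\<omega>. u \<omega> * (\<Sum>i\<in>I. \<theta> i * Y i \<omega>)) = 0"
      proof -
        have "expectation (\<lambda>\<omega>. u \<omega> * (\<Sum>i\<in>I. \<theta> i * Y i \<omega>))
            = expectation (\<lambda>\<omega>. \<Sum>i\<in>I. \<theta> i * (u \<omega> * Y i \<omega>))"
          by (simp add: sum_distrib_left mult_ac)
        also have "\<dots> = 0"
          using square_integrable_mult[OF u Y] uY by (subst Bochner_Integration.integral_sum) auto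
        finally show ?thesis .
      qed
      show "(\<integral>\<omega>. complex_of_real (u \<omega>) * iexp (\<Sum>i\<in>I. \<theta> i * Y i \<omega>) \<partial>M) = 0"
        by (rule gaussian_char_orthogonal[OF u square_integrable_sum[OF square_integrable_cmult[OF Y]] assms(4) u0 uS])
    qed (use ui Ym B in auto)
    moreover have "(\<integral>\<omega>. complex_of_real (u \<omega>) * (\<Prod>i\<in>I. indicator (B i) (Y i \<omega>)) \<partial>M)
        = (\<integral>\<omega>. complex_of_real (u \<omega> * indicator S \<omega>) \<partial>M)"
    proof (rule Bochner_Integration.integral_cong[OF refl])
      fix \<omega> assume w: "\<omega> \<in> space M"
      have "(\<Prod>i\<in>I. indicator (B i) (Y i \<omega>)) = (indicator S \<omega> :: complex)"
      proof (cases "\<forall>i\<in>I. Y i \<omega> \<in> B i")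
        case True then show ?thesis using w by (simp add: S)
      next
        case False
        then obtain i where "i \<in> I" "Y i \<omega> \<notin> B i" by auto
        then have "(\<Prod>i\<in>I. indicator (B i) (Y i \<omega>)) = (0 :: complex)"
          by (intro prod_zero[OF fin] bexI[of _ i]) auto
        then show ?thesis using False by (simp add: S)
      qed
      then show "complex_of_real (u \<omega>) * (\<Prod>i\<in>I. indicator (B i) (Y i \<omega>)) = complex_of_real (u \<omega> * indicator S \<omega>)"
        by (simp add: indicator_def)
    qed
    ultimately show ?thesis by (simp only: integral_complex_of_real) simp
  qed
  have GI: "Int_stable G"
  proof (rule Int_stableI)
    fix a b assume "a \<in> G" "b \<in> G"
    then obtain B B' where "a = {\<omega> \<in> space M. \<forall>i\<in>I. Y i \<omega> \<in> B i}" "\<forall>i. B i \<in> sets borel"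
      "b = {\<omega> \<in> space M. \<forall>i\<in>I. Y i \<omega> \<in> B' i}" "\<forall>i. B' i \<in> sets borel" unfolding G_def by blast
    then show "a \<inter> b \<in> G" unfolding G_def
      by (intro CollectI exI[of _ "\<lambda>i. B i \<inter> B' i"]) auto
  qed
  have AG: "A \<in> sigma_sets (space M) G"
  proof -
    have "sigma_sets (space M) (\<Union>i\<in>I. {Y i -` B \<inter> space M | B. B \<in> sets borel}) \<subseteq> sigma_sets (space M) G"
    proof (rule sigma_sets_mono', rule subsetI)
      fix S assume "S \<in> (\<Union>i\<in>I. {Y i -` B \<inter> space M | B. B \<in> sets borel})"
      then obtain i B where "i \<in> I" "B \<in> sets borel" "S = Y i -` B \<inter> space M" by auto
      then show "S \<in> G" unfolding G_def
        by (intro CollectI exI[of _ "\<lambda>j. if j = i then B else UNIV"]) auto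
    qed
    then show ?thesis using A by (auto simp: sets_generated_sigma)
  qed
  have GP: "G \<subseteq> Pow (space M)" by (auto simp: G_def)
  have sM: "sigma_sets (space M) G \<subseteq> sets M" by (rule sets.sigma_sets_subset[OF GM])
  have iS: "integrable M (\<lambda>\<omega>. u \<omega> * indicator S \<omega>)" if "S \<in> sets M" for S
    by (rule integrable_mult_indicator[OF that ui, unfolded real_scaleR_def, simplified mult.commute])
  show ?thesis using GI GP AG
  proof (induction rule: sigma_sets_induct_disjoint)
    case (basic S) then show ?case by (rule 1)
  next
    case empty then show ?case by simp
  next
    case (compl S)
    have S: "S \<in> sets M" using compl sM by auto
    have "expectation (\<lambda>\<omega>. u \<omega> * indicator (space M - S) \<omega>) = expectation (\<lambda>\<omega>. u \<omega> - u \<omega> * indicator S \<omega>)"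
      by (rule Bochner_Integration.integral_cong) (auto split: split_indicator)
    then show ?case using compl ui iS[OF S] u0 by simp
  next
    case (union S)
    have S: "S i \<in> sets M" for i using union sM by auto
    have U: "(\<Union>i. S i) \<in> sets M" using S by auto
    have "expectation (\<lambda>\<omega>. u \<omega> * indicator (\<Union>i. S i) \<omega>) = (\<integral>\<omega>\<in>(\<Union>i. S i). u \<omega> \<partial>M)"
      by (simp add: set_lebesgue_integral_def mult.commute)
    also have "\<dots> = (\<Sum>i. \<integral>\<omega>\<in>S i. u \<omega> \<partial>M)"
      by (rule lebesgue_integral_countable_add)
         (use S union iS[OF U] in \<open>auto simp: disjoint_family_on_def set_integrable_def mult.commute\<close>)
    also have "\<dots> = 0" using union.IH by (simp add: set_lebesgue_integral_def mult.commute)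
    finally show ?case .
  qed
qed

section \<open>Projections and approximation in mean square\<close>

text \<open>One Gram-Schmidt step per function: the new function is replaced by its residual r
  against the old ones, and a multiple t of r is removed from the old residual v of u. The family
  may be linearly dependent.\<close>

lemma square_integrable_projection:
  fixes Y :: "'i \<Rightarrow> 'w \<Rightarrow> real"
  assumes "finite I" and "square_integrable M u" and "\<And>i. i \<in> I \<Longrightarrow> square_integrable M (Y i)"
  shows "\<exists>a. \<forall>j\<in>I. (\<integral>\<omega>. (u \<omega> - (\<Sum>i\<in>I. a i * Y i \<omega>)) * Y j \<omega> \<partial>M) = 0"
  using assms
proof (induction I arbitrary: u)
  case empty
  then show ?case by simp
next
  case (insert k I)
  have Y: "square_integrable M (Y i)" if "i \<in> insert k I" for i using insert.prems(2) that .
  obtain b where b: "\<forall>j\<in>I. (\<integral>\<omega>. (Y k \<omega> - (\<Sum>i\<in>I. b i * Y i \<omega>)) * Y j \<omega> \<partial>M) = 0"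
    using insert.IH[of "Y k"] Y by auto
  obtain a where a: "\<forall>j\<in>I. (\<integral>\<omega>. (u \<omega> - (\<Sum>i\<in>I. a i * Y i \<omega>)) * Y j \<omega> \<partial>M) = 0"
    using insert.IH[of u] insert.prems by auto
  define r where "r \<omega> = Y k \<omega> - (\<Sum>i\<in>I. b i * Y i \<omega>)" for \<omega>
  define v where "v \<omega> = u \<omega> - (\<Sum>i\<in>I. a i * Y i \<omega>)" for \<omega>
  have r: "square_integrable M r" and v: "square_integrable M v" unfolding r_def[abs_def] v_def[abs_def]
    using Y insert.prems
    by (auto intro!: square_integrable_diff square_integrable_sum square_integrable_cmult)
  define t where "t = (\<integral>\<omega>. v \<omega> * r \<omega> \<partial>M) / (\<integral>\<omega>. (r \<omega>)\<^sup>2 \<partial>M)"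
  define v' where "v' \<omega> = v \<omega> - t * r \<omega>" for \<omega>
  have v': "square_integrable M v'" unfolding v'_def[abs_def]
    by (intro square_integrable_diff square_integrable_cmult v r)
  \<comment> \<open>If r has norm zero, t is 0 by the convention for division, and Cauchy-Schwarz
    makes the pairing of v with r vanish too.\<close>
  have t: "t * (\<integral>\<omega>. (r \<omega>)\<^sup>2 \<partial>M) = (\<integral>\<omega>. v \<omega> * r \<omega> \<partial>M)"
    using square_integrable_cauchy_schwarz[OF v r]
    by (cases "(\<integral>\<omega>. (r \<omega>)\<^sup>2 \<partial>M) = 0") (auto simp: t_def)
  have v'r: "(\<integral>\<omega>. v' \<omega> * r \<omega> \<partial>M) = 0"
  proof -
    have "(\<integral>\<omega>. v' \<omega> * r \<omega> \<partial>M) = (\<integral>\<omega>. v \<omega> * r \<omega> - t * (r \<omega>)\<^sup>2 \<partial>M)"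
      by (simp add: v'_def algebra_simps power2_eq_square)
    then show ?thesis using t square_integrable_mult[OF v r] r by (simp add: square_integrable_def)
  qed
  have v'I: "(\<integral>\<omega>. v' \<omega> * Y j \<omega> \<partial>M) = 0" if j: "j \<in> I" for j
  proof -
    have "(\<integral>\<omega>. v' \<omega> * Y j \<omega> \<partial>M) = (\<integral>\<omega>. v \<omega> * Y j \<omega> - t * (r \<omega> * Y j \<omega>) \<partial>M)"
      by (simp add: v'_def algebra_simps)
    then show ?thesis using a b j square_integrable_mult[OF v Y] square_integrable_mult[OF r Y]
      by (simp add: v_def r_def)
  qed
  have v'k: "(\<integral>\<omega>. v' \<omega> * Y k \<omega> \<partial>M) = 0"
  proof -
    have "(\<integral>\<omega>. v' \<omega> * Y k \<omega> \<partial>M) = (\<integral>\<omega>. v' \<omega> * r \<omega> + (\<Sum>i\<in>I. b i * (v' \<omega> * Y i \<omega>)) \<partial>M)"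
      by (simp add: r_def algebra_simps sum_distrib_left)
    also have "\<dots> = (\<Sum>i\<in>I. b i * (\<integral>\<omega>. v' \<omega> * Y i \<omega> \<partial>M))"
      using square_integrable_mult[OF v' r] square_integrable_mult[OF v' Y] v'r by simp
    finally show ?thesis using v'I by simp
  qed
  have "u \<omega> - (\<Sum>i\<in>insert k I. ((\<lambda>i. a i - t * b i)(k := t)) i * Y i \<omega>) = v' \<omega>" for \<omega>
  proof -
    have "(\<Sum>i\<in>I. ((\<lambda>i. a i - t * b i)(k := t)) i * Y i \<omega>) = (\<Sum>i\<in>I. (a i - t * b i) * Y i \<omega>)"
      by (rule sum.cong) (use insert.hyps in auto)
    then show ?thesis using insert.hyps
      by (simp add: v'_def v_def r_def algebra_simps sum_subtractf sum_distrib_left)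
  qed
  then show ?case using v'I v'k by (intro exI[of _ "(\<lambda>i. a i - t * b i)(k := t)"]) simp
qed

text \<open>The constant function 1 joins the family under the index \<open>None\<close>;
  orthogonality to it is the vanishing mean.\<close>

lemma (in finite_measure) square_integrable_affine_projection:
  fixes Y :: "'i \<Rightarrow> 'a \<Rightarrow> real"
  assumes "finite I" and "square_integrable M u" and "\<And>i. i \<in> I \<Longrightarrow> square_integrable M (Y i)"
  shows "\<exists>a c. (\<integral>\<omega>. u \<omega> - (c + (\<Sum>i\<in>I. a i * Y i \<omega>)) \<partial>M) = 0 \<and>
    (\<forall>j\<in>I. (\<integral>\<omega>. (u \<omega> - (c + (\<Sum>i\<in>I. a i * Y i \<omega>))) * Y j \<omega> \<partial>M) = 0)"
proof -
  define Z where "Z = case_option (\<lambda>_. 1) Y"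
  obtain a where a: "\<forall>j\<in>insert None (Some ` I). (\<integral>\<omega>. (u \<omega> - (\<Sum>i\<in>insert None (Some ` I). a i * Z i \<omega>)) * Z j \<omega> \<partial>M) = 0"
  proof (atomize_elim, rule square_integrable_projection[OF _ assms(2)])
    show "finite (insert None (Some ` I))" using assms(1) by simp
    show "square_integrable M (Z i)" if "i \<in> insert None (Some ` I)" for i
      using that assms(3) by (auto simp: Z_def square_integrable_const)
  qed
  have "(\<Sum>i\<in>insert None (Some ` I). a i * Z i \<omega>) = a None + (\<Sum>i\<in>I. (a \<circ> Some) i * Y i \<omega>)" for \<omega>
    using assms(1) by (subst sum.insert) (auto simp: Z_def sum.reindex)
  with a have "\<forall>j\<in>insert None (Some ` I). (\<integral>\<omega>. (u \<omega> - (a None + (\<Sum>i\<in>I. (a \<circ> Some) i * Y i \<omega>))) * Z j \<omega> \<partial>M) = 0"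
    by (simp only:)
  then show ?thesis
    by (intro exI[of _ "a \<circ> Some"] exI[of _ "a None"]) (auto simp: Z_def)
qed

section \<open>Reduction to finitely many observations\<close>

text \<open>Closeness is measured in mean, which suits induction over sets and simple functions. For
  bounded functions it is later improved to mean square by clipping the approximant.\<close>

definition finitely_approximable ::
    "'w measure \<Rightarrow> 'i set \<Rightarrow> ('i \<Rightarrow> 'w \<Rightarrow> 'b::topological_space) \<Rightarrow> ('w \<Rightarrow> real) \<Rightarrow> bool" where
  "finitely_approximable M I X f \<longleftrightarrow> integrable M f \<and>
     (\<forall>\<epsilon>>0. \<exists>J g. finite J \<and> J \<subseteq> I \<and> g \<in> borel_measurable (generated_sigma M J X) \<and> integrable M g \<and>
        (\<integral>\<omega>. \<bar>f \<omega> - g \<omega>\<bar> \<partial>M) < \<epsilon>)"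

lemma finitely_approximableI:
  assumes "integrable M f" "finite J" "J \<subseteq> I" "f \<in> borel_measurable (generated_sigma M J X)"
  shows "finitely_approximable M I X f"
  unfolding finitely_approximable_def using assms by (auto intro!: exI[of _ J] exI[of _ f])

lemma finitely_approximable_add:
  assumes f: "finitely_approximable M I X f" and g: "finitely_approximable M I X g"
  shows "finitely_approximable M I X (\<lambda>\<omega>. f \<omega> + g \<omega>)"
  unfolding finitely_approximable_def
proof (intro conjI allI impI)
  have fi[simp]: "integrable M f" "integrable M g" using f g by (auto simp: finitely_approximable_def)
  then show "integrable M (\<lambda>\<omega>. f \<omega> + g \<omega>)" by simp
  fix \<epsilon> :: real assume "\<epsilon> > 0"
  then have "\<epsilon> / 2 > 0" by simp
  then obtain J f' K g' where J: "finite J" "J \<subseteq> I" "f' \<in> borel_measurable (generated_sigma M J X)" "integrable M f'"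
        "(\<integral>\<omega>. \<bar>f \<omega> - f' \<omega>\<bar> \<partial>M) < \<epsilon> / 2"
      and K: "finite K" "K \<subseteq> I" "g' \<in> borel_measurable (generated_sigma M K X)" "integrable M g'"
        "(\<integral>\<omega>. \<bar>g \<omega> - g' \<omega>\<bar> \<partial>M) < \<epsilon> / 2"
    using f g unfolding finitely_approximable_def by meson
  have "f' \<in> borel_measurable (generated_sigma M (J \<union> K) X)" "g' \<in> borel_measurable (generated_sigma M (J \<union> K) X)"
    using J K measurable_generated_sigma_mono[of _ M _ X "J \<union> K"] by auto
  then have "(\<lambda>\<omega>. f' \<omega> + g' \<omega>) \<in> borel_measurable (generated_sigma M (J \<union> K) X)" by simp
  moreover have "(\<integral>\<omega>. \<bar>f \<omega> + g \<omega> - (f' \<omega> + g' \<omega>)\<bar> \<partial>M) < \<epsilon>"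
  proof -
    have "(\<integral>\<omega>. \<bar>f \<omega> + g \<omega> - (f' \<omega> + g' \<omega>)\<bar> \<partial>M) \<le> (\<integral>\<omega>. \<bar>f \<omega> - f' \<omega>\<bar> + \<bar>g \<omega> - g' \<omega>\<bar> \<partial>M)"
      using J K by (intro integral_mono) auto
    also have "\<dots> < \<epsilon>" using J K by simp
    finally show ?thesis .
  qed
  ultimately show "\<exists>J h. finite J \<and> J \<subseteq> I \<and> h \<in> borel_measurable (generated_sigma M J X) \<and> integrable M h \<and>
        (\<integral>\<omega>. \<bar>f \<omega> + g \<omega> - h \<omega>\<bar> \<partial>M) < \<epsilon>"
    using J K by (intro exI[of _ "J \<union> K"] exI[of _ "\<lambda>\<omega>. f' \<omega> + g' \<omega>"]) auto
qed

lemma finitely_approximable_cmult: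
  assumes f: "finitely_approximable M I X f"
  shows "finitely_approximable M I X (\<lambda>\<omega>. c * f \<omega>)"
  unfolding finitely_approximable_def
proof (intro conjI allI impI)
  have fi[simp]: "integrable M f" using f by (auto simp: finitely_approximable_def)
  then show "integrable M (\<lambda>\<omega>. c * f \<omega>)" by simp
  fix \<epsilon> :: real assume e: "\<epsilon> > 0"
  then have "\<epsilon> / (\<bar>c\<bar> + 1) > 0" by (simp add: pos_divide_less_eq divide_pos_pos)
  then obtain J f' where J: "finite J" "J \<subseteq> I" "f' \<in> borel_measurable (generated_sigma M J X)" "integrable M f'"
        "(\<integral>\<omega>. \<bar>f \<omega> - f' \<omega>\<bar> \<partial>M) < \<epsilon> / (\<bar>c\<bar> + 1)"
    using f unfolding finitely_approximable_def by meson
  have "(\<lambda>\<omega>. c * f' \<omega>) \<in> borel_measurable (generated_sigma M J X)" using J(3) by simp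
  moreover have "(\<integral>\<omega>. \<bar>c * f \<omega> - c * f' \<omega>\<bar> \<partial>M) < \<epsilon>"
  proof -
    have "(\<integral>\<omega>. \<bar>c * f \<omega> - c * f' \<omega>\<bar> \<partial>M) = \<bar>c\<bar> * (\<integral>\<omega>. \<bar>f \<omega> - f' \<omega>\<bar> \<partial>M)"
      by (simp flip: right_diff_distrib add: abs_mult)
    also have "\<dots> \<le> \<bar>c\<bar> * (\<epsilon> / (\<bar>c\<bar> + 1))" using J by (intro mult_left_mono) auto
    also have "\<dots> < \<epsilon>" using e by (simp add: field_simps)
    finally show ?thesis .
  qed
  ultimately show "\<exists>J h. finite J \<and> J \<subseteq> I \<and> h \<in> borel_measurable (generated_sigma M J X) \<and> integrable M h \<and>
        (\<integral>\<omega>. \<bar>c * f \<omega> - h \<omega>\<bar> \<partial>M) < \<epsilon>"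
    using J by (intro exI[of _ J] exI[of _ "\<lambda>\<omega>. c * f' \<omega>"]) auto
qed

lemma finitely_approximable_limit:
  assumes s: "\<And>i::nat. finitely_approximable M I X (s i)" and f: "integrable M f"
    and lim: "(\<lambda>i. \<integral>\<omega>. \<bar>s i \<omega> - f \<omega>\<bar> \<partial>M) \<longlonglongrightarrow> 0"
  shows "finitely_approximable M I X f"
  unfolding finitely_approximable_def
proof (intro conjI allI impI f)
  fix \<epsilon> :: real assume e: "\<epsilon> > 0"
  then obtain i where i: "(\<integral>\<omega>. \<bar>s i \<omega> - f \<omega>\<bar> \<partial>M) < \<epsilon> / 2"
    using order_tendstoD(2)[OF lim, of "\<epsilon>/2"] by (auto simp: eventually_sequentially)
  have si: "integrable M (s i)" using s by (auto simp: finitely_approximable_def)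
  from e have "\<epsilon> / 2 > 0" by simp
  then obtain J g where J: "finite J" "J \<subseteq> I" "g \<in> borel_measurable (generated_sigma M J X)" "integrable M g"
        "(\<integral>\<omega>. \<bar>s i \<omega> - g \<omega>\<bar> \<partial>M) < \<epsilon> / 2"
    using s[of i] unfolding finitely_approximable_def by meson
  have "(\<integral>\<omega>. \<bar>f \<omega> - g \<omega>\<bar> \<partial>M) \<le> (\<integral>\<omega>. \<bar>s i \<omega> - f \<omega>\<bar> + \<bar>s i \<omega> - g \<omega>\<bar> \<partial>M)"
    using J f si by (intro integral_mono) auto
  also have "\<dots> < \<epsilon>" using J f si i by simp
  finally show "\<exists>J g. finite J \<and> J \<subseteq> I \<and> g \<in> borel_measurable (generated_sigma M J X) \<and> integrable M g \<and>
        (\<integral>\<omega>. \<bar>f \<omega> - g \<omega>\<bar> \<partial>M) < \<epsilon>" using J by blast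
qed

text \<open>The sets that depend on finitely many variables are stable under intersection, because
  two finite index sets have a finite union, and they generate the whole sigma-algebra.
  Approximability passes to complements by linearity and to countable disjoint unions by dominated
  convergence.\<close>

lemma (in finite_measure) finitely_approximable_indicator:
  assumes X: "\<And>i. i \<in> I \<Longrightarrow> X i \<in> borel_measurable M"
    and A: "A \<in> sets (generated_sigma M I X)"
  shows "finitely_approximable M I X (indicator A)"
proof -
  define G where "G = (\<Union>J\<in>{J. finite J \<and> J \<subseteq> I}. sets (generated_sigma M J X))"
  have sub: "sets (generated_sigma M J X) \<subseteq> sets M" if "J \<subseteq> I" for J
    by (rule generated_sigma_least) (use X that in auto)
  have GM: "G \<subseteq> sets M" using sub by (auto simp: G_def)
  then have GP: "G \<subseteq> Pow (space M)" using sets.sets_into_space by auto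
  have GI: "Int_stable G"
  proof (rule Int_stableI)
    fix a b assume "a \<in> G" "b \<in> G"
    then obtain J K where J: "finite J" "J \<subseteq> I" "a \<in> sets (generated_sigma M J X)"
      and K: "finite K" "K \<subseteq> I" "b \<in> sets (generated_sigma M K X)" by (auto simp: G_def)
    then have "a \<in> sets (generated_sigma M (J \<union> K) X)" "b \<in> sets (generated_sigma M (J \<union> K) X)"
      using generated_sigma_mono[of J "J \<union> K" M X] generated_sigma_mono[of K "J \<union> K" M X] by auto
    then have "a \<inter> b \<in> sets (generated_sigma M (J \<union> K) X)" by auto
    then show "a \<inter> b \<in> G" unfolding G_def using J K by (intro UN_I[of "J \<union> K"]) auto
  qed
  have AG: "A \<in> sigma_sets (space M) G"
  proof -
    have "sigma_sets (space M) (\<Union>i\<in>I. {X i -` B \<inter> space M | B. B \<in> sets borel}) \<subseteq> sigma_sets (space M) G"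
    proof (rule sigma_sets_mono', rule subsetI)
      fix S assume "S \<in> (\<Union>i\<in>I. {X i -` B \<inter> space M | B. B \<in> sets borel})"
      then obtain i B where "i \<in> I" "B \<in> sets borel" "S = X i -` B \<inter> space M" by auto
      then have "S \<in> sets (generated_sigma M {i} X)"
        using measurable_sets[OF measurable_generated_sigma[of i "{i}" X M], of B] by simp
      then show "S \<in> G" unfolding G_def using \<open>i \<in> I\<close> by (intro UN_I[of "{i}"]) auto
    qed
    then show ?thesis using A by (auto simp: sets_generated_sigma)
  qed
  have sM: "sigma_sets (space M) G \<subseteq> sets M" by (rule sets.sigma_sets_subset[OF GM])
  have ind: "integrable M (indicator S :: 'a \<Rightarrow> real)" if "S \<in> sets M" for S
    using that by (simp add: less_top[symmetric])
  have G_approx: "finitely_approximable M I X (indicator S)" if "S \<in> G" for S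
  proof -
    from that obtain J where "finite J" "J \<subseteq> I" "S \<in> sets (generated_sigma M J X)" by (auto simp: G_def)
    then show ?thesis using that GM by (intro finitely_approximableI[of M _ J] ind) auto
  qed
  show ?thesis using GI GP AG
  proof (induction rule: sigma_sets_induct_disjoint)
    case (basic S) then show ?case by (rule G_approx)
  next
    case empty
    have "{} \<in> G" by (auto simp: G_def intro!: exI[of _ "{}"])
    then show ?case by (rule G_approx)
  next
    case (compl S)
    have "space M \<in> G" using sets.top[of "generated_sigma M {} X"] by (auto simp: G_def simp del: sets.top intro!: exI[of _ "{}"])
    then have "finitely_approximable M I X (\<lambda>\<omega>. indicator (space M) \<omega> + (-1) * indicator S \<omega>)"
      by (intro finitely_approximable_add finitely_approximable_cmult compl G_approx)
    moreover have "S \<subseteq> space M" using sets.sets_into_space sM compl by auto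
    then have "(\<lambda>\<omega>. indicator (space M) \<omega> + (-1) * indicator S \<omega> :: real) = indicator (space M - S)"
      by (auto simp: fun_eq_iff split: split_indicator)
    ultimately show ?case by simp
  next
    case (union S)
    have S: "S i \<in> sets M" for i using union sM by auto
    show ?case
    proof (rule finitely_approximable_limit)
      fix n :: nat
      show "finitely_approximable M I X (\<lambda>\<omega>. \<Sum>i<n. indicator (S i) \<omega>)"
      proof (induction n)
        case 0
        have "{} \<in> G" by (auto simp: G_def intro!: exI[of _ "{}"])
        from G_approx[OF this] show ?case by (simp add: indicator_def[abs_def])
      next
        case (Suc n)
        then show ?case using union.IH by (simp add: finitely_approximable_add)
      qed
    next
      show "integrable M (indicator (\<Union>i. S i) :: 'a \<Rightarrow> real)" using S by (intro ind) auto
      have 1: "(\<Sum>i<n. indicator (S i) \<omega>) = (indicator (\<Union>i<n. S i) \<omega> :: real)" for n \<omega>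
        by (rule indicator_UN_disjoint[symmetric]) (use union in \<open>auto intro: disjoint_family_on_mono\<close>)
      show "(\<lambda>n. \<integral>\<omega>. \<bar>(\<Sum>i<n. indicator (S i) \<omega>) - indicator (\<Union>i. S i) \<omega> :: real\<bar> \<partial>M) \<longlonglongrightarrow> 0"
      proof -
        have "(\<lambda>n. \<integral>\<omega>. \<bar>(\<Sum>i<n. indicator (S i) \<omega>) - indicator (\<Union>i. S i) \<omega> :: real\<bar> \<partial>M) \<longlonglongrightarrow> (\<integral>\<omega>. 0 \<partial>M)"
        proof (rule integral_dominated_convergence[where w="\<lambda>_. 1"])
          show "AE \<omega> in M. (\<lambda>n. \<bar>(\<Sum>i<n. indicator (S i) \<omega>) - indicator (\<Union>i. S i) \<omega>\<bar> :: real) \<longlonglongrightarrow> 0"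
          proof (rule AE_I2)
            fix \<omega>
            have "(\<lambda>n. indicator (\<Union>i<n. S i) \<omega> :: real) \<longlonglongrightarrow> indicator (\<Union>i. S i) \<omega>"
              by (rule LIMSEQ_indicator_UN)
            then show "(\<lambda>n. \<bar>(\<Sum>i<n. indicator (S i) \<omega>) - indicator (\<Union>i. S i) \<omega>\<bar> :: real) \<longlonglongrightarrow> 0"
              unfolding 1 by (intro tendsto_rabs_zero LIM_zero)
          qed
          show "AE \<omega> in M. norm \<bar>(\<Sum>i<n. indicator (S i) \<omega>) - indicator (\<Union>i. S i) \<omega> :: real\<bar> \<le> 1" for n
            unfolding 1 by (auto split: split_indicator)
        qed (use S in auto)
        then show ?thesis by simp
      qed
    qed
  qed
qed

text \<open>The induction over integrable functions runs on the restriction of the measure to the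
  generated sigma-algebra, so that the simple functions involved are built from sets of that
  sigma-algebra.\<close>

lemma (in finite_measure) finitely_approximable_measurable:
  fixes f :: "'a \<Rightarrow> real"
  assumes X: "\<And>i. i \<in> I \<Longrightarrow> X i \<in> borel_measurable M"
    and f: "f \<in> borel_measurable (generated_sigma M I X)" "integrable M f"
  shows "finitely_approximable M I X f"
proof -
  define F where "F = generated_sigma M I X"
  have sub: "subalgebra M F" unfolding F_def by (rule generated_sigma_subalgebra[OF X])
  have "integrable (restr_to_subalg M F) f"
    by (rule integrable_in_subalg[OF sub]) (use f in \<open>auto simp: F_def\<close>)
  then show ?thesis
  proof (induction rule: integrable_induct)
    case (base A c)
    then have "A \<in> sets (generated_sigma M I X)"
      using sets_restr_to_subalg[OF sub] by (simp add: F_def)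
    from finitely_approximable_cmult[OF finitely_approximable_indicator[OF X this], of c]
    show ?case by (simp add: mult.commute)
  next
    case (add f g)
    then show ?case by (intro finitely_approximable_add) auto
  next
    case (lim f s)
    note int = integrable_from_subalg[OF sub]
    have fM: "integrable M f" using lim int by blast
    show ?case
    proof (rule finitely_approximable_limit[of M I X s])
      show "integrable M f" by (rule fM)
      have "(\<lambda>i. \<integral>\<omega>. \<bar>s i \<omega> - f \<omega>\<bar> \<partial>M) \<longlonglongrightarrow> (\<integral>\<omega>. 0 \<partial>M)"
      proof (rule integral_dominated_convergence[where w="\<lambda>\<omega>. 3 * \<bar>f \<omega>\<bar>"])
        show "integrable M (\<lambda>\<omega>. 3 * \<bar>f \<omega>\<bar>)" using fM by simp
        have [measurable]: "f \<in> borel_measurable M" "s i \<in> borel_measurable M" for i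
          using lim int by blast+
        show "(\<lambda>\<omega>. \<bar>s i \<omega> - f \<omega>\<bar>) \<in> borel_measurable M" for i by measurable
        have sp: "space (restr_to_subalg M F) = space M" by (simp add: space_restr_to_subalg)
        show "AE \<omega> in M. (\<lambda>i. \<bar>s i \<omega> - f \<omega>\<bar>) \<longlonglongrightarrow> 0"
          using lim by (intro AE_I2 tendsto_rabs_zero LIM_zero) (auto simp: sp)
        show "AE \<omega> in M. norm \<bar>s i \<omega> - f \<omega>\<bar> \<le> 3 * \<bar>f \<omega>\<bar>" for i
        proof (rule AE_I2)
          fix \<omega> assume "\<omega> \<in> space M"
          then have "norm (s i \<omega>) \<le> 2 * norm (f \<omega>)" using lim by (auto simp: sp)
          then show "norm \<bar>s i \<omega> - f \<omega>\<bar> \<le> 3 * \<bar>f \<omega>\<bar>" by auto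
        qed
      qed auto
      then show "(\<lambda>i. \<integral>\<omega>. \<bar>s i \<omega> - f \<omega>\<bar> \<partial>M) \<longlonglongrightarrow> 0" by simp
    qed (use lim in auto)
  qed
qed

text \<open>The bound on the pairing with functions measurable with respect to finitely many of the
  variables passes to the whole generated \<open>\<sigma>\<close>-algebra; clipping \<open>v\<close> makes it an admissible
  test function.\<close>
lemma (in finite_measure) square_integral_le_of_finite_pairing:
  assumes X: "\<And>i. i \<in> I \<Longrightarrow> X i \<in> borel_measurable M" and u: "square_integrable M u" and D: "0 \<le> D"
    and bound: "\<And>J \<psi>. finite J \<Longrightarrow> J \<subseteq> I \<Longrightarrow> \<psi> \<in> borel_measurable (generated_sigma M J X) \<Longrightarrow>
      square_integrable M \<psi> \<Longrightarrow> \<bar>\<integral>\<omega>. u \<omega> * \<psi> \<omega> \<partial>M\<bar> \<le> D * sqrt (\<integral>\<omega>. (\<psi> \<omega>)\<^sup>2 \<partial>M)"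
    and v: "v \<in> borel_measurable (generated_sigma M I X)" "integrable M v"
    and uv: "\<And>\<psi> c. \<psi> \<in> borel_measurable (generated_sigma M I X) \<Longrightarrow> (\<And>\<omega>. \<bar>\<psi> \<omega>\<bar> \<le> c) \<Longrightarrow>
      (\<integral>\<omega>. v \<omega> * \<psi> \<omega> \<partial>M) = (\<integral>\<omega>. u \<omega> * \<psi> \<omega> \<partial>M)"
  shows "square_integrable M v" and "(\<integral>\<omega>. (v \<omega>)\<^sup>2 \<partial>M) \<le> D\<^sup>2"
proof -
  note sub = generated_sigma_subalgebra[OF X]
  have [measurable]: "v \<in> borel_measurable M" using v(2) by simp
  define cl where "cl N t = max (- N) (min N t)" for N t :: real
  have cl_le: "\<bar>cl N t\<bar> \<le> N" if "N \<ge> 0" for N t using that by (auto simp: cl_def)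
  have cl_meas[measurable]: "cl N \<in> borel_measurable borel" for N unfolding cl_def[abs_def] by measurable
  have bsq: "square_integrable M \<psi>" if "\<psi> \<in> borel_measurable M" "\<And>\<omega>. \<bar>\<psi> \<omega>\<bar> \<le> N" for \<psi> N
    unfolding square_integrable_def
    using that power_mono[OF that(2) abs_ge_zero, of _ 2]
    by (auto intro!: integrable_const_bound[of _ "N\<^sup>2"])
  have bnd: "\<bar>\<integral>\<omega>. u \<omega> * \<psi> \<omega> \<partial>M\<bar> \<le> D * sqrt (\<integral>\<omega>. (\<psi> \<omega>)\<^sup>2 \<partial>M)"
    if psi: "\<psi> \<in> borel_measurable (generated_sigma M I X)" and N: "\<And>\<omega>. \<bar>\<psi> \<omega>\<bar> \<le> N" for \<psi> N
  proof -
    have psiM[measurable]: "\<psi> \<in> borel_measurable M" by (rule measurable_from_subalg[OF sub psi])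
    have N0: "N \<ge> 0" using N[of undefined] by linarith
    note psi2 = bsq[OF psiM N]
    have fa: "finitely_approximable M I X \<psi>"
      by (rule finitely_approximable_measurable[OF X psi square_integrable_integrable[OF psi2]])
    define U P where "U = sqrt (\<integral>\<omega>. (u \<omega>)\<^sup>2 \<partial>M)" and "P = sqrt (\<integral>\<omega>. (\<psi> \<omega>)\<^sup>2 \<partial>M)"
    have UP: "U \<ge> 0" "P \<ge> 0" by (auto simp: U_def P_def)
    have main: "\<bar>\<integral>\<omega>. u \<omega> * \<psi> \<omega> \<partial>M\<bar> \<le> D * P + (U + D) * d" if d: "d > 0" for d
    proof -
      \<comment> \<open>The square of \<psi> - h is at most 2 N |\<psi> - g|, so an error \<epsilon>
        in mean becomes an error d in mean square. The summand 1 in the denominator covers N =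
        0.\<close>
      define \<epsilon> where "\<epsilon> = d\<^sup>2 / (2 * N + 1)"
      have e: "\<epsilon> > 0" using d N0 by (simp add: \<epsilon>_def)
      obtain J g where J: "finite J" "J \<subseteq> I" "g \<in> borel_measurable (generated_sigma M J X)" "integrable M g"
        "(\<integral>\<omega>. \<bar>\<psi> \<omega> - g \<omega>\<bar> \<partial>M) < \<epsilon>" using fa e unfolding finitely_approximable_def by meson
      define h where "h \<omega> = cl N (g \<omega>)" for \<omega>
      have hJ: "h \<in> borel_measurable (generated_sigma M J X)" unfolding h_def[abs_def] using J(3) by measurable
      have hM[measurable]: "h \<in> borel_measurable M" unfolding h_def[abs_def] using J(4) by measurable
      have hN: "\<bar>h \<omega>\<bar> \<le> N" for \<omega> unfolding h_def by (rule cl_le[OF N0])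
      note h2 = bsq[OF hM hN]
      note dd2 = square_integrable_diff[OF psi2 h2]
      have "(\<integral>\<omega>. (\<psi> \<omega> - h \<omega>)\<^sup>2 \<partial>M) \<le> (\<integral>\<omega>. (2 * N) * \<bar>\<psi> \<omega> - g \<omega>\<bar> \<partial>M)"
      proof (rule integral_mono)
        show "integrable M (\<lambda>\<omega>. (\<psi> \<omega> - h \<omega>)\<^sup>2)" using dd2 by (simp add: square_integrable_def)
        show "integrable M (\<lambda>\<omega>. (2 * N) * \<bar>\<psi> \<omega> - g \<omega>\<bar>)"
          using square_integrable_integrable[OF psi2] J(4) by auto
        fix \<omega>
        \<comment> \<open>As |\<psi>| is at most N, clipping g at N can only bring it closer to
          \<psi>.\<close>
        have "\<bar>\<psi> \<omega> - h \<omega>\<bar> \<le> \<bar>\<psi> \<omega> - g \<omega>\<bar>" using N[of \<omega>] by (auto simp: h_def cl_def)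
        moreover have "\<bar>\<psi> \<omega> - h \<omega>\<bar> \<le> 2 * N" using N[of \<omega>] hN[of \<omega>] by linarith
        ultimately have "\<bar>\<psi> \<omega> - h \<omega>\<bar> * \<bar>\<psi> \<omega> - h \<omega>\<bar> \<le> 2 * N * \<bar>\<psi> \<omega> - g \<omega>\<bar>"
          by (intro mult_mono) auto
        then show "(\<psi> \<omega> - h \<omega>)\<^sup>2 \<le> (2 * N) * \<bar>\<psi> \<omega> - g \<omega>\<bar>"
          by (simp add: power2_eq_square flip: abs_mult)
      qed
      also have "\<dots> \<le> (2 * N) * \<epsilon>" using J(5) N0 by (auto intro!: mult_left_mono)
      also have "\<dots> \<le> d\<^sup>2" using N0 by (simp add: \<epsilon>_def field_simps)
      finally have dle: "sqrt (\<integral>\<omega>. (\<psi> \<omega> - h \<omega>)\<^sup>2 \<partial>M) \<le> d" using d by (simp add: real_le_lsqrt)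
      have cs: "\<bar>\<integral>\<omega>. p \<omega> * q \<omega> \<partial>M\<bar> \<le> sqrt (\<integral>\<omega>. (p \<omega>)\<^sup>2 \<partial>M) * sqrt (\<integral>\<omega>. (q \<omega>)\<^sup>2 \<partial>M)"
        if "square_integrable M p" "square_integrable M q" for p q
        using real_sqrt_le_mono[OF square_integrable_cauchy_schwarz[OF that]] by (simp add: real_sqrt_mult)
      have "(\<integral>\<omega>. u \<omega> * \<psi> \<omega> \<partial>M) = (\<integral>\<omega>. u \<omega> * (\<psi> \<omega> - h \<omega>) \<partial>M) + (\<integral>\<omega>. u \<omega> * h \<omega> \<partial>M)"
        using square_integrable_mult[OF u psi2] square_integrable_mult[OF u h2] by (simp add: right_diff_distrib)
      moreover have "\<bar>\<integral>\<omega>. u \<omega> * (\<psi> \<omega> - h \<omega>) \<partial>M\<bar> \<le> U * d"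
        using cs[OF u dd2] mult_left_mono[OF dle UP(1)] by (simp add: U_def)
      moreover have "\<bar>\<integral>\<omega>. u \<omega> * h \<omega> \<partial>M\<bar> \<le> D * (P + d)"
      proof -
        have "(\<integral>\<omega>. (h \<omega>)\<^sup>2 \<partial>M) \<le> (P + d)\<^sup>2"
        proof -
          have "(\<integral>\<omega>. (h \<omega>)\<^sup>2 \<partial>M) = (\<integral>\<omega>. (\<psi> \<omega>)\<^sup>2 + (\<psi> \<omega> - h \<omega>)\<^sup>2 - 2 * (\<psi> \<omega> * (\<psi> \<omega> - h \<omega>)) \<partial>M)"
            by (rule Bochner_Integration.integral_cong) (auto simp: power2_eq_square algebra_simps)
          also have "\<dots> = P\<^sup>2 + (\<integral>\<omega>. (\<psi> \<omega> - h \<omega>)\<^sup>2 \<partial>M) - 2 * (\<integral>\<omega>. \<psi> \<omega> * (\<psi> \<omega> - h \<omega>) \<partial>M)"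
            using psi2 dd2 square_integrable_mult[OF psi2 dd2] by (simp add: P_def square_integrable_def)
          also have "\<dots> \<le> P\<^sup>2 + d\<^sup>2 + 2 * (P * d)"
          proof -
            have "(\<integral>\<omega>. (\<psi> \<omega> - h \<omega>)\<^sup>2 \<partial>M) \<le> d\<^sup>2" using sqrt_le_D[OF dle] .
            moreover have "\<bar>\<integral>\<omega>. \<psi> \<omega> * (\<psi> \<omega> - h \<omega>) \<partial>M\<bar> \<le> P * d"
              using cs[OF psi2 dd2] mult_left_mono[OF dle UP(2)] by (simp add: P_def)
            ultimately show ?thesis by linarith
          qed
          finally show ?thesis by (simp add: power2_sum)
        qed
        then have "sqrt (\<integral>\<omega>. (h \<omega>)\<^sup>2 \<partial>M) \<le> P + d" using UP d by (simp add: real_le_lsqrt)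
        then have "D * sqrt (\<integral>\<omega>. (h \<omega>)\<^sup>2 \<partial>M) \<le> D * (P + d)" using D by (rule mult_left_mono)
        then show ?thesis using bound[OF J(1,2) hJ h2] by linarith
      qed
      ultimately show ?thesis by (simp add: algebra_simps)
    qed
    have "\<bar>\<integral>\<omega>. u \<omega> * \<psi> \<omega> \<partial>M\<bar> \<le> D * P"
    proof (rule field_le_epsilon)
      fix e :: real assume e: "e > 0"
      have "U + D \<ge> 0" using UP D by simp
      then have "(U + D) * (e / (U + D + 1)) \<le> e" using e by (simp add: field_simps)
      moreover have "e / (U + D + 1) > 0" using e \<open>U + D \<ge> 0\<close> by (auto intro!: divide_pos_pos)
      ultimately show "\<bar>\<integral>\<omega>. u \<omega> * \<psi> \<omega> \<partial>M\<bar> \<le> D * P + e" using main[of "e / (U + D + 1)"] by linarith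
    qed
    then show ?thesis by (simp add: P_def)
  qed
  define w where "w n \<omega> = cl (real n) (v \<omega>)" for n \<omega>
  have wI: "w n \<in> borel_measurable (generated_sigma M I X)" for n unfolding w_def[abs_def] using v(1) by measurable
  have wn: "\<bar>w n \<omega>\<bar> \<le> real n" for n \<omega> unfolding w_def by (rule cl_le) simp
  have w2: "square_integrable M (w n)" for n using bsq[OF _ wn, of n] by (simp add: w_def[abs_def])
  have wbound: "(\<integral>\<omega>. (w n \<omega>)\<^sup>2 \<partial>M) \<le> D\<^sup>2" for n
  proof -
    define Q where "Q = (\<integral>\<omega>. (w n \<omega>)\<^sup>2 \<partial>M)"
    have Q0: "Q \<ge> 0" by (simp add: Q_def)
    \<comment> \<open>Pointwise the square of the clipped function is at most its product with v.
      Testing u against the clipped function itself then gives Q at most D sqrt(Q), and one factor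
      sqrt(Q) cancels. Fatou's lemma removes the clipping afterwards.\<close>
    have "Q \<le> (\<integral>\<omega>. v \<omega> * w n \<omega> \<partial>M)" unfolding Q_def
    proof (rule integral_mono)
      show "integrable M (\<lambda>\<omega>. (w n \<omega>)\<^sup>2)" using w2 by (simp add: square_integrable_def)
      show "integrable M (\<lambda>\<omega>. v \<omega> * w n \<omega>)"
      proof (rule Bochner_Integration.integrable_bound)
        show "integrable M (\<lambda>\<omega>. real n * v \<omega>)" using v(2) by simp
        show "(\<lambda>\<omega>. v \<omega> * w n \<omega>) \<in> borel_measurable M" unfolding w_def by measurable
        show "AE \<omega> in M. norm (v \<omega> * w n \<omega>) \<le> norm (real n * v \<omega>)"
          using mult_left_mono[OF wn abs_ge_zero]
          by (auto intro!: AE_I2 simp: abs_mult mult.commute[of "real n"])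
      qed
      show "(w n \<omega>)\<^sup>2 \<le> v \<omega> * w n \<omega>" for \<omega>
        using mult_right_mono[of "real n" "- v \<omega>" "real n"]
        by (auto simp: w_def cl_def power2_eq_square max_def min_def mult_right_mono)
    qed
    also have "\<dots> = (\<integral>\<omega>. u \<omega> * w n \<omega> \<partial>M)" by (rule uv[OF wI wn])
    also have "\<dots> \<le> D * sqrt Q" using bnd[OF wI wn, of n] by (simp add: Q_def)
    finally have QD: "sqrt Q * sqrt Q \<le> D * sqrt Q" using Q0 by simp
    have "sqrt Q \<le> D"
    proof (cases "Q = 0")
      case False
      then have "sqrt Q > 0" using Q0 by simp
      then show ?thesis using QD by (simp only: mult_le_cancel_right_pos)
    qed (simp add: D)
    then show ?thesis using sqrt_le_D by (simp add: Q_def)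
  qed
  have w_lim: "(\<lambda>n. (w n \<omega>)\<^sup>2) \<longlonglongrightarrow> (v \<omega>)\<^sup>2" for \<omega>
  proof (rule tendsto_eventually)
    obtain N where "\<bar>v \<omega>\<bar> \<le> real N" using real_arch_simple by blast
    then show "\<forall>\<^sub>F n in sequentially. (w n \<omega>)\<^sup>2 = (v \<omega>)\<^sup>2"
      unfolding eventually_sequentially by (intro exI[of _ N]) (auto simp: w_def cl_def)
  qed
  have "(\<integral>\<^sup>+\<omega>. ennreal ((v \<omega>)\<^sup>2) \<partial>M) = (\<integral>\<^sup>+\<omega>. liminf (\<lambda>n. ennreal ((w n \<omega>)\<^sup>2)) \<partial>M)"
    by (intro nn_integral_cong lim_imp_Liminf[symmetric]) (auto intro!: w_lim)
  also have "\<dots> \<le> liminf (\<lambda>n. \<integral>\<^sup>+\<omega>. ennreal ((w n \<omega>)\<^sup>2) \<partial>M)"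
    by (rule nn_integral_liminf) (auto simp: w_def)
  also have "\<dots> \<le> ennreal (D\<^sup>2)"
  proof -
    have "(\<integral>\<^sup>+\<omega>. ennreal ((w n \<omega>)\<^sup>2) \<partial>M) \<le> ennreal (D\<^sup>2)" for n
      using w2[of n] wbound[of n] by (subst nn_integral_eq_integral) (auto simp: square_integrable_def intro: ennreal_leI)
    then show ?thesis by (intro Liminf_le) auto
  qed
  finally have fin: "(\<integral>\<^sup>+\<omega>. ennreal ((v \<omega>)\<^sup>2) \<partial>M) \<le> ennreal (D\<^sup>2)" .
  then show sv: "square_integrable M v" unfolding square_integrable_def
    by (auto intro!: integrableI_bounded simp: le_less_trans[OF _ ennreal_less_top])
  then show "(\<integral>\<omega>. (v \<omega>)\<^sup>2 \<partial>M) \<le> D\<^sup>2"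
    using fin by (subst (asm) nn_integral_eq_integral) (auto simp: square_integrable_def)
qed

section \<open>Hilbert space preliminaries\<close>

text \<open>Normalisation by \<open>sgn\<close> sends a zero residual to 0, so a dense sequence with
  many dependent members can be fed in unchanged.\<close>

fun gram_schmidt :: "(nat \<Rightarrow> 'x::real_inner) \<Rightarrow> nat \<Rightarrow> 'x" where
  "gram_schmidt d n = sgn (d n - (\<Sum>i<n. (d n \<bullet> gram_schmidt d i) *\<^sub>R gram_schmidt d i))"

declare gram_schmidt.simps [simp del]

text \<open>Some of the vectors may vanish, hence the idempotent form of normalisation.\<close>
lemma gram_schmidt_inner_self:
  "(gram_schmidt d n \<bullet> gram_schmidt d n) *\<^sub>R gram_schmidt d n = gram_schmidt d n"
proof -
  have "(sgn r \<bullet> sgn r) *\<^sub>R sgn r = sgn r" for r :: 'a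
    by (simp add: dot_square_norm norm_sgn)
  then show ?thesis by (metis gram_schmidt.simps)
qed

text \<open>Under strong induction the earlier vectors are already orthogonal, so of the subtracted
  projections only the one along \<open>gram_schmidt d i\<close> survives the pairing with it, and
  it cancels the pairing of \<open>d n\<close>.\<close>

lemma gram_schmidt_orthogonal_less:
  "i < n \<Longrightarrow> gram_schmidt d i \<bullet> gram_schmidt d n = 0"
proof (induction n arbitrary: i rule: less_induct)
  case (less n)
  let ?e = "gram_schmidt d"
  have "(\<Sum>j<n. (d n \<bullet> ?e j) * (?e j \<bullet> ?e i)) = (\<Sum>j<n. if j = i then (d n \<bullet> ?e i) * (?e i \<bullet> ?e i) else 0)"
  proof (rule sum.cong[OF refl])
    fix j assume "j \<in> {..<n}"
    then show "(d n \<bullet> ?e j) * (?e j \<bullet> ?e i) = (if j = i then (d n \<bullet> ?e i) * (?e i \<bullet> ?e i) else 0)"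
      using less.IH[of j i] less.IH[of i j] less.prems by (cases i j rule: linorder_cases) (auto simp: inner_commute)
  qed
  also have "\<dots> = (d n \<bullet> ?e i) * (?e i \<bullet> ?e i)" using less.prems by simp
  also have "\<dots> = d n \<bullet> ((?e i \<bullet> ?e i) *\<^sub>R ?e i)" by simp
  also have "\<dots> = d n \<bullet> ?e i" by (simp only: gram_schmidt_inner_self)
  finally have "(d n - (\<Sum>j<n. (d n \<bullet> ?e j) *\<^sub>R ?e j)) \<bullet> ?e i = 0"
    by (simp add: inner_diff_left inner_sum_left)
  then have "?e n \<bullet> ?e i = 0"
    by (subst gram_schmidt.simps) (simp add: sgn_div_norm)
  then show ?case by (simp add: inner_commute)
qed

lemma gram_schmidt_orthogonal:
  "i \<noteq> j \<Longrightarrow> gram_schmidt d i \<bullet> gram_schmidt d j = 0"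
  using gram_schmidt_orthogonal_less[of i j d] gram_schmidt_orthogonal_less[of j i d]
  by (cases i j rule: linorder_cases) (auto simp: inner_commute)

lemma gram_schmidt_residual:
  assumes "j < k"
  shows "(v - (\<Sum>i<k. (v \<bullet> gram_schmidt d i) *\<^sub>R gram_schmidt d i)) \<bullet> gram_schmidt d j = 0"
proof -
  let ?e = "gram_schmidt d"
  have "(\<Sum>i<k. (v \<bullet> ?e i) * (?e i \<bullet> ?e j)) = (\<Sum>i<k. if i = j then (v \<bullet> ?e j) * (?e j \<bullet> ?e j) else 0)"
    by (rule sum.cong[OF refl]) (simp add: gram_schmidt_orthogonal)
  also have "\<dots> = (v \<bullet> ?e j) * (?e j \<bullet> ?e j)" using assms by simp
  also have "\<dots> = v \<bullet> ((?e j \<bullet> ?e j) *\<^sub>R ?e j)" by simp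
  also have "\<dots> = v \<bullet> ?e j" by (simp only: gram_schmidt_inner_self)
  finally show ?thesis by (simp add: inner_diff_left inner_sum_left)
qed

text \<open>The last coefficient is the length of the residual, so the last summand restores exactly
  what normalisation removed.\<close>

lemma gram_schmidt_span:
  "d n = (\<Sum>i<Suc n. (d n \<bullet> gram_schmidt d i) *\<^sub>R gram_schmidt d i)"
proof -
  let ?e = "gram_schmidt d"
  define r where "r = d n - (\<Sum>i<n. (d n \<bullet> ?e i) *\<^sub>R ?e i)"
  have en: "?e n = sgn r" unfolding r_def by (rule gram_schmidt.simps)
  have "d n \<bullet> ?e n = r \<bullet> ?e n + (\<Sum>i<n. (d n \<bullet> ?e i) * (?e i \<bullet> ?e n))"
    by (simp add: r_def inner_diff_left inner_sum_left)
  also have "\<dots> = r \<bullet> ?e n" by (simp add: gram_schmidt_orthogonal_less)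
  also have "\<dots> = norm r"
    by (cases "r = 0") (simp_all add: en sgn_div_norm power2_eq_square flip: power2_norm_eq_inner)
  finally have "(d n \<bullet> ?e n) *\<^sub>R ?e n = r"
    by (cases "r = 0") (simp_all add: en sgn_div_norm)
  then show ?thesis by (simp add: r_def)
qed

text \<open>Stands in for an orthonormal basis: Bessel's inequality and Parseval's identity are the
  properties used, and they tolerate zero vectors. The sequence is Gram-Schmidt applied to a
  countable dense set; the partial sums \<open>P k v\<close> are best approximations, so density
  makes them converge to v.\<close>

theorem parseval_sequence:
  obtains e :: "nat \<Rightarrow> 'x::{real_inner, second_countable_topology}"
  where "\<And>v k. (\<Sum>i<k. (v \<bullet> e i)\<^sup>2) \<le> (norm v)\<^sup>2"
    and "\<And>v. (\<lambda>k. \<Sum>i<k. (v \<bullet> e i)\<^sup>2) \<longlonglongrightarrow> (norm v)\<^sup>2"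
proof -
  obtain D :: "'x set" where D: "countable D" "\<And>X. open X \<Longrightarrow> X \<noteq> {} \<Longrightarrow> \<exists>d\<in>D. d \<in> X"
    using countable_dense_setE by blast
  have "D \<noteq> {}" using D(2)[of UNIV] by auto
  define d where "d = from_nat_into D"
  have dD: "\<exists>n. d n = y" if "y \<in> D" for y
    using from_nat_into_surj[OF D(1) that] by (auto simp: d_def)
  define e where "e = gram_schmidt d"
  define P where "P k v = (\<Sum>i<k. (v \<bullet> e i) *\<^sub>R e i)" for k v
  have res: "(v - P k v) \<bullet> e j = 0" if "j < k" for v k j
    unfolding P_def e_def by (rule gram_schmidt_residual[OF that])
  have res_span: "(v - P k v) \<bullet> (\<Sum>i<k. c i *\<^sub>R e i) = 0" for v k c
    by (simp add: inner_sum_right res)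
  have pyth: "(\<Sum>i<k. (v \<bullet> e i)\<^sup>2) = (norm v)\<^sup>2 - (norm (v - P k v))\<^sup>2" for v k
  proof -
    have "(v - P k v) \<bullet> P k v = 0" using res_span[of v k "\<lambda>i. v \<bullet> e i"] by (simp add: P_def)
    moreover have "v \<bullet> P k v = (\<Sum>i<k. (v \<bullet> e i)\<^sup>2)"
      by (simp add: P_def inner_sum_right power2_eq_square)
    ultimately show ?thesis
      by (simp add: power2_norm_eq_inner inner_diff_left inner_diff_right inner_commute)
  qed
  \<comment> \<open>For n < k the vector \<open>d n\<close> lies in the span of the first k vectors,
    and v - \<open>P k v\<close> is orthogonal to that span; Pythagoras compares the two
    distances.\<close>
  have best: "norm (v - P k v) \<le> norm (v - d n)" if "n < k" for v k n
  proof -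
    define c where "c i = (if i < Suc n then d n \<bullet> e i else 0)" for i
    have dn: "d n = (\<Sum>i<k. c i *\<^sub>R e i)"
    proof -
      have "d n = (\<Sum>i<Suc n. c i *\<^sub>R e i)"
        unfolding e_def
        by (subst gram_schmidt_span[of d n]) (rule sum.cong, auto simp: c_def e_def)
      also have "\<dots> = (\<Sum>i<k. c i *\<^sub>R e i)"
        by (rule sum.mono_neutral_left) (use that in \<open>auto simp: c_def\<close>)
      finally show ?thesis .
    qed
    have "P k v - d n = (\<Sum>i<k. ((v \<bullet> e i) - c i) *\<^sub>R e i)"
      unfolding P_def dn by (simp add: sum_subtractf scaleR_diff_left)
    then have 0: "(v - P k v) \<bullet> (P k v - d n) = 0" using res_span by simp
    have "v - d n = (v - P k v) + (P k v - d n)" by simp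
    then have "(norm (v - d n))\<^sup>2 = (norm (v - P k v))\<^sup>2 + (norm (P k v - d n))\<^sup>2"
      using 0 norm_add_Pythagorean[of "v - P k v" "P k v - d n"] by (simp add: orthogonal_def)
    then have "(norm (v - P k v))\<^sup>2 \<le> (norm (v - d n))\<^sup>2" by simp
    then show ?thesis by simp
  qed
  have "(\<lambda>k. v - P k v) \<longlonglongrightarrow> 0" for v
  proof (rule LIMSEQ_I)
    fix r :: real assume r: "r > 0"
    have "ball v r \<noteq> {}" using r by auto
    then obtain y where "y \<in> D" "y \<in> ball v r" using D(2)[of "ball v r"] by auto
    then obtain n where "norm (v - d n) < r" using dD by (metis dist_norm mem_ball)
    then have "norm (v - P k v - 0) < r" if "k \<ge> Suc n" for k
      using best[of n k v] that by simp
    then show "\<exists>no. \<forall>k\<ge>no. norm (v - P k v - 0) < r" by blast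
  qed
  then have "(\<lambda>k. (norm v)\<^sup>2 - (norm (v - P k v))\<^sup>2) \<longlonglongrightarrow> (norm v)\<^sup>2 - (norm (0::'x))\<^sup>2" for v
    by (intro tendsto_intros)
  then show ?thesis by (intro that[of e]) (simp_all add: pyth)
qed

section \<open>First variations and Riesz representation\<close>

text \<open>The first-order condition at a minimiser, used for the Riesz vector and for the Rayleigh
  quotient. If a were nonzero, t = -a / (b + 1) would make the expression equal to -a^2 / (b + 1) -
  t^2; the shift by 1 covers b = 0.\<close>

lemma quadratic_nonneg_imp_zero:
  fixes a b :: real
  assumes "\<And>t. 0 \<le> 2 * t * a + t\<^sup>2 * b" and "0 \<le> b"
  shows "a = 0"
proof (rule ccontr)
  assume a: "a \<noteq> 0"
  define t where "t = - a / (b + 1)"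
  have tb: "t * (b + 1) = - a" using assms(2) by (simp add: t_def)
  have "2 * t * a + t\<^sup>2 * b = t * a + t * (a + t * (b + 1)) - t\<^sup>2"
    by (simp add: power2_eq_square algebra_simps)
  also have "\<dots> = t * a - t\<^sup>2" using tb by simp
  also have "t * a = - (a\<^sup>2 / (b + 1))" by (simp add: t_def power2_eq_square)
  finally have "2 * t * a + t\<^sup>2 * b = - (a\<^sup>2 / (b + 1)) - t\<^sup>2" .
  moreover have "0 < a\<^sup>2 / (b + 1)" using a assms(2) by (simp add: divide_pos_pos)
  moreover have "0 \<le> t\<^sup>2" by simp
  ultimately show False using assms(1)[of t] by linarith
qed

text \<open>The representing vector minimises J v = |v|^2 - 2 L v. This functional is bounded below
  by completing the square, and its first variation at a minimiser k in the direction h is a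
  multiple of <h, k> - L h.\<close>

theorem riesz_representation:
  fixes L :: "'x::{real_inner, banach} \<Rightarrow> real"
  assumes L: "bounded_linear L"
  shows "\<exists>k. \<forall>v. L v = v \<bullet> k"
proof -
  interpret L: bounded_linear L by (rule L)
  obtain K where K: "\<And>v. norm (L v) \<le> norm v * K" "K > 0" using L.pos_bounded by blast
  define J where "J v = (norm v)\<^sup>2 - 2 * L v" for v
  have below: "- K\<^sup>2 \<le> J v" for v
  proof -
    have "L v \<le> norm v * K" using K(1)[of v] by simp
    moreover have "0 \<le> (norm v - K)\<^sup>2" by simp
    ultimately show ?thesis by (simp add: J_def power2_diff)
  qed
  define d where "d = Inf (range J)"
  have bdd: "bdd_below (range J)" using below by (auto simp: bdd_below_def)
  have dle: "d \<le> J v" for v unfolding d_def by (rule cInf_lower[OF _ bdd]) simp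
  have "\<exists>v. J v < d + 1 / real (Suc n)" for n
  proof -
    have "Inf (range J) < d + 1 / real (Suc n)" by (simp add: d_def)
    then show ?thesis using cInf_less_iff[OF _ bdd] by auto
  qed
  then obtain v where v: "\<And>n. J (v n) < d + 1 / real (Suc n)" by metis
  \<comment> \<open>Parallelogram law: the midpoint of two near-minimisers cannot have a value below
    d, so near-minimisers are close to each other and a minimising sequence is Cauchy.\<close>
  have par: "(norm (a - b))\<^sup>2 = 2 * J a + 2 * J b - 4 * J ((1/2) *\<^sub>R (a + b))" for a b
    by (simp add: J_def power2_norm_eq_inner L.scaleR L.add inner_add_left inner_add_right
        inner_diff_left inner_diff_right inner_commute algebra_simps)
  have dst: "(norm (v n - v m))\<^sup>2 \<le> 2 / real (Suc n) + 2 / real (Suc m)" for n m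
    using par[of "v n" "v m"] v[of n] v[of m] dle[of "(1/2) *\<^sub>R (v n + v m)"] by simp
  have "Cauchy v"
  proof (rule metric_CauchyI)
    fix e :: real assume e: "e > 0"
    obtain N where N: "4 / e\<^sup>2 < real N" using reals_Archimedean2 by blast
    have "dist (v n) (v m) < e" if "n \<ge> N" "m \<ge> N" for n m
    proof -
      have "(norm (v n - v m))\<^sup>2 \<le> 2 / real (Suc N) + 2 / real (Suc N)"
        using dst[of n m] that by (smt (verit) frac_le of_nat_0_less_iff of_nat_mono Suc_le_mono zero_less_Suc)
      also have "\<dots> < e\<^sup>2"
      proof -
        have "4 < real N * e\<^sup>2" using N e by (simp add: pos_divide_less_eq)
        also have "\<dots> \<le> real (Suc N) * e\<^sup>2" by (intro mult_right_mono) auto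
        finally show ?thesis by (simp add: pos_divide_less_eq mult.commute)
      qed
      finally show ?thesis using e by (simp add: dist_norm power2_less_imp_less)
    qed
    then show "\<exists>N. \<forall>m\<ge>N. \<forall>n\<ge>N. dist (v m) (v n) < e" by blast
  qed
  then obtain k where k: "v \<longlonglongrightarrow> k" by (auto simp: Cauchy_convergent_iff convergent_def)
  have "(\<lambda>n. J (v n)) \<longlonglongrightarrow> J k" unfolding J_def using k by (intro tendsto_intros L.tendsto)
  moreover have "(\<lambda>n. d + 1 / real (Suc n)) \<longlonglongrightarrow> d + 0"
    by (intro tendsto_intros LIMSEQ_Suc lim_1_over_n)
  ultimately have "J k \<le> d" using LIMSEQ_le[of "\<lambda>n. J (v n)" "J k" "\<lambda>n. d + 1 / real (Suc n)" "d + 0"] v less_imp_le by auto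
  then have min: "J k \<le> J (k + t *\<^sub>R h)" for t h using dle[of "k + t *\<^sub>R h"] by linarith
  have "L h = h \<bullet> k" for h
  proof -
    define b where "b = h \<bullet> k - L h"
    have q: "0 \<le> 2 * t * b + t\<^sup>2 * (norm h)\<^sup>2" for t
      using min[of t h] unfolding J_def b_def power2_norm_eq_inner
      by (simp add: L.add L.scaleR inner_add_left inner_add_right inner_commute power2_eq_square algebra_simps)
    have "b = 0" by (rule quadratic_nonneg_imp_zero[OF q]) simp
    then show ?thesis by (simp add: b_def)
  qed
  then show ?thesis by blast
qed

text \<open>By \<open>E q\<^sup>2 \<le> 3 (E q)\<^sup>2\<close> for the squared length \<open>q\<close> of finitely many coordinates, the mass of
  \<open>q\<close> on an event of probability at most \<open>1/12\<close> is at most \<open>E q / 2\<close>; so a bound on \<open>q\<close> in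
  probability bounds \<open>E q\<close>.\<close>
lemma (in prob_space) norm_square_integrable_of_fourth_moments:
  fixes Y :: "nat \<Rightarrow> 'a \<Rightarrow> 'x::{real_inner, second_countable_topology}" and Z :: "'a \<Rightarrow> 'x"
  assumes Y[measurable]: "\<And>N. Y N \<in> borel_measurable M" and Z[measurable]: "Z \<in> borel_measurable M"
    and int4: "\<And>N h. integrable M (\<lambda>\<omega>. (Y N \<omega> \<bullet> h)^4)"
    and four: "\<And>N h. expectation (\<lambda>\<omega>. (Y N \<omega> \<bullet> h)^4) \<le> 3 * (expectation (\<lambda>\<omega>. (Y N \<omega> \<bullet> h)\<^sup>2))\<^sup>2"
    and lim: "AE \<omega> in M. (\<lambda>N. Y N \<omega>) \<longlonglongrightarrow> Z \<omega>"
  shows "integrable M (\<lambda>\<omega>. (norm (Z \<omega>))\<^sup>2)"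
proof -
  obtain e :: "nat \<Rightarrow> 'x" where e1: "\<And>v k. (\<Sum>i<k. (v \<bullet> e i)\<^sup>2) \<le> (norm v)\<^sup>2"
    and e2: "\<And>v. (\<lambda>k. \<Sum>i<k. (v \<bullet> e i)\<^sup>2) \<longlonglongrightarrow> (norm v)\<^sup>2"
    using parseval_sequence by blast
  \<comment> \<open>The bound in probability has to hold for all N at once. The events
    \<open>A m\<close> decrease to the event that the sequence is unbounded, which is null because
    the sequence converges almost surely.\<close>
  define A where "A m = {\<omega> \<in> space M. \<exists>N. (norm (Y N \<omega>))\<^sup>2 > real m}" for m :: nat
  have A[measurable]: "A m \<in> sets M" for m unfolding A_def by measurable
  have "(\<lambda>m. prob (A m)) \<longlonglongrightarrow> prob (\<Inter>m. A m)"
  proof (rule finite_Lim_measure_decseq)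
    show "decseq A" unfolding decseq_def A_def
    proof safe
      fix m n :: nat and \<omega> N
      assume "m \<le> n" "real n < (norm (Y N \<omega>))\<^sup>2"
      then have "real m < (norm (Y N \<omega>))\<^sup>2" by linarith
      then show "\<exists>N. real m < (norm (Y N \<omega>))\<^sup>2" by blast
    qed
  qed auto
  moreover have "prob (\<Inter>m. A m) = 0"
  proof -
    have "AE \<omega> in M. \<omega> \<notin> (\<Inter>m. A m)"
      using lim
    proof eventually_elim
      case (elim \<omega>)
      then have "Bseq (\<lambda>N. Y N \<omega>)" by (intro convergent_imp_Bseq convergentI)
      then obtain K where K: "\<And>N. norm (Y N \<omega>) \<le> K" "K > 0" unfolding Bseq_def by blast
      obtain m where m: "K\<^sup>2 \<le> real m" using real_arch_simple by blast
      have "(norm (Y N \<omega>))\<^sup>2 \<le> real m" for N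
        using power_mono[OF K(1)[of N], of 2] m by simp
      then have "\<omega> \<notin> A m" by (auto simp: A_def not_less)
      then show ?case by auto
    qed
    moreover have "(\<Inter>m. A m) \<in> sets M" by auto
    ultimately show ?thesis using prob_eq_0 by blast
  qed
  ultimately obtain m where m: "prob (A m) < 1 / 12"
    using order_tendstoD(2)[of "\<lambda>m. prob (A m)" 0 sequentially "1/12"] by (auto simp: eventually_sequentially)
  have main: "expectation (\<lambda>\<omega>. \<Sum>i<k. (Y N \<omega> \<bullet> e i)\<^sup>2) \<le> 2 * real m
      \<and> integrable M (\<lambda>\<omega>. \<Sum>i<k. (Y N \<omega> \<bullet> e i)\<^sup>2)" for N k
  proof -
    define a where "a i \<omega> = (Y N \<omega> \<bullet> e i)\<^sup>2" for i \<omega>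
    have a2: "square_integrable M (a i)" for i
      using int4[of N "e i"] by (simp add: square_integrable_def a_def[abs_def] flip: power_mult)
    define s where "s i = expectation (a i)" for i
    have s0: "s i \<ge> 0" for i by (simp add: s_def a_def)
    \<comment> \<open>Cauchy-Schwarz spreads the factor 3 from single squares to products of two
      different coordinates, so summation gives E q^2 at most 3 (E q)^2 with no dependence on the
      number k of coordinates.\<close>
    have aij: "expectation (\<lambda>\<omega>. a i \<omega> * a j \<omega>) \<le> 3 * (s i * s j)" for i j
    proof -
      have 4: "expectation (\<lambda>\<omega>. (a i \<omega>)\<^sup>2) \<le> 3 * (s i)\<^sup>2" for i
        using four[of N "e i"] by (simp add: s_def a_def[abs_def] flip: power_mult)
      have "(expectation (\<lambda>\<omega>. a i \<omega> * a j \<omega>))\<^sup>2 \<le> expectation (\<lambda>\<omega>. (a i \<omega>)\<^sup>2) * expectation (\<lambda>\<omega>. (a j \<omega>)\<^sup>2)"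
        by (rule square_integrable_cauchy_schwarz[OF a2 a2])
      also have "\<dots> \<le> (3 * (s i)\<^sup>2) * (3 * (s j)\<^sup>2)" by (intro mult_mono 4) auto
      also have "\<dots> = (3 * (s i * s j))\<^sup>2" by (simp add: power2_eq_square)
      finally show ?thesis by (rule power2_le_imp_le) (simp add: s0)
    qed
    define q where "q \<omega> = (\<Sum>i<k. a i \<omega>)" for \<omega>
    have q2: "square_integrable M q" unfolding q_def[abs_def] by (rule square_integrable_sum[OF a2])
    note qi = square_integrable_integrable[OF q2]
    have q0: "q \<omega> \<ge> 0" for \<omega> by (simp add: q_def a_def sum_nonneg)
    have Eq: "expectation q = (\<Sum>i<k. s i)" unfolding q_def[abs_def] s_def
      using square_integrable_integrable[OF a2] by simp
    have Eq0: "expectation q \<ge> 0" unfolding Eq by (simp add: sum_nonneg s0)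
    have Eq2: "expectation (\<lambda>\<omega>. (q \<omega>)\<^sup>2) \<le> 3 * (expectation q)\<^sup>2"
    proof -
      have "expectation (\<lambda>\<omega>. (q \<omega>)\<^sup>2) = expectation (\<lambda>\<omega>. \<Sum>i<k. \<Sum>j<k. a i \<omega> * a j \<omega>)"
        by (simp add: q_def power2_eq_square sum_product)
      also have "\<dots> = (\<Sum>i<k. \<Sum>j<k. expectation (\<lambda>\<omega>. a i \<omega> * a j \<omega>))"
        using square_integrable_mult[OF a2 a2] by simp
      also have "\<dots> \<le> (\<Sum>i<k. \<Sum>j<k. 3 * (s i * s j))" by (intro sum_mono aij)
      also have "\<dots> = 3 * (expectation q)\<^sup>2"
      proof -
        have "(expectation q)\<^sup>2 = (\<Sum>i<k. \<Sum>j<k. s i * s j)"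
          unfolding Eq by (simp only: power2_eq_square sum_product)
        then show ?thesis by (simp only: sum_distrib_left)
      qed
      finally show ?thesis .
    qed
    have ind2: "(indicator (A m) \<omega> :: real)\<^sup>2 = indicator (A m) \<omega>" for \<omega>
      by (simp split: split_indicator)
    have iA2: "square_integrable M (indicator (A m))"
      by (simp add: square_integrable_def ind2 less_top[symmetric])
    have "(expectation (\<lambda>\<omega>. q \<omega> * indicator (A m) \<omega>))\<^sup>2 \<le> expectation (\<lambda>\<omega>. (q \<omega>)\<^sup>2) * expectation (\<lambda>\<omega>. (indicator (A m) \<omega>)\<^sup>2)"
      by (rule square_integrable_cauchy_schwarz[OF q2 iA2])
    also have "(\<lambda>\<omega>. (indicator (A m) \<omega> :: real)\<^sup>2) = indicator (A m)" by (simp only: ind2)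
    also have "expectation (indicator (A m)) = prob (A m)" by simp
    also have "expectation (\<lambda>\<omega>. (q \<omega>)\<^sup>2) * prob (A m) \<le> (3 * (expectation q)\<^sup>2) * (1 / 12)"
      using Eq2 m by (intro mult_mono) auto
    also have "\<dots> = (expectation q / 2)\<^sup>2" by (simp add: power2_eq_square)
    finally have half: "expectation (\<lambda>\<omega>. q \<omega> * indicator (A m) \<omega>) \<le> expectation q / 2"
      by (rule power2_le_imp_le) (simp add: Eq0)
    \<comment> \<open>Off \<open>A m\<close> Bessel's inequality bounds q by m; on
      \<open>A m\<close> half of E q is absorbed on the left.\<close>
    have "expectation q \<le> expectation (\<lambda>\<omega>. real m + q \<omega> * indicator (A m) \<omega>)"
    proof (rule integral_mono)
      show "integrable M (\<lambda>\<omega>. real m + q \<omega> * indicator (A m) \<omega>)"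
        using square_integrable_mult[OF q2 iA2] by simp
      fix \<omega> assume w: "\<omega> \<in> space M"
      show "q \<omega> \<le> real m + q \<omega> * indicator (A m) \<omega>"
      proof (cases "\<omega> \<in> A m")
        case False
        then have "(norm (Y N \<omega>))\<^sup>2 \<le> real m" using w by (auto simp: A_def not_less)
        then show ?thesis using False e1[of "Y N \<omega>" k] by (simp add: q_def a_def)
      qed simp
    qed (rule qi)
    also have "\<dots> = real m + expectation (\<lambda>\<omega>. q \<omega> * indicator (A m) \<omega>)"
      using square_integrable_mult[OF q2 iA2] by (simp add: prob_space)
    finally have "expectation q \<le> 2 * real m" using half by linarith
    then show ?thesis using qi by (simp add: q_def[abs_def] a_def)
  qed
  have YN: "(\<integral>\<^sup>+\<omega>. ennreal ((norm (Y N \<omega>))\<^sup>2) \<partial>M) \<le> ennreal (2 * real m)" for N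
  proof -
    have "(\<integral>\<^sup>+\<omega>. ennreal ((norm (Y N \<omega>))\<^sup>2) \<partial>M) = (\<integral>\<^sup>+\<omega>. liminf (\<lambda>k. ennreal (\<Sum>i<k. (Y N \<omega> \<bullet> e i)\<^sup>2)) \<partial>M)"
      by (intro nn_integral_cong lim_imp_Liminf[symmetric]) (auto intro!: e2)
    also have "\<dots> \<le> liminf (\<lambda>k. \<integral>\<^sup>+\<omega>. ennreal (\<Sum>i<k. (Y N \<omega> \<bullet> e i)\<^sup>2) \<partial>M)"
      by (rule nn_integral_liminf) auto
    also have "\<dots> \<le> ennreal (2 * real m)"
    proof -
      have "(\<integral>\<^sup>+\<omega>. ennreal (\<Sum>i<k. (Y N \<omega> \<bullet> e i)\<^sup>2) \<partial>M) \<le> ennreal (2 * real m)" for k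
        using main[of N k] by (subst nn_integral_eq_integral) (auto intro!: ennreal_leI sum_nonneg)
      then show ?thesis by (intro Liminf_le) auto
    qed
    finally show ?thesis .
  qed
  have "(\<integral>\<^sup>+\<omega>. ennreal ((norm (Z \<omega>))\<^sup>2) \<partial>M) = (\<integral>\<^sup>+\<omega>. liminf (\<lambda>N. ennreal ((norm (Y N \<omega>))\<^sup>2)) \<partial>M)"
  proof (rule nn_integral_cong_AE)
    show "AE \<omega> in M. ennreal ((norm (Z \<omega>))\<^sup>2) = liminf (\<lambda>N. ennreal ((norm (Y N \<omega>))\<^sup>2))"
      using lim by eventually_elim (auto intro!: lim_imp_Liminf[symmetric] tendsto_intros)
  qed
  also have "\<dots> \<le> liminf (\<lambda>N. \<integral>\<^sup>+\<omega>. ennreal ((norm (Y N \<omega>))\<^sup>2) \<partial>M)"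
    by (rule nn_integral_liminf) auto
  also have "\<dots> \<le> ennreal (2 * real m)" by (intro Liminf_le always_eventually allI YN) auto
  finally have "(\<integral>\<^sup>+\<omega>. ennreal ((norm (Z \<omega>))\<^sup>2) \<partial>M) < \<infinity>" using ennreal_less_top le_less_trans by fastforce
  then show ?thesis by (intro integrableI_bounded) auto
qed

section \<open>Analytic semigroups\<close>

lemma has_vector_derivative_iff_quotient:
  "(f has_vector_derivative q) (at t within X) \<longleftrightarrow>
    ((\<lambda>s. (f s - f t) /\<^sub>R (s - t)) \<longlongrightarrow> q) (at t within X)"
proof -
  have "(f has_vector_derivative q) (at t within X) \<longleftrightarrow>
      ((\<lambda>s. norm ((f s - f t) - (s - t) *\<^sub>R q) / norm (s - t)) \<longlongrightarrow> 0) (at t within X)"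
    by (simp add: has_vector_derivative_def has_derivative_iff_norm bounded_linear_scaleR_left)
  also have "\<dots> \<longleftrightarrow> ((\<lambda>s. norm ((f s - f t) /\<^sub>R (s - t) - q)) \<longlongrightarrow> 0) (at t within X)"
  proof (rule tendsto_cong)
    have "norm ((f s - f t) - (s - t) *\<^sub>R q) / norm (s - t) = norm ((f s - f t) /\<^sub>R (s - t) - q)" if "s \<noteq> t" for s
    proof -
      have "(f s - f t) /\<^sub>R (s - t) - q = ((f s - f t) - (s - t) *\<^sub>R q) /\<^sub>R (s - t)"
        using that by (simp add: scaleR_diff_right)
      then show ?thesis by (simp add: divide_inverse mult.commute)
    qed
    then show "\<forall>\<^sub>F s in at t within X. norm ((f s - f t) - (s - t) *\<^sub>R q) / norm (s - t)
        = norm ((f s - f t) /\<^sub>R (s - t) - q)"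
      by (auto simp: eventually_at_filter)
  qed
  also have "\<dots> \<longleftrightarrow> ((\<lambda>s. (f s - f t) /\<^sub>R (s - t)) \<longlongrightarrow> q) (at t within X)"
    by (simp add: tendsto_norm_zero_iff LIM_zero_iff)
  finally show ?thesis .
qed

section \<open>The generator and differentiability of orbits\<close>

lemma generatorI:
  fixes S :: "real \<Rightarrow> ('a::real_normed_vector \<Rightarrow>\<^sub>L 'a)"
  assumes "((\<lambda>h. (S h \<xi> - \<xi>) /\<^sub>R h) \<longlongrightarrow> \<eta>) (at_right 0)"
  shows "\<xi> \<in> generator_domain S" and "generator S \<xi> = \<eta>"
proof -
  show d: "\<xi> \<in> generator_domain S" using assms by (auto simp: generator_domain_def)
  show "generator S \<xi> = \<eta>"
    unfolding generator_def using d assms by (simp add: tendsto_Lim)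
qed

lemma generatorD:
  fixes S :: "real \<Rightarrow> ('a::real_normed_vector \<Rightarrow>\<^sub>L 'a)"
  assumes "\<xi> \<in> generator_domain S"
  shows "((\<lambda>h. (S h \<xi> - \<xi>) /\<^sub>R h) \<longlongrightarrow> generator S \<xi>) (at_right 0)"
proof -
  obtain \<eta> where "((\<lambda>h. (S h \<xi> - \<xi>) /\<^sub>R h) \<longlongrightarrow> \<eta>) (at_right 0)"
    using assms by (auto simp: generator_domain_def)
  then show ?thesis using generatorI(2) by metis
qed

lemma generator_add:
  fixes S :: "real \<Rightarrow> ('a::real_normed_vector \<Rightarrow>\<^sub>L 'a)"
  assumes "\<xi> \<in> generator_domain S" "\<eta> \<in> generator_domain S"
  shows "\<xi> + \<eta> \<in> generator_domain S" and "generator S (\<xi> + \<eta>) = generator S \<xi> + generator S \<eta>"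
proof -
  have "((\<lambda>h. (S h \<xi> - \<xi>) /\<^sub>R h + (S h \<eta> - \<eta>) /\<^sub>R h) \<longlongrightarrow> generator S \<xi> + generator S \<eta>) (at_right 0)"
    by (intro tendsto_intros generatorD assms)
  then have "((\<lambda>h. (S h (\<xi> + \<eta>) - (\<xi> + \<eta>)) /\<^sub>R h) \<longlongrightarrow> generator S \<xi> + generator S \<eta>) (at_right 0)"
    by (simp add: blinfun.add_right algebra_simps)
  then show "\<xi> + \<eta> \<in> generator_domain S" and "generator S (\<xi> + \<eta>) = generator S \<xi> + generator S \<eta>"
    by (fact generatorI)+
qed

lemma generator_scaleR:
  fixes S :: "real \<Rightarrow> ('a::real_normed_vector \<Rightarrow>\<^sub>L 'a)"
  assumes "\<xi> \<in> generator_domain S"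
  shows "a *\<^sub>R \<xi> \<in> generator_domain S" and "generator S (a *\<^sub>R \<xi>) = a *\<^sub>R generator S \<xi>"
proof -
  have "((\<lambda>h. a *\<^sub>R ((S h \<xi> - \<xi>) /\<^sub>R h)) \<longlongrightarrow> a *\<^sub>R generator S \<xi>) (at_right 0)"
    by (intro tendsto_intros generatorD assms)
  then have "((\<lambda>h. (S h (a *\<^sub>R \<xi>) - a *\<^sub>R \<xi>) /\<^sub>R h) \<longlongrightarrow> a *\<^sub>R generator S \<xi>) (at_right 0)"
    by (simp add: blinfun.scaleR_right scaleR_diff_right mult.commute)
  then show "a *\<^sub>R \<xi> \<in> generator_domain S" and "generator S (a *\<^sub>R \<xi>) = a *\<^sub>R generator S \<xi>"
    by (fact generatorI)+
qed

lemma generator_diff: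
  fixes S :: "real \<Rightarrow> ('a::real_normed_vector \<Rightarrow>\<^sub>L 'a)"
  assumes "\<xi> \<in> generator_domain S" "\<eta> \<in> generator_domain S"
  shows "\<xi> - \<eta> \<in> generator_domain S" and "generator S (\<xi> - \<eta>) = generator S \<xi> - generator S \<eta>"
  using generator_add[OF assms(1) generator_scaleR(1)[OF assms(2), of "-1"]] generator_scaleR(2)[OF assms(2), of "-1"]
  by simp_all

lemma tendsto_at_right_shift:
  fixes t :: real
  shows "(f \<longlongrightarrow> l) (at_right t) \<longleftrightarrow> ((\<lambda>h. f (t + h)) \<longlongrightarrow> l) (at_right 0)"
  unfolding at_right_to_0[of t] filterlim_filtermap by (simp add: add.commute)

lemma at_within_atLeast_real: "at (t::real) within {t..} = at_right t"
  by (rule at_within_nhd[of t UNIV]) auto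

locale bounded_analytic_semigroup =
  fixes S :: "real \<Rightarrow> ('x::{real_inner, banach, second_countable_topology} \<Rightarrow>\<^sub>L 'x)" and T \<mu> :: real
  assumes analytic: "analytic_semigroup S" and T: "0 < T"
    and \<mu>: "\<And>t. 0 \<le> t \<Longrightarrow> t \<le> T \<Longrightarrow> norm (S t) \<le> \<mu>"
begin

lemma C0: "C0_semigroup S" using analytic by (simp add: analytic_semigroup_def)

lemma S_0 [simp]: "S 0 \<xi> = \<xi>" using C0 by (simp add: C0_semigroup_def)

lemma S_add: "0 \<le> s \<Longrightarrow> 0 \<le> t \<Longrightarrow> S (s + t) \<xi> = S s (S t \<xi>)"
  using C0 by (simp add: C0_semigroup_def)

lemma S_commute: "0 \<le> s \<Longrightarrow> 0 \<le> t \<Longrightarrow> S s (S t \<xi>) = S t (S s \<xi>)"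
  by (metis S_add add.commute)

lemma S_at_right_0: "((\<lambda>t. S t \<xi>) \<longlongrightarrow> \<xi>) (at_right 0)"
  using C0 by (simp add: C0_semigroup_def)

lemma \<mu>_nonneg: "0 \<le> \<mu>"
  by (rule order_trans[OF norm_ge_zero \<mu>[of 0]]) (use T in auto)

lemma norm_S: "0 \<le> t \<Longrightarrow> t \<le> T \<Longrightarrow> norm (S t \<xi>) \<le> \<mu> * norm \<xi>"
  using norm_blinfun[of "S t" \<xi>] mult_right_mono[OF \<mu>[of t], of "norm \<xi>"] by simp

text \<open>The complex derivative of the extension \<open>U\<close> at the real point t, taken
  along real increments and in the first component, is the derivative of the orbit.\<close>

lemma S_differentiable:
  assumes t: "0 < t"
  shows "\<exists>q. ((\<lambda>s. S s \<xi>) has_vector_derivative q) (at t)"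
proof -
  obtain \<theta> and U :: "complex \<Rightarrow> (('x \<times> 'x) \<Rightarrow>\<^sub>L ('x \<times> 'x))" where \<theta>: "0 < \<theta>"
    and UR: "\<And>t \<xi>. t > 0 \<Longrightarrow> blinfun_apply (U (complex_of_real t)) (\<xi>, 0) = (S t \<xi>, 0)"
    and UD: "\<And>z p. z \<in> sector \<theta> \<Longrightarrow> \<exists>q. ((\<lambda>h. cscale (inverse h) (blinfun_apply (U (z + h)) p - blinfun_apply (U z) p)) \<longlongrightarrow> q) (at 0)"
    using analytic unfolding analytic_semigroup_def by blast
  have "complex_of_real t \<in> sector \<theta>" using t \<theta> by (simp add: sector_def Arg_of_real)
  from UD[OF this] obtain q where
    q: "((\<lambda>h. cscale (inverse h) (blinfun_apply (U (complex_of_real t + h)) (\<xi>, 0) - blinfun_apply (U (complex_of_real t)) (\<xi>, 0))) \<longlongrightarrow> q) (at 0)"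
    by blast
  have lim: "filterlim (\<lambda>s. complex_of_real (s - t)) (at 0) (at t)"
    unfolding filterlim_at
  proof
    show "((\<lambda>s. complex_of_real (s - t)) \<longlongrightarrow> 0) (at t)"
      by (rule tendsto_eq_intros | simp)+
    show "\<forall>\<^sub>F s in at t. complex_of_real (s - t) \<in> UNIV \<and> complex_of_real (s - t) \<noteq> 0"
      by (auto simp: eventually_at_filter)
  qed
  have "((\<lambda>s. fst (cscale (inverse (complex_of_real (s - t)))
      (blinfun_apply (U (complex_of_real t + complex_of_real (s - t))) (\<xi>, 0) - blinfun_apply (U (complex_of_real t)) (\<xi>, 0)))) \<longlongrightarrow> fst q) (at t)"
    by (intro tendsto_fst filterlim_compose[OF q lim])
  moreover have "\<forall>\<^sub>F s in at t. fst (cscale (inverse (complex_of_real (s - t)))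
      (blinfun_apply (U (complex_of_real t + complex_of_real (s - t))) (\<xi>, 0) - blinfun_apply (U (complex_of_real t)) (\<xi>, 0)))
      = (S s \<xi> - S t \<xi>) /\<^sub>R (s - t)"
  proof -
    have "\<forall>\<^sub>F s in at t. s > 0" using t by (rule order_tendstoD(1)[OF tendsto_ident_at])
    then show ?thesis
    proof eventually_elim
      case (elim s)
      have "inverse (complex_of_real (s - t)) = complex_of_real (inverse (s - t))" by simp
      moreover have "complex_of_real t + complex_of_real (s - t) = complex_of_real s" by simp
      ultimately show ?case using UR[OF t, of \<xi>] UR[OF elim, of \<xi>]
        by (simp only: cscale_def Re_complex_of_real Im_complex_of_real fst_diff fst_conv) simp
    qed
  qed
  ultimately have "((\<lambda>s. (S s \<xi> - S t \<xi>) /\<^sub>R (s - t)) \<longlongrightarrow> fst q) (at t)"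
    by (rule Lim_transform_eventually)
  then show ?thesis unfolding has_vector_derivative_iff_quotient by blast
qed

lemma S_quotient_shift:
  assumes "0 \<le> t"
  shows "((\<lambda>s. (S s \<xi> - S t \<xi>) /\<^sub>R (s - t)) \<longlongrightarrow> q) (at_right t) \<longleftrightarrow>
    ((\<lambda>h. S t ((S h \<xi> - \<xi>) /\<^sub>R h)) \<longlongrightarrow> q) (at_right 0)"
  unfolding tendsto_at_right_shift[of _ q t]
  by (rule tendsto_cong)
     (use assms in \<open>auto simp: eventually_at_filter S_add blinfun.scaleR_right blinfun.diff_right\<close>)

text \<open>The smoothing property: the right difference quotient of the orbit at t equals, since
  the operators commute, the quotient at 0 of the vector S t \<xi>. Differentiability at t > 0
  therefore puts this vector into the domain for every \<xi>.\<close>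

lemma S_in_domain:
  assumes t: "0 < t"
  shows "S t \<xi> \<in> generator_domain S"
    and "((\<lambda>s. S s \<xi>) has_vector_derivative generator S (S t \<xi>)) (at t)"
proof -
  obtain q where q: "((\<lambda>s. S s \<xi>) has_vector_derivative q) (at t)" using S_differentiable[OF t] by blast
  then have "((\<lambda>s. (S s \<xi> - S t \<xi>) /\<^sub>R (s - t)) \<longlongrightarrow> q) (at t)"
    by (simp add: has_vector_derivative_iff_quotient)
  then have "((\<lambda>s. (S s \<xi> - S t \<xi>) /\<^sub>R (s - t)) \<longlongrightarrow> q) (at_right t)"
    by (rule filterlim_mono) (auto simp: at_le)
  then have "((\<lambda>h. S t ((S h \<xi> - \<xi>) /\<^sub>R h)) \<longlongrightarrow> q) (at_right 0)"
    using t by (simp only: S_quotient_shift[OF less_imp_le])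
  moreover have "\<forall>\<^sub>F h in at_right 0. S t ((S h \<xi> - \<xi>) /\<^sub>R h) = (S h (S t \<xi>) - S t \<xi>) /\<^sub>R h"
    using t by (auto simp: eventually_at_filter S_commute blinfun.scaleR_right blinfun.diff_right)
  ultimately have "((\<lambda>h. (S h (S t \<xi>) - S t \<xi>) /\<^sub>R h) \<longlongrightarrow> q) (at_right 0)"
    by (rule Lim_transform_eventually)
  note * = generatorI[OF this]
  show "S t \<xi> \<in> generator_domain S" by (rule *(1))
  show "((\<lambda>s. S s \<xi>) has_vector_derivative generator S (S t \<xi>)) (at t)" using q *(2) by simp
qed

text \<open>At t = 0 this is strong continuity; at t > 0 it follows from differentiability of the
  orbit.\<close>

lemma S_continuous: "continuous_on {0..} (\<lambda>s. S s \<xi>)"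
  unfolding continuous_on_def
proof
  fix t :: real assume "t \<in> {0..}"
  then consider "t = 0" | "t > 0" by fastforce
  then show "((\<lambda>s. S s \<xi>) \<longlongrightarrow> S t \<xi>) (at t within {0..})"
  proof cases
    case 1 then show ?thesis using S_at_right_0 by (simp add: at_within_atLeast_real)
  next
    case 2
    then have "isCont (\<lambda>s. S s \<xi>) t" by (intro has_vector_derivative_continuous[OF S_in_domain(2)])
    then show ?thesis unfolding isCont_def by (rule tendsto_within_subset) simp
  qed
qed

lemma S_continuous_Icc: "0 \<le> a \<Longrightarrow> continuous_on {a..b} (\<lambda>s. S s \<xi>)"
  using S_continuous by (rule continuous_on_subset) auto

text \<open>The bounded operator S t passes through the limit of the quotients that defines the
  generator. The derivative is taken within {0..} so that t = 0 is included, where it is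
  one-sided.\<close>

lemma generator_S:
  assumes \<xi>: "\<xi> \<in> generator_domain S" and t: "0 \<le> t"
  shows "S t \<xi> \<in> generator_domain S" and "generator S (S t \<xi>) = S t (generator S \<xi>)"
    and "((\<lambda>s. S s \<xi>) has_vector_derivative S t (generator S \<xi>)) (at t within {0..})"
proof -
  have lim: "((\<lambda>h. S t ((S h \<xi> - \<xi>) /\<^sub>R h)) \<longlongrightarrow> S t (generator S \<xi>)) (at_right 0)"
    by (intro blinfun.tendsto tendsto_const generatorD \<xi>)
  moreover have "\<forall>\<^sub>F h in at_right 0. S t ((S h \<xi> - \<xi>) /\<^sub>R h) = (S h (S t \<xi>) - S t \<xi>) /\<^sub>R h"
    using t by (auto simp: eventually_at_filter S_commute blinfun.scaleR_right blinfun.diff_right)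
  ultimately have "((\<lambda>h. (S h (S t \<xi>) - S t \<xi>) /\<^sub>R h) \<longlongrightarrow> S t (generator S \<xi>)) (at_right 0)"
    by (rule Lim_transform_eventually)
  note * = generatorI[OF this]
  show "S t \<xi> \<in> generator_domain S" "generator S (S t \<xi>) = S t (generator S \<xi>)" by (fact *)+
  show "((\<lambda>s. S s \<xi>) has_vector_derivative S t (generator S \<xi>)) (at t within {0..})"
  proof (cases "t = 0")
    case True
    then show ?thesis using generatorD[OF \<xi>]
      by (simp add: has_vector_derivative_iff_quotient at_within_atLeast_real)
  next
    case False
    then show ?thesis using S_in_domain(2)[of t \<xi>] t *(2)
      by (simp add: has_vector_derivative_at_within)
  qed
qed

section \<open>Integrals of orbits\<close>

text \<open>The vector to which C is applied in the output. It lies in the domain of the generator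
  for every initial vector, so C may act on it in both cases.\<close>

definition orbit_integral :: "real \<Rightarrow> 'x \<Rightarrow> 'x" where
  "orbit_integral t \<xi> = integral {0..t} (\<lambda>s. S s \<xi>)"

lemma S_integrable: "0 \<le> a \<Longrightarrow> (\<lambda>s. S s \<xi>) integrable_on {a..b}"
  by (intro integrable_continuous_real S_continuous_Icc)

lemma orbit_integral_add: "orbit_integral t (\<xi> + \<eta>) = orbit_integral t \<xi> + orbit_integral t \<eta>"
  unfolding orbit_integral_def blinfun.add_right by (rule Henstock_Kurzweil_Integration.integral_add) (auto intro: S_integrable)

lemma orbit_integral_scaleR: "orbit_integral t (a *\<^sub>R \<xi>) = a *\<^sub>R orbit_integral t \<xi>"
  unfolding orbit_integral_def blinfun.scaleR_right by simp

lemma norm_orbit_integral: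
  assumes "0 \<le> t" "t \<le> T"
  shows "norm (orbit_integral t \<xi>) \<le> \<mu> * t * norm \<xi>"
proof -
  have "norm (integral {0..t} (\<lambda>s. S s \<xi>)) \<le> (\<mu> * norm \<xi>) * (t - 0)"
    by (rule integral_bound) (use assms in \<open>auto intro!: S_continuous_Icc norm_S\<close>)
  then show ?thesis by (simp add: orbit_integral_def mult_ac)
qed

lemma bounded_linear_orbit_integral:
  assumes "0 \<le> t" "t \<le> T"
  shows "bounded_linear (orbit_integral t)"
  by (rule bounded_linear_intro[where K="\<mu> * t"])
     (use norm_orbit_integral[OF assms] in \<open>auto simp: orbit_integral_add orbit_integral_scaleR mult.commute\<close>)

lemma orbit_integral_0 [simp]: "orbit_integral 0 \<xi> = 0"
  by (simp add: orbit_integral_def)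

lemma orbit_integral_derivative:
  assumes "0 \<le> t" "t \<le> b"
  shows "((\<lambda>s. orbit_integral s \<xi>) has_vector_derivative S t \<xi>) (at t within {0..b})"
  unfolding orbit_integral_def
  by (rule integral_has_vector_derivative) (use assms in \<open>auto intro: S_continuous_Icc\<close>)

lemma orbit_integral_derivative_right:
  assumes "0 \<le> t"
  shows "((\<lambda>h. (orbit_integral (t + h) \<xi> - orbit_integral t \<xi>) /\<^sub>R h) \<longlongrightarrow> S t \<xi>) (at_right 0)"
proof -
  have "((\<lambda>s. (orbit_integral s \<xi> - orbit_integral t \<xi>) /\<^sub>R (s - t)) \<longlongrightarrow> S t \<xi>) (at t within {0..t+1})"
    using orbit_integral_derivative[of t "t+1" \<xi>] assms by (simp add: has_vector_derivative_iff_quotient)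
  then have "((\<lambda>s. (orbit_integral s \<xi> - orbit_integral t \<xi>) /\<^sub>R (s - t)) \<longlongrightarrow> S t \<xi>) (at t within {t<..<t+1})"
    by (rule tendsto_within_subset) (use assms in auto)
  moreover have "at t within {t<..<t+1} = at_right t" by (rule at_within_nhd[of t "{..<t+1}"]) auto
  ultimately have "((\<lambda>s. (orbit_integral s \<xi> - orbit_integral t \<xi>) /\<^sub>R (s - t)) \<longlongrightarrow> S t \<xi>) (at_right t)"
    by simp
  then show ?thesis unfolding tendsto_at_right_shift[of _ _ t] by simp
qed

text \<open>The operator S h passes under the integral and shifts the interval from [0, t] to
  [h, t + h]; both sides of the shift are the same because S h commutes with the orbit.\<close>

lemma S_orbit_integral:
  assumes "0 \<le> h" "0 \<le> t"
  shows "S h (orbit_integral t \<xi>) = orbit_integral (t + h) \<xi> - orbit_integral h \<xi>"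
    and "orbit_integral t (S h \<xi>) = orbit_integral (t + h) \<xi> - orbit_integral h \<xi>"
proof -
  have "S h (orbit_integral t \<xi>) = integral {0..t} (\<lambda>s. S h (S s \<xi>))"
    unfolding orbit_integral_def
    using integral_linear[OF S_integrable[of 0 \<xi> t] blinfun.bounded_linear_right[of "S h"]] by (simp add: comp_def)
  also have "\<dots> = orbit_integral t (S h \<xi>)"
    unfolding orbit_integral_def by (rule Henstock_Kurzweil_Integration.integral_cong) (use assms in \<open>auto simp: S_commute\<close>)
  finally have 1: "S h (orbit_integral t \<xi>) = orbit_integral t (S h \<xi>)" .
  have "orbit_integral t (S h \<xi>) = integral {0..t} (\<lambda>s. S (s + h) \<xi>)"
    unfolding orbit_integral_def by (rule Henstock_Kurzweil_Integration.integral_cong) (use assms in \<open>auto simp: S_add\<close>)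
  also have "\<dots> = integral {h..t+h} (\<lambda>s. S s \<xi>)"
    using integral_shift_real_ivl[of h h "t + h" "\<lambda>s. S s \<xi>"] by simp
  also have "\<dots> = orbit_integral (t + h) \<xi> - orbit_integral h \<xi>"
    unfolding orbit_integral_def
    using Henstock_Kurzweil_Integration.integral_combine[of 0 h "t + h" "\<lambda>s. S s \<xi>"] assms S_integrable[of 0 \<xi> "t+h"] by (simp add: algebra_simps)
  finally show "orbit_integral t (S h \<xi>) = orbit_integral (t + h) \<xi> - orbit_integral h \<xi>" .
  with 1 show "S h (orbit_integral t \<xi>) = orbit_integral (t + h) \<xi> - orbit_integral h \<xi>" by simp
qed

text \<open>By the shift formula the difference quotient is the average of the orbit over [t, t + h]
  minus the average over [0, h].\<close>

lemma generator_orbit_integral: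
  assumes t: "0 \<le> t"
  shows "orbit_integral t \<xi> \<in> generator_domain S" and "generator S (orbit_integral t \<xi>) = S t \<xi> - \<xi>"
proof -
  have "((\<lambda>h. (orbit_integral (t + h) \<xi> - orbit_integral t \<xi>) /\<^sub>R h - (orbit_integral (0 + h) \<xi> - orbit_integral 0 \<xi>) /\<^sub>R h) \<longlongrightarrow> S t \<xi> - S 0 \<xi>) (at_right 0)"
    by (intro tendsto_diff orbit_integral_derivative_right t) simp
  moreover have "\<forall>\<^sub>F h in at_right 0. (orbit_integral (t + h) \<xi> - orbit_integral t \<xi>) /\<^sub>R h - (orbit_integral (0 + h) \<xi> - orbit_integral 0 \<xi>) /\<^sub>R h
      = (S h (orbit_integral t \<xi>) - orbit_integral t \<xi>) /\<^sub>R h"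
    using t by (auto simp: eventually_at_filter S_orbit_integral(1) scaleR_diff_right)
  ultimately have "((\<lambda>h. (S h (orbit_integral t \<xi>) - orbit_integral t \<xi>) /\<^sub>R h) \<longlongrightarrow> S t \<xi> - S 0 \<xi>) (at_right 0)"
    by (rule Lim_transform_eventually)
  from generatorI[OF this] show "orbit_integral t \<xi> \<in> generator_domain S"
    "generator S (orbit_integral t \<xi>) = S t \<xi> - \<xi>" by simp_all
qed

section \<open>Measurability of the domain and of the generator\<close>

text \<open>A sequence of bounded linear maps approximating the generator on its domain. Continuity
  gives Borel measurability of the limit; linearity makes the images of a Gaussian variable
  Gaussian.\<close>

definition generator_quotient :: "nat \<Rightarrow> 'x \<Rightarrow> 'x" where
  "generator_quotient N \<xi> = (S (1 / real (Suc N)) \<xi> - \<xi>) /\<^sub>R (1 / real (Suc N))"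

lemma filterlim_inverse_Suc: "filterlim (\<lambda>N. 1 / real (Suc N)) (at_right 0) sequentially"
proof -
  have "(\<lambda>N. 1 / real (Suc N)) \<longlonglongrightarrow> 0"
    using LIMSEQ_Suc[OF lim_1_over_n] .
  then show ?thesis by (auto simp: filterlim_at intro!: always_eventually)
qed

lemma generator_quotient_tendsto:
  "\<xi> \<in> generator_domain S \<Longrightarrow> (\<lambda>N. generator_quotient N \<xi>) \<longlonglongrightarrow> generator S \<xi>"
  unfolding generator_quotient_def by (rule filterlim_compose[OF generatorD filterlim_inverse_Suc])

text \<open>Convergence along \<open>h = 1/N\<close> suffices: it identifies \<open>S t \<xi> - \<xi>\<close> with the integral of the
  orbit of the limit. Hence the domain is a Borel set.\<close>
lemma generator_domain_sequential:
  assumes lim: "(\<lambda>N. generator_quotient N \<xi>) \<longlonglongrightarrow> \<eta>"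
  shows "\<xi> \<in> generator_domain S"
proof -
  have eq: "S t \<xi> - \<xi> = orbit_integral t \<eta>" if t: "0 \<le> t" "t \<le> T" for t
  proof -
    interpret I: bounded_linear "orbit_integral t" by (rule bounded_linear_orbit_integral[OF t])
    define h where "h N = 1 / real (Suc N)" for N
    have h: "h N > 0" for N by (simp add: h_def)
    have "orbit_integral t (generator_quotient N \<xi>) = (orbit_integral (t + h N) \<xi> - orbit_integral t \<xi>) /\<^sub>R h N
        - (orbit_integral (0 + h N) \<xi> - orbit_integral 0 \<xi>) /\<^sub>R h N" for N
      unfolding generator_quotient_def h_def[symmetric]
      using S_orbit_integral(2)[OF less_imp_le[OF h] t(1), of N \<xi>]
      by (simp add: I.scaleR I.diff scaleR_diff_right)
    moreover have "((\<lambda>h. (orbit_integral (t + h) \<xi> - orbit_integral t \<xi>) /\<^sub>R h - (orbit_integral (0 + h) \<xi> - orbit_integral 0 \<xi>) /\<^sub>R h) \<longlongrightarrow> S t \<xi> - S 0 \<xi>) (at_right 0)"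
      by (intro tendsto_diff orbit_integral_derivative_right t) simp
    note filterlim_compose[OF this filterlim_inverse_Suc]
    ultimately have "(\<lambda>N. orbit_integral t (generator_quotient N \<xi>)) \<longlonglongrightarrow> S t \<xi> - \<xi>"
      by (simp add: h_def)
    moreover have "(\<lambda>N. orbit_integral t (generator_quotient N \<xi>)) \<longlonglongrightarrow> orbit_integral t \<eta>"
      by (rule I.tendsto[OF lim])
    ultimately show ?thesis by (rule LIMSEQ_unique)
  qed
  \<comment> \<open>The identity just obtained rewrites the quotient of \<xi> at every small h > 0
    as an average of the orbit of \<eta>, so the limit exists along all h and not only along the
    sequence.\<close>
  have "((\<lambda>h. (orbit_integral (0 + h) \<eta> - orbit_integral 0 \<eta>) /\<^sub>R h) \<longlongrightarrow> S 0 \<eta>) (at_right 0)"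
    by (rule orbit_integral_derivative_right) simp
  moreover have "\<forall>\<^sub>F h in at_right 0. (orbit_integral (0 + h) \<eta> - orbit_integral 0 \<eta>) /\<^sub>R h = (S h \<xi> - \<xi>) /\<^sub>R h"
    using eventually_at_right_less[of 0] order_tendstoD(2)[OF tendsto_ident_at T, of "{0<..}"]
    by eventually_elim (simp add: eq)
  ultimately have "((\<lambda>h. (S h \<xi> - \<xi>) /\<^sub>R h) \<longlongrightarrow> S 0 \<eta>) (at_right 0)"
    by (rule Lim_transform_eventually)
  then show ?thesis by (rule generatorI(1))
qed

lemma measurable_generator_quotient [measurable]: "generator_quotient N \<in> borel_measurable borel"
  unfolding generator_quotient_def[abs_def]
  by (intro borel_measurable_continuous_onI continuous_intros)

text \<open>By completeness the Cauchy condition replaces existence of a limit, and it is a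
  countable condition on continuous functions of \<xi>.\<close>

lemma generator_domain_eq: "generator_domain S = {\<xi>. Cauchy (\<lambda>N. generator_quotient N \<xi>)}"
  unfolding Cauchy_convergent_iff
proof (intro set_eqI iffI CollectI)
  fix \<xi> assume "\<xi> \<in> generator_domain S"
  then show "convergent (\<lambda>N. generator_quotient N \<xi>)" by (rule convergentI[OF generator_quotient_tendsto])
next
  fix \<xi> assume "\<xi> \<in> {\<xi>. convergent (\<lambda>N. generator_quotient N \<xi>)}"
  then obtain \<eta> where "(\<lambda>N. generator_quotient N \<xi>) \<longlonglongrightarrow> \<eta>" unfolding convergent_def by auto
  then show "\<xi> \<in> generator_domain S" by (rule generator_domain_sequential)
qed

lemma sets_generator_domain [measurable]: "generator_domain S \<in> sets borel"
proof -
  have "{\<xi> \<in> space borel. Cauchy (\<lambda>N. generator_quotient N \<xi>)} \<in> sets borel"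
    by (rule sets_Collect_Cauchy) measurable
  then show ?thesis by (simp add: generator_domain_eq)
qed

lemma measurable_generator [measurable]: "generator S \<in> borel_measurable borel"
proof -
  \<comment> \<open>On the Borel set where it converges, the generator is the limit of continuous
    maps; off this set its conventional value is constant.\<close>
  have "generator S = (\<lambda>\<xi>. if \<xi> \<in> generator_domain S then lim (\<lambda>N. generator_quotient N \<xi>) else 0)"
  proof
    fix \<xi>
    show "generator S \<xi> = (if \<xi> \<in> generator_domain S then lim (\<lambda>N. generator_quotient N \<xi>) else 0)"
    proof (cases "\<xi> \<in> generator_domain S")
      case True
      then show ?thesis using limI[OF generator_quotient_tendsto[OF True]] by (simp only: if_True)
    next
      case False
      then show ?thesis by (simp only: generator_def if_False)
    qed
  qed
  also have "\<dots> \<in> borel_measurable borel"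
    by (rule measurable_If_set[OF borel_measurable_lim_metric[OF measurable_generator_quotient]])
       (simp_all add: sets_generator_domain)
  finally show ?thesis .
qed

end

section \<open>Brownian motion and step functions\<close>

lemma positive_definite_symmetric:
  assumes "positive_definite R"
  shows "(R *v v) \<bullet> u = v \<bullet> (R *v u)"
  using assms dot_lmul_matrix[of v R u] unfolding positive_definite_def
  by (metis transpose_matrix_vector)

text \<open>\<open>Min\<close> needs a finite nonempty set. Eigenvectors for distinct eigenvalues
  are orthogonal, hence independent, so there are finitely many eigenvalues; a minimiser of the
  quadratic form on the unit sphere is an eigenvector, so there is at least one. The minimum l on
  the sphere is thus an eigenvalue and the form dominates l |v|^2.\<close>

theorem min_eigenvalue_positive_definite:
  fixes R :: "real^'r^'r"
  assumes R: "positive_definite R"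
  shows "0 < min_eigenvalue R" and "min_eigenvalue R * (norm v)\<^sup>2 \<le> v \<bullet> (R *v v)"
proof -
  note sym = positive_definite_symmetric[OF R]
  define E where "E = {l. \<exists>v. v \<noteq> 0 \<and> R *v v = l *\<^sub>R v}"
  have "\<forall>l\<in>E. \<exists>v. v \<noteq> 0 \<and> R *v v = l *\<^sub>R v" by (auto simp: E_def)
  from bchoice[OF this] obtain f where "\<forall>l\<in>E. f l \<noteq> 0 \<and> R *v f l = l *\<^sub>R f l" ..
  then have f: "f l \<noteq> 0 \<and> R *v f l = l *\<^sub>R f l" if "l \<in> E" for l using that by blast
  have orth: "f l \<bullet> f k = 0" if "l \<in> E" "k \<in> E" "l \<noteq> k" for l k
  proof -
    have "l * (f l \<bullet> f k) = k * (f l \<bullet> f k)"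
      using sym[of "f l" "f k"] f[OF that(1)] f[OF that(2)] by simp
    then show ?thesis using that(3) by simp
  qed
  have "inj_on f E"
  proof (rule inj_onI)
    fix l k assume lk: "l \<in> E" "k \<in> E" "f l = f k"
    show "l = k"
    proof (rule ccontr)
      assume "l \<noteq> k"
      then have "f l \<bullet> f l = 0" using orth[of l k] lk by simp
      then show False using f[OF lk(1)] by simp
    qed
  qed
  moreover have "independent (f ` E)"
    by (rule pairwise_orthogonal_independent) (use orth f in \<open>auto simp: pairwise_def orthogonal_def\<close>)
  then have "finite (f ` E)" by (rule independent_imp_finite)
  ultimately have finE: "finite E" using finite_imageD by blast
  have "\<exists>x\<in>sphere 0 1. \<forall>y\<in>sphere (0::real^'r) 1. x \<bullet> (R *v x) \<le> y \<bullet> (R *v y)"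
  proof (rule continuous_attains_inf)
    show "continuous_on (sphere 0 1) (\<lambda>x. x \<bullet> (R *v x))"
      by (intro continuous_intros linear_continuous_on) (simp add: matrix_vector_mul_bounded_linear)
    have "axis undefined 1 \<in> sphere (0::real^'r) 1" by simp
    then show "sphere (0::real^'r) 1 \<noteq> {}" by blast
  qed simp
  then obtain v0 :: "real^'r" where v0: "norm v0 = 1"
    and min0: "\<And>y. norm y = 1 \<Longrightarrow> v0 \<bullet> (R *v v0) \<le> y \<bullet> (R *v y)" by auto
  define l where "l = v0 \<bullet> (R *v v0)"
  have low: "l * (norm y)\<^sup>2 \<le> y \<bullet> (R *v y)" for y
  proof (cases "y = 0")
    case False
    have "l \<le> (y /\<^sub>R norm y) \<bullet> (R *v (y /\<^sub>R norm y))"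
      unfolding l_def by (rule min0) (simp add: False)
    also have "\<dots> = (y \<bullet> (R *v y)) / (norm y)\<^sup>2"
      by (simp add: matrix_vector_mult_scaleR power2_eq_square field_simps)
    finally show ?thesis using False by (simp add: pos_le_divide_eq)
  qed simp
  \<comment> \<open>The defect of the eigenvalue equation at the minimiser. Moving from
    \<open>v0\<close> in this very direction has first variation z \<bullet> z for the nonnegative
    form v \<bullet> (R v) - l |v|^2, which vanishes at \<open>v0\<close>; so z = 0.\<close>
  define z where "z = R *v v0 - l *\<^sub>R v0"
  have "z \<bullet> z = 0"
  proof (rule quadratic_nonneg_imp_zero)
    fix t :: real
    have "0 \<le> (v0 + t *\<^sub>R z) \<bullet> (R *v (v0 + t *\<^sub>R z)) - l * (norm (v0 + t *\<^sub>R z))\<^sup>2"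
      using low[of "v0 + t *\<^sub>R z"] by simp
    also have "\<dots> = (v0 \<bullet> (R *v v0) - l * (v0 \<bullet> v0)) + 2 * t * ((R *v v0) \<bullet> z - l * (v0 \<bullet> z))
        + t\<^sup>2 * (z \<bullet> (R *v z) - l * (z \<bullet> z))"
      unfolding power2_norm_eq_inner
      by (simp add: matrix_vector_right_distrib matrix_vector_mult_scaleR inner_add_left inner_add_right
          sym[of v0 z] inner_commute[of z "R *v v0"] inner_commute[of z v0] power2_eq_square algebra_simps)
    also have "v0 \<bullet> (R *v v0) - l * (v0 \<bullet> v0) = 0" using v0 by (simp add: l_def dot_square_norm)
    also have "(R *v v0) \<bullet> z - l * (v0 \<bullet> z) = z \<bullet> z" by (simp add: z_def inner_diff_left)
    finally show "0 \<le> 2 * t * (z \<bullet> z) + t\<^sup>2 * (z \<bullet> (R *v z) - l * (z \<bullet> z))" by simp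
  next
    show "0 \<le> z \<bullet> (R *v z) - l * (z \<bullet> z)" using low[of z] by (simp add: power2_norm_eq_inner)
  qed
  then have "R *v v0 = l *\<^sub>R v0" by (simp add: z_def)
  then have lE: "l \<in> E" unfolding E_def using v0 by (intro CollectI exI[of _ v0]) auto
  have me: "min_eigenvalue R = Min E" by (simp add: min_eigenvalue_def E_def)
  have "Min E \<in> E" using finE lE by (intro Min_in) auto
  from f[OF this] have fM: "f (Min E) \<noteq> 0" "R *v f (Min E) = Min E *\<^sub>R f (Min E)" by blast+
  have "0 < v \<bullet> (R *v v)" if "v \<noteq> 0" for v using R that by (simp add: positive_definite_def)
  from this[OF fM(1)] have "0 < Min E * (f (Min E) \<bullet> f (Min E))" unfolding fM(2) by simp
  then show "0 < min_eigenvalue R" unfolding me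
    using inner_ge_zero[of "f (Min E)"] by (simp add: zero_less_mult_iff)
  have "Min E \<le> l" using finE lE by simp
  then have "min_eigenvalue R * (norm v)\<^sup>2 \<le> l * (norm v)\<^sup>2" unfolding me by (rule mult_right_mono) simp
  then show "min_eigenvalue R * (norm v)\<^sup>2 \<le> v \<bullet> (R *v v)" using low[of v] by linarith
qed

text \<open>Independence of two sigma-algebras passes to the smaller ones generated by f and
  g.\<close>

lemma (in prob_space) indep_var_of_indep_set:
  assumes ind: "indep_set (sets A) (sets B)" and sp: "space A = space M" "space B = space M"
    and f: "f \<in> borel_measurable A" and g: "g \<in> borel_measurable B"
  shows "indep_var borel f borel g"
proof -
  have AB: "sets A \<subseteq> sets M" "sets B \<subseteq> sets M"
    using indep_setD_ev1[OF ind] indep_setD_ev2[OF ind] by auto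
  have fM: "f \<in> borel_measurable M" "g \<in> borel_measurable M"
    using f g AB sp by (auto simp: measurable_def)
  have sA: "sigma_sets (space M) {f -` S \<inter> space M |S. S \<in> sets borel} \<subseteq> sets A"
    unfolding sp(1)[symmetric] by (rule sets.sigma_sets_subset) (use f in \<open>auto intro: measurable_sets\<close>)
  have sB: "sigma_sets (space M) {g -` S \<inter> space M |S. S \<in> sets borel} \<subseteq> sets B"
    unfolding sp(2)[symmetric] by (rule sets.sigma_sets_subset) (use g in \<open>auto intro: measurable_sets\<close>)
  show ?thesis unfolding indep_var_eq
    using fM indep_sets_mono_sets[OF ind[unfolded indep_set_def],
        of "case_bool (sigma_sets (space M) {f -` S \<inter> space M |S. S \<in> sets borel})
                      (sigma_sets (space M) {g -` S \<inter> space M |S. S \<in> sets borel})"] sA sB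
    unfolding indep_set_def by (auto split: bool.splits)
qed

lemma integral_mult_indep_zero:
  assumes "prob_space M" "prob_space.indep_var M borel f borel g"
    and "square_integrable M f" "square_integrable M g" "(\<integral>\<omega>. g \<omega> \<partial>M) = (0::real)"
  shows "(\<integral>\<omega>. f \<omega> * g \<omega> \<partial>M) = 0"
proof -
  interpret prob_space M by fact
  show ?thesis using indep_var_lebesgue_integral[OF assms(2) square_integrable_integrable[OF assms(3)]
      square_integrable_integrable[OF assms(4)]] assms(5) by simp
qed

definition time_measure :: "real \<Rightarrow> real measure" where
  "time_measure T = restrict_space lborel {0..T}"

text \<open>The Wiener integral of a step function is a finite combination of values of the path.\<close>
definition step_function :: "real set \<Rightarrow> (real \<Rightarrow> 'b::real_vector) \<Rightarrow> real \<Rightarrow> 'b" where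
  "step_function J a t = (\<Sum>s\<in>J. indicator {0..s} t *\<^sub>R a s)"

text \<open>The path is a parameter: with the noise \<open>w\<close> this is a Wiener integral, with
  the outputs it is a linear estimator from the observation times in J.\<close>

definition path_combination :: "real set \<Rightarrow> (real \<Rightarrow> 'b::real_inner) \<Rightarrow> (real \<Rightarrow> 'w \<Rightarrow> 'b) \<Rightarrow> 'w \<Rightarrow> real" where
  "path_combination J a w \<omega> = (\<Sum>s\<in>J. a s \<bullet> w s \<omega>)"

section \<open>Joint laws and covariances of the noise\<close>

locale wiener = prob_space M for M :: "'w measure" +
  fixes R :: "real^'r^'r" and w :: "real \<Rightarrow> 'w \<Rightarrow> real^'r"
  assumes R: "positive_definite R" and w: "brownian_motion M R w"
begin

lemma w_measurable [measurable]: "0 \<le> t \<Longrightarrow> w t \<in> borel_measurable M"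
  using w by (simp add: brownian_motion_def)

lemma w_0: "AE \<omega> in M. w 0 \<omega> = 0"
  using w by (simp add: brownian_motion_def)

lemma increment_gaussian:
  assumes "0 \<le> s" "s \<le> t"
  shows "real_gaussian M (\<lambda>\<omega>. v \<bullet> (w t \<omega> - w s \<omega>)) 0 ((t - s) * (v \<bullet> (R *v v)))"
  using w assms unfolding brownian_motion_def gaussian_def
  by (auto simp: inner_commute)

lemma value_gaussian:
  assumes "0 \<le> t"
  shows "square_integrable M (\<lambda>\<omega>. v \<bullet> w t \<omega>)" and "expectation (\<lambda>\<omega>. v \<bullet> w t \<omega>) = 0"
    and "expectation (\<lambda>\<omega>. (v \<bullet> w t \<omega>)\<^sup>2) = t * (v \<bullet> (R *v v))"
proof -
  note G = increment_gaussian[OF order_refl assms, of v]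
  have [measurable]: "w t \<in> borel_measurable M" "w 0 \<in> borel_measurable M" using assms by auto
  have ae: "AE \<omega> in M. v \<bullet> (w t \<omega> - w 0 \<omega>) = v \<bullet> w t \<omega>" using w_0 by eventually_elim simp
  have "integrable M (\<lambda>\<omega>. (v \<bullet> (w t \<omega> - w 0 \<omega>))\<^sup>2) \<longleftrightarrow> integrable M (\<lambda>\<omega>. (v \<bullet> w t \<omega>)\<^sup>2)"
    by (rule integrable_cong_AE) (use ae in auto)
  then show "square_integrable M (\<lambda>\<omega>. v \<bullet> w t \<omega>)"
    using real_gaussian_square_integrable[OF G] by (simp add: square_integrable_def)
  have "expectation (\<lambda>\<omega>. v \<bullet> (w t \<omega> - w 0 \<omega>)) = expectation (\<lambda>\<omega>. v \<bullet> w t \<omega>)"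
    by (rule integral_cong_AE) (use ae in auto)
  then show "expectation (\<lambda>\<omega>. v \<bullet> w t \<omega>) = 0" using real_gaussian_moments(2)[OF G] by simp
  have "expectation (\<lambda>\<omega>. (v \<bullet> (w t \<omega> - w 0 \<omega>))\<^sup>2) = expectation (\<lambda>\<omega>. (v \<bullet> w t \<omega>)\<^sup>2)"
    by (rule integral_cong_AE) (use ae in auto)
  then show "expectation (\<lambda>\<omega>. (v \<bullet> w t \<omega>)\<^sup>2) = t * (v \<bullet> (R *v v))"
    using real_gaussian_moments(3)[OF G] by simp
qed

lemma increment_square_integrable:
  "0 \<le> s \<Longrightarrow> s \<le> t \<Longrightarrow> square_integrable M (\<lambda>\<omega>. v \<bullet> (w t \<omega> - w s \<omega>))"
  by (rule real_gaussian_square_integrable[OF increment_gaussian])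

lemma increments_indep:
  fixes \<tau> :: "nat \<Rightarrow> real" and b :: "nat \<Rightarrow> real^'r"
  assumes "0 \<le> \<tau> 0" "mono \<tau>"
  shows "indep_vars (\<lambda>_. borel) (\<lambda>l \<omega>. b l \<bullet> (w (\<tau> (Suc l)) \<omega> - w (\<tau> l) \<omega>)) {..<k}"
proof -
  have "indep_vars (\<lambda>_. borel) (\<lambda>l \<omega>. w (\<tau> (Suc l)) \<omega> - w (\<tau> l) \<omega>) {..<k}"
    using w assms by (simp add: brownian_motion_def)
  from indep_vars_compose2[OF this, of "\<lambda>l y. b l \<bullet> y" "\<lambda>_. borel"] show ?thesis by simp
qed

lemma increments_gaussian_char:
  fixes \<tau> :: "nat \<Rightarrow> real" and b :: "nat \<Rightarrow> real^'r"
  assumes \<tau>: "0 \<le> \<tau> 0" "mono \<tau>"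
  shows "gaussian_char M (\<lambda>\<omega>. \<Sum>l<k. b l \<bullet> (w (\<tau> (Suc l)) \<omega> - w (\<tau> l) \<omega>))"
proof (induction k)
  case 0
  then show ?case using gaussian_char_const[of 0] by simp
next
  case (Suc k)
  have \<tau>0: "0 \<le> \<tau> l" for l using \<tau> monoD[OF \<tau>(2), of 0 l] by simp
  have "indep_vars (\<lambda>_. borel) (\<lambda>l \<omega>. b l \<bullet> (w (\<tau> (Suc l)) \<omega> - w (\<tau> l) \<omega>)) (insert k {..<k})"
    using increments_indep[OF \<tau>, of b "Suc k"] by (simp add: lessThan_Suc)
  then have "indep_var borel (\<lambda>\<omega>. b k \<bullet> (w (\<tau> (Suc k)) \<omega> - w (\<tau> k) \<omega>))
      borel (\<lambda>\<omega>. \<Sum>l<k. b l \<bullet> (w (\<tau> (Suc l)) \<omega> - w (\<tau> l) \<omega>))"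
    by (intro indep_vars_sum) auto
  moreover have "gaussian_char M (\<lambda>\<omega>. b k \<bullet> (w (\<tau> (Suc k)) \<omega> - w (\<tau> k) \<omega>))"
    by (rule real_gaussian_char[OF increment_gaussian]) (use \<tau>0 monoD[OF \<tau>(2), of k "Suc k"] in auto)
  ultimately show ?case using gaussian_char_add_indep[OF _ _ Suc] by (simp add: add.commute)
qed

lemma increment_uncorrelated:
  assumes st: "0 \<le> s" "s \<le> t"
  shows "expectation (\<lambda>\<omega>. (v \<bullet> w s \<omega>) * (u \<bullet> (w t \<omega> - w s \<omega>))) = 0"
proof -
  \<comment> \<open>The times 0, s, t are continued by the constant t to a monotone sequence; its
    first two increments are the ones compared.\<close>
  define \<tau> :: "nat \<Rightarrow> real" where "\<tau> i = (if i = 0 then 0 else if i = 1 then s else t)" for i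
  have mono: "0 \<le> \<tau> 0" "mono \<tau>" using st by (auto simp: \<tau>_def mono_def)
  define b where "b i = (if i = 0 then v else u)" for i :: nat
  have "indep_vars (\<lambda>_. borel) (\<lambda>l \<omega>. b l \<bullet> (w (\<tau> (Suc l)) \<omega> - w (\<tau> l) \<omega>)) (insert 1 {0})"
    using increments_indep[OF mono, of b 2] by (simp add: numeral_2_eq_2 lessThan_Suc)
  then have "indep_var borel (\<lambda>\<omega>. b 1 \<bullet> (w (\<tau> (Suc 1)) \<omega> - w (\<tau> 1) \<omega>))
      borel (\<lambda>\<omega>. \<Sum>l\<in>{0}. b l \<bullet> (w (\<tau> (Suc l)) \<omega> - w (\<tau> l) \<omega>))"
    by (intro indep_vars_sum) auto
  then have ind: "indep_var borel (\<lambda>\<omega>. u \<bullet> (w t \<omega> - w s \<omega>)) borel (\<lambda>\<omega>. v \<bullet> (w s \<omega> - w 0 \<omega>))"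
    by (simp add: b_def \<tau>_def)
  have "expectation (\<lambda>\<omega>. (u \<bullet> (w t \<omega> - w s \<omega>)) * (v \<bullet> (w s \<omega> - w 0 \<omega>))) = 0"
    by (rule integral_mult_indep_zero[OF prob_space_axioms ind])
       (use st increment_square_integrable real_gaussian_moments(2)[OF increment_gaussian[of 0 s v]] in auto)
  moreover have "expectation (\<lambda>\<omega>. (u \<bullet> (w t \<omega> - w s \<omega>)) * (v \<bullet> (w s \<omega> - w 0 \<omega>)))
      = expectation (\<lambda>\<omega>. (v \<bullet> w s \<omega>) * (u \<bullet> (w t \<omega> - w s \<omega>)))"
  proof (rule integral_cong_AE)
    have [measurable]: "w t \<in> borel_measurable M" "w s \<in> borel_measurable M" "w 0 \<in> borel_measurable M"
      using st by auto
    show "(\<lambda>\<omega>. (u \<bullet> (w t \<omega> - w s \<omega>)) * (v \<bullet> (w s \<omega> - w 0 \<omega>))) \<in> borel_measurable M"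
      "(\<lambda>\<omega>. (v \<bullet> w s \<omega>) * (u \<bullet> (w t \<omega> - w s \<omega>))) \<in> borel_measurable M" by measurable
    show "AE \<omega> in M. (u \<bullet> (w t \<omega> - w s \<omega>)) * (v \<bullet> (w s \<omega> - w 0 \<omega>)) = (v \<bullet> w s \<omega>) * (u \<bullet> (w t \<omega> - w s \<omega>))"
      using w_0 by eventually_elim simp
  qed
  ultimately show ?thesis by simp
qed

text \<open>Polarisation of the variance formula; symmetry of R merges the two mixed terms.\<close>

lemma covariance_same_time:
  assumes t: "0 \<le> t"
  shows "expectation (\<lambda>\<omega>. (v \<bullet> w t \<omega>) * (u \<bullet> w t \<omega>)) = t * (v \<bullet> (R *v u))"
proof -
  have "expectation (\<lambda>\<omega>. ((v + u) \<bullet> w t \<omega>)\<^sup>2) =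
      expectation (\<lambda>\<omega>. (v \<bullet> w t \<omega>)\<^sup>2 + (u \<bullet> w t \<omega>)\<^sup>2 + 2 * ((v \<bullet> w t \<omega>) * (u \<bullet> w t \<omega>)))"
    by (simp add: inner_add_left power2_sum mult.assoc)
  also have "\<dots> = t * (v \<bullet> (R *v v)) + t * (u \<bullet> (R *v u)) + 2 * expectation (\<lambda>\<omega>. (v \<bullet> w t \<omega>) * (u \<bullet> w t \<omega>))"
    using value_gaussian[OF t] square_integrable_mult[OF value_gaussian(1)[OF t] value_gaussian(1)[OF t]]
    by (simp add: square_integrable_def)
  finally show ?thesis
    using value_gaussian(3)[OF t, of "v + u"] positive_definite_symmetric[OF R, of v u]
    by (simp add: matrix_vector_right_distrib inner_add_left inner_add_right inner_commute algebra_simps)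
qed

lemma covariance:
  assumes st: "0 \<le> s" "0 \<le> t"
  shows "expectation (\<lambda>\<omega>. (v \<bullet> w s \<omega>) * (u \<bullet> w t \<omega>)) = min s t * (v \<bullet> (R *v u))"
proof -
  have le: "expectation (\<lambda>\<omega>. (v \<bullet> w s \<omega>) * (u \<bullet> w t \<omega>)) = s * (v \<bullet> (R *v u))" if "0 \<le> s" "s \<le> t" for s t v u
  proof -
    have "expectation (\<lambda>\<omega>. (v \<bullet> w s \<omega>) * (u \<bullet> w t \<omega>))
        = expectation (\<lambda>\<omega>. (v \<bullet> w s \<omega>) * (u \<bullet> w s \<omega>) + (v \<bullet> w s \<omega>) * (u \<bullet> (w t \<omega> - w s \<omega>)))"
      by (simp add: inner_diff_right algebra_simps)
    also have "\<dots> = s * (v \<bullet> (R *v u)) + 0"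
      using square_integrable_mult[OF value_gaussian(1)[OF that(1)] value_gaussian(1)[OF that(1)]]
        square_integrable_mult[OF value_gaussian(1)[OF that(1)] increment_square_integrable[OF that]]
        covariance_same_time[OF that(1)] increment_uncorrelated[OF that] by simp
    finally show ?thesis by simp
  qed
  show ?thesis
  proof (cases "s \<le> t")
    case True
    then show ?thesis using le[OF st(1)] by simp
  next
    case False
    then show ?thesis using le[OF st(2), of s u v] positive_definite_symmetric[OF R, of v u]
      by (simp add: mult.commute inner_commute)
  qed
qed

text \<open>Values at different times are dependent, so the combination is rewritten in terms of
  independent increments between the sorted times. Time 0 is added to them because the path starts
  at 0 almost surely, and the telescoping begins there.\<close>

lemma path_combination_gaussian_char:
  assumes J: "finite J" "J \<subseteq> {0..}"
  shows "gaussian_char M (path_combination J a w)"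
proof -
  define L where "L = sorted_list_of_set (insert 0 J)"
  have "finite (insert 0 J)" using J by simp
  then have setL: "set L = insert 0 J" and sL: "sorted L"
    unfolding L_def by (rule set_sorted_list_of_set, intro sorted_sorted_list_of_set)
  then have L0: "L \<noteq> []" by auto
  define k where "k = length L - 1"
  have len: "length L = Suc k" using L0 by (simp add: k_def)
  \<comment> \<open>Indices beyond the last time k are frozen, which makes the sequence monotone on
    all natural numbers.\<close>
  define \<tau> where "\<tau> i = L ! (min i k)" for i
  have mono: "mono \<tau>" unfolding mono_def \<tau>_def
    using sL(1) len by (auto intro!: sorted_nth_mono simp: min_def)
  have \<tau>0: "0 \<le> \<tau> l" for l
  proof -
    have "\<tau> l \<in> set L" unfolding \<tau>_def using L0 by (intro nth_mem) (auto simp: len min_def)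
    then show ?thesis using setL J by auto
  qed
  have "\<tau> 0 = 0"
  proof -
    have "0 \<in> set L" using setL by simp
    then obtain i where i: "i < length L" "L ! i = 0" by (auto simp: in_set_conv_nth)
    have "\<tau> 0 \<le> \<tau> i" by (rule monoD[OF mono]) simp
    moreover have "\<tau> i = 0" using i by (simp add: \<tau>_def len min_def)
    ultimately show ?thesis using \<tau>0[of 0] by simp
  qed
  have "\<exists>j\<le>k. \<tau> j = s" if "s \<in> J" for s
  proof -
    have "s \<in> set L" using setL that by simp
    then obtain j where "j < length L" "L ! j = s" by (auto simp: in_set_conv_nth)
    then show ?thesis by (intro exI[of _ j]) (auto simp: \<tau>_def len min_def)
  qed
  then have "\<forall>s\<in>J. \<exists>j. j \<le> k \<and> \<tau> j = s" by blast
  from bchoice[OF this] obtain j where "\<forall>s\<in>J. j s \<le> k \<and> \<tau> (j s) = s" ..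
  then have j: "j s \<le> k \<and> \<tau> (j s) = s" if "s \<in> J" for s using that by blast
  \<comment> \<open>Summation by parts: an increment collects the coefficients of all observation
    times that lie after it.\<close>
  define b where "b l = (\<Sum>s\<in>J. (if l < j s then a s else 0))" for l
  have "path_combination J a w \<omega> = (\<Sum>l<k. b l \<bullet> (w (\<tau> (Suc l)) \<omega> - w (\<tau> l) \<omega>))" if w0: "w 0 \<omega> = 0" for \<omega>
  proof -
    have tel: "w s \<omega> = (\<Sum>l<k. if l < j s then w (\<tau> (Suc l)) \<omega> - w (\<tau> l) \<omega> else 0)" if s: "s \<in> J" for s
    proof -
      have "(\<Sum>l<k. if l < j s then w (\<tau> (Suc l)) \<omega> - w (\<tau> l) \<omega> else 0) = (\<Sum>l\<in>{..<k} \<inter> {l. l < j s}. w (\<tau> (Suc l)) \<omega> - w (\<tau> l) \<omega>)"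
        by (simp add: sum.inter_restrict)
      also have "{..<k} \<inter> {l. l < j s} = {..<j s}" using j[OF s] by auto
      also have "(\<Sum>l<j s. w (\<tau> (Suc l)) \<omega> - w (\<tau> l) \<omega>) = w (\<tau> (j s)) \<omega> - w (\<tau> 0) \<omega>"
        by (rule sum_lessThan_telescope)
      finally show ?thesis using j[OF s] w0 \<open>\<tau> 0 = 0\<close> by simp
    qed
    have "path_combination J a w \<omega> = (\<Sum>s\<in>J. \<Sum>l<k. (if l < j s then a s \<bullet> (w (\<tau> (Suc l)) \<omega> - w (\<tau> l) \<omega>) else 0))"
      unfolding path_combination_def
      by (rule sum.cong[OF refl], subst tel) (auto simp: inner_sum_right intro!: sum.cong)
    also have "\<dots> = (\<Sum>l<k. \<Sum>s\<in>J. (if l < j s then a s \<bullet> (w (\<tau> (Suc l)) \<omega> - w (\<tau> l) \<omega>) else 0))"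
      by (rule sum.swap)
    also have "\<dots> = (\<Sum>l<k. b l \<bullet> (w (\<tau> (Suc l)) \<omega> - w (\<tau> l) \<omega>))"
      unfolding b_def inner_sum_left by (intro sum.cong refl) auto
    finally show ?thesis .
  qed
  then have ae: "AE \<omega> in M. (\<Sum>l<k. b l \<bullet> (w (\<tau> (Suc l)) \<omega> - w (\<tau> l) \<omega>)) = path_combination J a w \<omega>"
    using w_0 by (auto elim!: eventually_mono)
  have g: "gaussian_char M (\<lambda>\<omega>. \<Sum>l<k. b l \<bullet> (w (\<tau> (Suc l)) \<omega> - w (\<tau> l) \<omega>))"
    by (rule increments_gaussian_char) (use mono \<tau>0 in auto)
  have m: "path_combination J a w \<in> borel_measurable M"
    unfolding path_combination_def[abs_def] using J by (intro borel_measurable_sum borel_measurable_inner) auto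
  show ?thesis by (rule gaussian_char_cong[OF ae g m])
qed

lemma path_combination_square_integrable:
  "finite J \<Longrightarrow> J \<subseteq> {0..} \<Longrightarrow> square_integrable M (path_combination J a w)"
  using path_combination_gaussian_char by (simp add: gaussian_char_def)

lemma path_combination_expectation:
  assumes "J \<subseteq> {0..}"
  shows "expectation (path_combination J a w) = 0"
  unfolding path_combination_def[abs_def]
  using assms value_gaussian square_integrable_integrable[OF value_gaussian(1)]
  by (subst Bochner_Integration.integral_sum) (auto intro!: sum.neutral)

lemma path_combination_covariance_min:
  assumes "J \<subseteq> {0..}" "K \<subseteq> {0..}"
  shows "expectation (\<lambda>\<omega>. path_combination J a w \<omega> * path_combination K b w \<omega>)
    = (\<Sum>s\<in>J. \<Sum>t\<in>K. min s t * (a s \<bullet> (R *v b t)))"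
proof -
  have i: "integrable M (\<lambda>\<omega>. (a s \<bullet> w s \<omega>) * (b t \<bullet> w t \<omega>))" if "s \<in> J" "t \<in> K" for s t
    using that assms by (intro square_integrable_mult value_gaussian(1)) auto
  have "expectation (\<lambda>\<omega>. path_combination J a w \<omega> * path_combination K b w \<omega>)
      = expectation (\<lambda>\<omega>. \<Sum>s\<in>J. \<Sum>t\<in>K. (a s \<bullet> w s \<omega>) * (b t \<bullet> w t \<omega>))"
    by (simp add: path_combination_def sum_product)
  also have "\<dots> = (\<Sum>s\<in>J. \<Sum>t\<in>K. expectation (\<lambda>\<omega>. (a s \<bullet> w s \<omega>) * (b t \<bullet> w t \<omega>)))"
  proof -
    have "expectation (\<lambda>\<omega>. \<Sum>t\<in>K. (a s \<bullet> w s \<omega>) * (b t \<bullet> w t \<omega>))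
        = (\<Sum>t\<in>K. expectation (\<lambda>\<omega>. (a s \<bullet> w s \<omega>) * (b t \<bullet> w t \<omega>)))" if "s \<in> J" for s
      by (rule Bochner_Integration.integral_sum) (rule i[OF that])
    moreover have "expectation (\<lambda>\<omega>. \<Sum>s\<in>J. \<Sum>t\<in>K. (a s \<bullet> w s \<omega>) * (b t \<bullet> w t \<omega>))
        = (\<Sum>s\<in>J. expectation (\<lambda>\<omega>. \<Sum>t\<in>K. (a s \<bullet> w s \<omega>) * (b t \<bullet> w t \<omega>)))"
      by (rule Bochner_Integration.integral_sum) (rule Bochner_Integration.integrable_sum, rule i)
    ultimately show ?thesis by simp
  qed
  also have "\<dots> = (\<Sum>s\<in>J. \<Sum>t\<in>K. min s t * (a s \<bullet> (R *v b t)))"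
  proof (intro sum.cong refl)
    fix s t assume "s \<in> J" "t \<in> K"
    then have "0 \<le> s" "0 \<le> t" using assms by auto
    then show "expectation (\<lambda>\<omega>. (a s \<bullet> w s \<omega>) * (b t \<bullet> w t \<omega>)) = min s t * (a s \<bullet> (R *v b t))"
      by (rule covariance)
  qed
  finally show ?thesis .
qed

end

section \<open>Lebesgue measure on [0, T] and the isometry for step functions\<close>

lemma space_time_measure [simp]: "space (time_measure T) = {0..T}"
  by (simp add: time_measure_def space_restrict_space)

lemma finite_measure_time_measure: "finite_measure (time_measure T)"
  by (rule finite_measureI) (simp add: time_measure_def emeasure_restrict_space emeasure_lborel_Icc_eq)

lemma measurable_time_measure: "f \<in> borel_measurable borel \<Longrightarrow> f \<in> borel_measurable (time_measure T)"
  unfolding time_measure_def by (rule measurable_restrict_space1) simp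

lemma integrable_bounded_time_measure:
  fixes f :: "real \<Rightarrow> 'b::{banach, second_countable_topology}"
  assumes "f \<in> borel_measurable (time_measure T)" "\<And>t. 0 \<le> t \<Longrightarrow> t \<le> T \<Longrightarrow> norm (f t) \<le> B"
  shows "integrable (time_measure T) f"
proof -
  interpret finite_measure "time_measure T" by (rule finite_measure_time_measure)
  show ?thesis by (rule integrable_const_bound[where B=B]) (use assms in \<open>auto intro!: AE_I2\<close>)
qed

lemma integral_time_measure_Icc:
  assumes "0 \<le> s" "s \<le> T"
  shows "(\<integral>t. indicator {0..s} t *\<^sub>R f t \<partial>time_measure T) = (\<integral>t. indicator {0..s} t *\<^sub>R (f t :: 'b::{banach, second_countable_topology}) \<partial>lborel)"
proof -
  have "(\<integral>t. indicator {0..s} t *\<^sub>R f t \<partial>time_measure T) = (\<integral>t. indicator {0..T} t *\<^sub>R (indicator {0..s} t *\<^sub>R f t) \<partial>lborel)"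
    unfolding time_measure_def by (rule integral_restrict_space) simp
  also have "\<dots> = (\<integral>t. indicator {0..s} t *\<^sub>R f t \<partial>lborel)"
    by (rule Bochner_Integration.integral_cong[OF refl]) (use assms in \<open>simp split: split_indicator\<close>)
  finally show ?thesis .
qed

lemma measurable_step_function [measurable]:
  "step_function J a \<in> borel_measurable (borel :: real measure)" for a :: "real \<Rightarrow> 'b::{real_normed_vector, second_countable_topology}"
  unfolding step_function_def[abs_def]
  by (intro borel_measurable_sum borel_measurable_scaleR borel_measurable_indicator) auto

lemma norm_step_function:
  "norm (step_function J a t) \<le> (\<Sum>s\<in>J. norm (a s))"
  unfolding step_function_def
  by (rule order_trans[OF norm_sum sum_mono]) (simp split: split_indicator)

lemma integral_indicator_mult_indicator:
  assumes "0 \<le> s" "s \<le> T" "0 \<le> t" "t \<le> T"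
  shows "(\<integral>u. indicator {0..s} u * (indicator {0..t} u :: real) \<partial>time_measure T) = min s t"
proof -
  have "(\<integral>u. indicator {0..s} u * (indicator {0..t} u :: real) \<partial>time_measure T)
      = (\<integral>u. indicator {0..s} u *\<^sub>R (indicator {0..t} u :: real) \<partial>lborel)"
    by (subst integral_time_measure_Icc[OF assms(1,2), symmetric]) simp
  also have "\<dots> = (\<integral>u. indicator {0..min s t} u \<partial>lborel)"
    by (rule Bochner_Integration.integral_cong[OF refl]) (simp split: split_indicator)
  finally show ?thesis using assms by simp
qed

lemma matrix_vector_mult_sum_scaleR:
  fixes A :: "real^'n^'m"
  shows "A *v (\<Sum>i\<in>I. c i *\<^sub>R v i) = (\<Sum>i\<in>I. c i *\<^sub>R (A *v v i))"
  by (induction I rule: infinite_finite_induct)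
     (simp_all add: matrix_vector_right_distrib matrix_vector_mult_scaleR)

text \<open>The Wiener isometry. Both sides are bilinear in the coefficients, and
  \<open>min s t\<close> is the length of the overlap of [0, s] and [0, t].\<close>

lemma (in wiener) path_combination_covariance:
  fixes a b :: "real \<Rightarrow> real^'r"
  assumes J: "finite J" "J \<subseteq> {0..T}" and K: "finite K" "K \<subseteq> {0..T}"
  shows "expectation (\<lambda>\<omega>. path_combination J a w \<omega> * path_combination K b w \<omega>)
    = (\<integral>t. step_function J a t \<bullet> (R *v step_function K b t) \<partial>time_measure T)"
proof -
  have "(\<integral>t. step_function J a t \<bullet> (R *v step_function K b t) \<partial>time_measure T)
      = (\<integral>u. (\<Sum>s\<in>J. \<Sum>t\<in>K. (indicator {0..s} u * indicator {0..t} u) * (a s \<bullet> (R *v b t))) \<partial>time_measure T)"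
    unfolding step_function_def matrix_vector_mult_sum_scaleR inner_sum_left
    unfolding inner_sum_right by (simp add: mult_ac)
  also have "\<dots> = (\<Sum>s\<in>J. \<Sum>t\<in>K. (\<integral>u. (indicator {0..s} u * indicator {0..t} u) * (a s \<bullet> (R *v b t)) \<partial>time_measure T))"
  proof -
    have i: "integrable (time_measure T) (\<lambda>u. (indicator {0..s} u * indicator {0..t} u) * (a s \<bullet> (R *v b t)))" for s t
      by (rule integrable_bounded_time_measure[where B="\<bar>a s \<bullet> (R *v b t)\<bar>"]) (auto intro!: measurable_time_measure split: split_indicator)
    have "(\<integral>u. (\<Sum>t\<in>K. (indicator {0..s} u * indicator {0..t} u) * (a s \<bullet> (R *v b t))) \<partial>time_measure T)
        = (\<Sum>t\<in>K. (\<integral>u. (indicator {0..s} u * indicator {0..t} u) * (a s \<bullet> (R *v b t)) \<partial>time_measure T))" for s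
      by (rule Bochner_Integration.integral_sum) (rule i)
    moreover have "(\<integral>u. (\<Sum>s\<in>J. \<Sum>t\<in>K. (indicator {0..s} u * indicator {0..t} u) * (a s \<bullet> (R *v b t))) \<partial>time_measure T)
        = (\<Sum>s\<in>J. (\<integral>u. (\<Sum>t\<in>K. (indicator {0..s} u * indicator {0..t} u) * (a s \<bullet> (R *v b t))) \<partial>time_measure T))"
      by (rule Bochner_Integration.integral_sum) (rule Bochner_Integration.integrable_sum, rule i)
    ultimately show ?thesis by simp
  qed
  also have "\<dots> = (\<Sum>s\<in>J. \<Sum>t\<in>K. min s t * (a s \<bullet> (R *v b t)))"
    using J K by (intro sum.cong refl) (auto simp: integral_indicator_mult_indicator subset_eq)
  also have "\<dots> = expectation (\<lambda>\<omega>. path_combination J a w \<omega> * path_combination K b w \<omega>)"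
    using J K by (intro path_combination_covariance_min[symmetric]) auto
  finally show ?thesis by simp
qed

section \<open>The observation operator along orbits\<close>

lemma graph_norm_eq_norm_Pair: "graph_norm A v = norm (v, A v)"
  by (simp add: graph_norm_def norm_Pair)

text \<open>Where \<open>normV\<close> vanishes, the quotient is 0 by the convention for division
  and the bound with K forces C v = 0; elsewhere the quotient is at most |K|. So the supremum is
  finite and the inequality holds also for vectors of norm zero.\<close>

lemma operator_norm_on_bound:
  assumes C: "bounded_operator_on V normV C" and nn: "\<And>v. 0 \<le> normV v" and v: "v \<in> V"
  shows "norm (C v) \<le> operator_norm_on V normV C * normV v"
proof -
  obtain K where K: "\<And>\<xi>. \<xi> \<in> V \<Longrightarrow> norm (C \<xi>) \<le> K * normV \<xi>"
    using C unfolding bounded_operator_on_def by blast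
  have "bdd_above ((\<lambda>\<xi>. norm (C \<xi>) / normV \<xi>) ` V)"
  proof (rule bdd_aboveI2[where M="\<bar>K\<bar>"])
    fix \<xi> assume xi: "\<xi> \<in> V"
    show "norm (C \<xi>) / normV \<xi> \<le> \<bar>K\<bar>"
    proof (cases "normV \<xi> = 0")
      case False
      then have "normV \<xi> > 0" using nn[of \<xi>] by simp
      moreover have "norm (C \<xi>) \<le> \<bar>K\<bar> * normV \<xi>"
        using K[OF xi] mult_right_mono[OF abs_ge_self nn, of K \<xi>] by linarith
      ultimately show ?thesis by (simp add: pos_divide_le_eq)
    qed simp
  qed
  then have le: "norm (C v) / normV v \<le> operator_norm_on V normV C"
    unfolding operator_norm_on_def by (rule cSUP_upper[OF v])
  show ?thesis
  proof (cases "normV v = 0")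
    case True
    then show ?thesis using K[OF v] by simp
  next
    case False
    then have "normV v > 0" using nn[of v] by simp
    then show ?thesis using le by (simp add: pos_divide_le_eq)
  qed
qed

text \<open>The two hypotheses on C are treated together through V and \<open>normV\<close>; case
  distinctions are confined to the transfer of estimates to \<open>normV\<close>.\<close>

locale observed_semigroup = bounded_analytic_semigroup S T \<mu>
  for S :: "real \<Rightarrow> ('x::{real_inner, banach, second_countable_topology} \<Rightarrow>\<^sub>L 'x)" and T \<mu> :: real +
  fixes C :: "'x \<Rightarrow> real^'r" and V :: "'x set" and normV :: "'x \<Rightarrow> real" and c1 :: real
  assumes c1: "\<And>t \<xi>. 0 < t \<Longrightarrow> norm (generator S (S t \<xi>)) \<le> c1 / t * norm \<xi>"
    and V: "(V = UNIV \<and> normV = norm) \<or> (V = generator_domain S \<and> normV = graph_norm (generator S))"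
    and C: "bounded_operator_on V normV C"
begin

abbreviation C_norm :: real where "C_norm \<equiv> operator_norm_on V normV C"

lemma normV_nonneg: "0 \<le> normV v"
  using V by (auto simp: graph_norm_def)

lemma V_scaleR: "v \<in> V \<Longrightarrow> a *\<^sub>R v \<in> V"
  using V generator_scaleR(1) by auto

lemma V_diff: "u \<in> V \<Longrightarrow> v \<in> V \<Longrightarrow> u - v \<in> V"
  using V generator_diff(1) by auto

lemma orbit_integral_in_V: "0 \<le> t \<Longrightarrow> orbit_integral t \<xi> \<in> V"
  using V generator_orbit_integral(1) by auto

lemma S_in_V: "\<xi> \<in> V \<Longrightarrow> 0 \<le> t \<Longrightarrow> S t \<xi> \<in> V"
  using V generator_S(1) by auto

lemma zero_in_V: "0 \<in> V"
  using orbit_integral_in_V[of 0] by simp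

lemma C_add: "u \<in> V \<Longrightarrow> v \<in> V \<Longrightarrow> C (u + v) = C u + C v"
  using C by (simp add: bounded_operator_on_def)

lemma C_scaleR: "v \<in> V \<Longrightarrow> C (a *\<^sub>R v) = a *\<^sub>R C v"
  using C by (simp add: bounded_operator_on_def)

lemma C_diff: "u \<in> V \<Longrightarrow> v \<in> V \<Longrightarrow> C (u - v) = C u - C v"
  using C_add[of u "(-1) *\<^sub>R v"] C_scaleR[of v "-1"] V_scaleR[of v "-1"] by simp

lemma C_bound: "v \<in> V \<Longrightarrow> norm (C v) \<le> C_norm * normV v"
  by (rule operator_norm_on_bound[OF C normV_nonneg])

lemma C_0 [simp]: "C 0 = 0"
  using C_scaleR[OF zero_in_V, of 0] by simp

lemma C_norm_nonneg: "0 \<le> C_norm"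
proof (cases "\<exists>v\<in>V. 0 < normV v")
  case True
  then obtain v where v: "v \<in> V" "0 < normV v" by blast
  have "0 \<le> C_norm * normV v" using order_trans[OF norm_ge_zero C_bound[OF v(1)]] .
  then show ?thesis using v(2) by (simp add: zero_le_mult_iff)
next
  case False
  then have "normV v = 0" if "v \<in> V" for v using that normV_nonneg[of v] by force
  then have "operator_norm_on V normV C = (SUP \<xi>\<in>V. 0)" unfolding operator_norm_on_def
    by (intro SUP_cong) auto
  also have "\<dots> = 0" using zero_in_V by (intro cSUP_const) auto
  finally show ?thesis by simp
qed

text \<open>Sequential continuity of C for the norm of V. In the graph norm, convergence to 0 means
  convergence of f together with its image under the generator, hence the conditional third
  assumption.\<close>

lemma C_tendsto_zero:
  assumes f: "\<forall>\<^sub>F s in F. f s \<in> V" and lim: "(f \<longlongrightarrow> 0) F"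
    and A: "V = generator_domain S \<Longrightarrow> ((\<lambda>s. generator S (f s)) \<longlongrightarrow> 0) F"
  shows "((\<lambda>s. C (f s)) \<longlongrightarrow> 0) F"
proof (rule Lim_null_comparison)
  show "\<forall>\<^sub>F s in F. norm (C (f s)) \<le> C_norm * normV (f s)"
    using f by eventually_elim (rule C_bound)
  from V have "((\<lambda>s. normV (f s)) \<longlongrightarrow> 0) F"
  proof
    assume "V = UNIV \<and> normV = norm"
    then show ?thesis using tendsto_norm_zero[OF lim] by simp
  next
    assume *: "V = generator_domain S \<and> normV = graph_norm (generator S)"
    have "((\<lambda>s. (f s, generator S (f s))) \<longlongrightarrow> (0, 0)) F"
      by (intro tendsto_Pair lim A) (simp add: *)
    then have "((\<lambda>s. norm (f s, generator S (f s))) \<longlongrightarrow> norm (0 :: 'x, 0 :: 'x)) F"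
      by (rule tendsto_norm)
    then show ?thesis using * by (simp add: graph_norm_eq_norm_Pair[abs_def])
  qed
  from tendsto_mult_left[OF this, of C_norm] show "((\<lambda>s. C_norm * normV (f s)) \<longlongrightarrow> 0) F" by simp
qed

text \<open>The graph norm is the Euclidean combination of the norms of a vector and of its image,
  so an estimate holding for both with the same constant k passes to it.\<close>

lemma normV_image_le:
  assumes "\<xi> \<in> V" and k: "0 \<le> k" and v: "norm v \<le> k * norm \<xi>"
    and Av: "V = generator_domain S \<Longrightarrow> norm (generator S v) \<le> k * norm (generator S \<xi>)"
  shows "normV v \<le> k * normV \<xi>"
  using V
proof
  assume "V = UNIV \<and> normV = norm"
  then show ?thesis using v by simp
next
  assume *: "V = generator_domain S \<and> normV = graph_norm (generator S)"
  have "(norm v)\<^sup>2 + (norm (generator S v))\<^sup>2 \<le> (k * norm \<xi>)\<^sup>2 + (k * norm (generator S \<xi>))\<^sup>2"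
    by (intro add_mono power_mono v Av) (simp_all add: *)
  also have "\<dots> = k\<^sup>2 * ((norm \<xi>)\<^sup>2 + (norm (generator S \<xi>))\<^sup>2)"
    by (simp add: power_mult_distrib distrib_left)
  finally have "sqrt ((norm v)\<^sup>2 + (norm (generator S v))\<^sup>2) \<le> sqrt (k\<^sup>2 * ((norm \<xi>)\<^sup>2 + (norm (generator S \<xi>))\<^sup>2))"
    by (rule real_sqrt_le_mono)
  then show ?thesis using * k by (simp add: graph_norm_def real_sqrt_mult)
qed

text \<open>Mean value inequality on [s, \<infinity>), where the derivative A S u \<xi> is
  controlled by c1 / u and hence by |c1| / s. The absolute value makes the bound monotone in u
  whatever the sign of \<open>c1\<close>.\<close>

lemma S_Lipschitz:
  assumes s: "0 < s" "s \<le> t"  "s \<le> r"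
  shows "norm (S t \<xi> - S r \<xi>) \<le> (\<bar>c1\<bar> / s * \<bar>t - r\<bar>) * norm \<xi>"
proof -
  have "norm (S t \<xi> - S r \<xi>) \<le> (\<bar>c1\<bar> / s * norm \<xi>) * norm (t - r)"
  proof (rule differentiable_bound[of "{s..}" "\<lambda>t. S t \<xi>" "\<lambda>t h. h *\<^sub>R generator S (S t \<xi>)"])
    fix u assume "u \<in> {s..}"
    then have u: "0 < u" "s \<le> u" using s by auto
    show "((\<lambda>t. S t \<xi>) has_derivative (\<lambda>h. h *\<^sub>R generator S (S u \<xi>))) (at u within {s..})"
      using has_vector_derivative_at_within[OF S_in_domain(2)[OF u(1)]] by (simp add: has_vector_derivative_def)
    have "norm (generator S (S u \<xi>)) \<le> c1 / u * norm \<xi>" by (rule c1[OF u(1)])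
    also have "\<dots> \<le> \<bar>c1\<bar> / s * norm \<xi>"
      using u s by (intro mult_right_mono frac_le) auto
    finally have le: "norm (generator S (S u \<xi>)) \<le> \<bar>c1\<bar> / s * norm \<xi>" .
    show "onorm (\<lambda>h. h *\<^sub>R generator S (S u \<xi>)) \<le> \<bar>c1\<bar> / s * norm \<xi>"
      by (rule onorm_le) (use mult_left_mono[OF le abs_ge_zero] in \<open>simp add: mult.commute\<close>)
  qed (use s in auto)
  then show ?thesis by (simp add: mult_ac)
qed

text \<open>In both cases the generator commutes with the semigroup, so the estimates in \<open>\<parallel>\<cdot>\<parallel>\<close> pass to the
  graph norm.\<close>
lemma C_S_Lipschitz:
  assumes \<xi>: "\<xi> \<in> V" and s: "0 < s" "s \<le> t"  "s \<le> r"
  shows "norm (C (S t \<xi>) - C (S r \<xi>)) \<le> C_norm * (\<bar>c1\<bar> / s * \<bar>t - r\<bar>) * normV \<xi>"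
proof -
  have tr: "0 \<le> t" "0 \<le> r" using s by auto
  have "normV (S t \<xi> - S r \<xi>) \<le> (\<bar>c1\<bar> / s * \<bar>t - r\<bar>) * normV \<xi>"
  proof (rule normV_image_le[OF \<xi>])
    show "norm (S t \<xi> - S r \<xi>) \<le> \<bar>c1\<bar> / s * \<bar>t - r\<bar> * norm \<xi>" by (rule S_Lipschitz[OF s])
    assume "V = generator_domain S"
    then have d: "\<xi> \<in> generator_domain S" using \<xi> by simp
    have "generator S (S t \<xi> - S r \<xi>) = S t (generator S \<xi>) - S r (generator S \<xi>)"
      using generator_diff(2)[OF generator_S(1)[OF d tr(1)] generator_S(1)[OF d tr(2)]]
        generator_S(2)[OF d tr(1)] generator_S(2)[OF d tr(2)] by simp
    then show "norm (generator S (S t \<xi> - S r \<xi>)) \<le> \<bar>c1\<bar> / s * \<bar>t - r\<bar> * norm (generator S \<xi>)"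
      using S_Lipschitz[OF s, of "generator S \<xi>"] by simp
  qed (use s in simp)
  then have "C_norm * normV (S t \<xi> - S r \<xi>) \<le> C_norm * ((\<bar>c1\<bar> / s * \<bar>t - r\<bar>) * normV \<xi>)"
    by (rule mult_left_mono[OF _ C_norm_nonneg])
  moreover have "norm (C (S t \<xi> - S r \<xi>)) \<le> C_norm * normV (S t \<xi> - S r \<xi>)"
    by (intro C_bound V_diff S_in_V \<xi> tr)
  ultimately show ?thesis using C_diff[OF S_in_V[OF \<xi> tr(1)] S_in_V[OF \<xi> tr(2)]] by (simp add: mult_ac)
qed

lemma norm_C_S:
  assumes \<xi>: "\<xi> \<in> V" and t: "0 \<le> t" "t \<le> T"
  shows "norm (C (S t \<xi>)) \<le> C_norm * \<mu> * normV \<xi>"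
proof -
  have "normV (S t \<xi>) \<le> \<mu> * normV \<xi>"
    by (rule normV_image_le[OF \<xi> \<mu>_nonneg norm_S[OF t]])
       (use \<xi> t generator_S(2)[OF _ t(1), of \<xi>] norm_S[OF t, of "generator S \<xi>"] in simp)
  then have "C_norm * normV (S t \<xi>) \<le> C_norm * (\<mu> * normV \<xi>)"
    by (rule mult_left_mono[OF _ C_norm_nonneg])
  then show ?thesis using C_bound[OF S_in_V[OF \<xi> t(1)]] by (simp add: mult.assoc)
qed

text \<open>On the domain the generator commutes with S s, so the image of the orbit of \<xi> is the
  orbit of A \<xi>. Both are continuous, and the orbit is therefore continuous in the graph
  norm.\<close>

lemma C_S_continuous:
  assumes \<xi>: "\<xi> \<in> V"
  shows "continuous_on {0..} (\<lambda>t. C (S t \<xi>))"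
  unfolding continuous_on_def
proof
  fix t :: real assume t: "t \<in> {0..}"
  have ev: "\<forall>\<^sub>F s in at t within {0..}. 0 \<le> s" by (auto simp: eventually_at_filter)
  have "((\<lambda>s. C (S s \<xi> - S t \<xi>)) \<longlongrightarrow> 0) (at t within {0..})"
  proof (rule C_tendsto_zero)
    show "\<forall>\<^sub>F s in at t within {0..}. S s \<xi> - S t \<xi> \<in> V"
      using ev by eventually_elim (use t in \<open>auto intro: V_diff S_in_V \<xi>\<close>)
    have Sc: "((\<lambda>s. S s \<eta>) \<longlongrightarrow> S t \<eta>) (at t within {0..})" for \<eta>
      using S_continuous[of \<eta>] t by (auto simp: continuous_on_def)
    then show "((\<lambda>s. S s \<xi> - S t \<xi>) \<longlongrightarrow> 0) (at t within {0..})" by (rule LIM_zero)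
    assume "V = generator_domain S"
    then have d: "\<xi> \<in> generator_domain S" using \<xi> by simp
    show "((\<lambda>s. generator S (S s \<xi> - S t \<xi>)) \<longlongrightarrow> 0) (at t within {0..})"
    proof (rule Lim_transform_eventually)
      show "((\<lambda>s. S s (generator S \<xi>) - S t (generator S \<xi>)) \<longlongrightarrow> 0) (at t within {0..})"
        by (rule LIM_zero[OF Sc])
      show "\<forall>\<^sub>F s in at t within {0..}. S s (generator S \<xi>) - S t (generator S \<xi>) = generator S (S s \<xi> - S t \<xi>)"
        using ev
      proof eventually_elim
        case (elim s)
        have "0 \<le> t" using t by simp
        then show ?case using generator_diff(2)[OF generator_S(1)[OF d elim] generator_S(1)[OF d \<open>0 \<le> t\<close>]]
            generator_S(2)[OF d elim] generator_S(2)[OF d \<open>0 \<le> t\<close>] by simp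
      qed
    qed
  qed
  moreover have "\<forall>\<^sub>F s in at t within {0..}. C (S s \<xi> - S t \<xi>) = C (S s \<xi>) - C (S t \<xi>)"
    using ev by eventually_elim (use t in \<open>auto intro!: C_diff S_in_V \<xi>\<close>)
  ultimately have "((\<lambda>s. C (S s \<xi>) - C (S t \<xi>)) \<longlongrightarrow> 0) (at t within {0..})"
    by (rule Lim_transform_eventually)
  then show "((\<lambda>s. C (S s \<xi>)) \<longlongrightarrow> C (S t \<xi>)) (at t within {0..})" by (rule LIM_zero_cancel)
qed

text \<open>Since A maps the orbit integral to S s \<xi> - \<xi>, the image under A of its
  difference quotient is the difference quotient of the orbit. The quotients thus converge in the
  graph norm, where C is continuous.\<close>

lemma C_orbit_integral_derivative:
  assumes \<xi>: "\<xi> \<in> V" and t: "0 \<le> t" "t \<le> b"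
  shows "((\<lambda>s. C (orbit_integral s \<xi>)) has_vector_derivative C (S t \<xi>)) (at t within {0..b})"
  unfolding has_vector_derivative_iff_quotient
proof -
  let ?F = "at t within {0..b}"
  let ?q = "\<lambda>s. (orbit_integral s \<xi> - orbit_integral t \<xi>) /\<^sub>R (s - t)"
  have ev: "\<forall>\<^sub>F s in ?F. 0 \<le> s" by (auto simp: eventually_at_filter)
  have dV: "?q s \<in> V" if "0 \<le> s" for s using that t by (intro V_scaleR V_diff orbit_integral_in_V) auto
  have "((\<lambda>s. C (?q s - S t \<xi>)) \<longlongrightarrow> 0) ?F"
  proof (rule C_tendsto_zero)
    show "\<forall>\<^sub>F s in ?F. ?q s - S t \<xi> \<in> V"
      using ev by eventually_elim (intro V_diff dV S_in_V \<xi> t)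
    show "((\<lambda>s. ?q s - S t \<xi>) \<longlongrightarrow> 0) ?F"
      using orbit_integral_derivative[OF t, of \<xi>] unfolding has_vector_derivative_iff_quotient by (rule LIM_zero)
    assume "V = generator_domain S"
    then have d: "\<xi> \<in> generator_domain S" using \<xi> by simp
    show "((\<lambda>s. generator S (?q s - S t \<xi>)) \<longlongrightarrow> 0) ?F"
    proof (rule Lim_transform_eventually)
      have "((\<lambda>s. S s \<xi>) has_vector_derivative S t (generator S \<xi>)) (at t within {0..b})"
        by (rule has_vector_derivative_within_subset[OF generator_S(3)[OF d t(1)]]) auto
      then show "((\<lambda>s. (S s \<xi> - S t \<xi>) /\<^sub>R (s - t) - S t (generator S \<xi>)) \<longlongrightarrow> 0) ?F"
        unfolding has_vector_derivative_iff_quotient by (rule LIM_zero)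
      show "\<forall>\<^sub>F s in ?F. (S s \<xi> - S t \<xi>) /\<^sub>R (s - t) - S t (generator S \<xi>) = generator S (?q s - S t \<xi>)"
        using ev
      proof eventually_elim
        case (elim s)
        note I = generator_orbit_integral[OF elim, of \<xi>] and It = generator_orbit_integral[OF t(1), of \<xi>]
        note D = generator_diff[OF I(1) It(1)]
        note Q = generator_scaleR[OF D(1), of "inverse (s - t)"]
        show ?case
          using generator_diff(2)[OF Q(1) generator_S(1)[OF d t(1)]] Q(2) D(2) I(2) It(2) generator_S(2)[OF d t(1)]
          by simp
      qed
    qed
  qed
  moreover have "\<forall>\<^sub>F s in ?F. C (?q s - S t \<xi>) = (C (orbit_integral s \<xi>) - C (orbit_integral t \<xi>)) /\<^sub>R (s - t) - C (S t \<xi>)"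
    using ev
  proof eventually_elim
    case (elim s)
    note I = orbit_integral_in_V[OF elim, of \<xi>] and It = orbit_integral_in_V[OF t(1), of \<xi>]
    show ?case
      using C_diff[OF dV[OF elim] S_in_V[OF \<xi> t(1)]] C_scaleR[OF V_diff[OF I It], of "inverse (s - t)"] C_diff[OF I It]
      by simp
  qed
  ultimately have "((\<lambda>s. (C (orbit_integral s \<xi>) - C (orbit_integral t \<xi>)) /\<^sub>R (s - t) - C (S t \<xi>)) \<longlongrightarrow> 0) ?F"
    by (rule Lim_transform_eventually)
  then show "((\<lambda>s. (C (orbit_integral s \<xi>) - C (orbit_integral t \<xi>)) /\<^sub>R (s - t)) \<longlongrightarrow> C (S t \<xi>)) ?F"
    by (rule LIM_zero_cancel)
qed

text \<open>Integration in time gains the domain: the graph norm of the integral is at most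
  |integral| + |S t \<xi> - \<xi>|, a multiple of |\<xi>|. So the noiseless output is a bounded
  functional on the whole state space also in case (ii), and the Riesz representation applies to
  it.\<close>

lemma bounded_linear_C_orbit_integral:
  assumes t: "0 \<le> t" "t \<le> T"
  shows "bounded_linear (\<lambda>\<xi>. C (orbit_integral t \<xi>))"
proof -
  \<comment> \<open>Dominates both constants \<mu> t and \<mu> + 1 of the two estimates below; their
    sum accounts for the factor 2.\<close>
  define k where "k = \<mu> * t + \<mu> + 1"
  have k: "0 \<le> k" using \<mu>_nonneg t by (simp add: k_def)
  have "norm (C (orbit_integral t \<xi>)) \<le> norm \<xi> * (C_norm * (2 * k))" for \<xi>
  proof -
    have 1: "norm (orbit_integral t \<xi>) \<le> k * norm \<xi>"
    proof -
      have "\<mu> * t * norm \<xi> \<le> k * norm \<xi>" using \<mu>_nonneg by (intro mult_right_mono) (auto simp: k_def)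
      then show ?thesis using norm_orbit_integral[OF t, of \<xi>] by linarith
    qed
    have 2: "norm (S t \<xi> - \<xi>) \<le> k * norm \<xi>"
    proof -
      have "norm (S t \<xi> - \<xi>) \<le> \<mu> * norm \<xi> + norm \<xi>"
        using norm_triangle_ineq4[of "S t \<xi>" \<xi>] norm_S[OF t, of \<xi>] by linarith
      also have "\<dots> = (\<mu> + 1) * norm \<xi>" by (simp add: distrib_right)
      also have "\<dots> \<le> k * norm \<xi>" using \<mu>_nonneg t by (intro mult_right_mono) (auto simp: k_def)
      finally show ?thesis .
    qed
    have "normV (orbit_integral t \<xi>) \<le> 2 * k * norm \<xi>"
      using V
    proof
      assume "V = UNIV \<and> normV = norm"
      then show ?thesis using 1 mult_nonneg_nonneg[OF k norm_ge_zero, of \<xi>] by simp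
    next
      assume *: "V = generator_domain S \<and> normV = graph_norm (generator S)"
      have "normV (orbit_integral t \<xi>) \<le> norm (orbit_integral t \<xi>) + norm (S t \<xi> - \<xi>)"
        using * generator_orbit_integral(2)[OF t(1), of \<xi>] by (simp add: graph_norm_def sqrt_sum_squares_le_sum)
      then show ?thesis using 1 2 by simp
    qed
    then have "C_norm * normV (orbit_integral t \<xi>) \<le> C_norm * (2 * k * norm \<xi>)"
      by (rule mult_left_mono[OF _ C_norm_nonneg])
    then show ?thesis using C_bound[OF orbit_integral_in_V[OF t(1)], of \<xi>] by (simp add: mult_ac)
  qed
  then show ?thesis
    by (intro bounded_linear_intro[where K="C_norm * (2 * k)"])
       (auto simp: orbit_integral_add orbit_integral_scaleR C_add C_scaleR orbit_integral_in_V t)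
qed

text \<open>In case (ii) C need not be bounded on the state space, so it cannot simply be moved
  under the integral; the fundamental theorem of calculus for s \<mapsto> C (orbit integral) takes
  the place of that interchange.\<close>

lemma C_orbit_integral_eq:
  assumes \<xi>: "\<xi> \<in> V" and s: "0 \<le> s" "s \<le> T"
  shows "C (orbit_integral s \<xi>) = (\<integral>t. indicator {0..s} t *\<^sub>R C (S t \<xi>) \<partial>time_measure T)"
proof -
  have "(\<integral>t. indicator {0..s} t *\<^sub>R C (S t \<xi>) \<partial>lborel) = C (orbit_integral s \<xi>) - C (orbit_integral 0 \<xi>)"
  proof (rule integral_FTC_Icc[OF s(1)])
    show "continuous_on {0..s} (\<lambda>t. C (S t \<xi>))"
      by (rule continuous_on_subset[OF C_S_continuous[OF \<xi>]]) auto
  qed (rule C_orbit_integral_derivative[OF \<xi>])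
  then show ?thesis by (simp add: integral_time_measure_Icc[OF s])
qed

lemma C_S_measurable:
  assumes \<xi>: "\<xi> \<in> V"
  shows "(\<lambda>t. C (S t \<xi>)) \<in> borel_measurable (time_measure T)"
proof -
  have "continuous_on {0..T} (\<lambda>t. C (S t \<xi>))"
    by (rule continuous_on_subset[OF C_S_continuous[OF \<xi>]]) auto
  then have "(\<lambda>t. C (S t \<xi>)) \<in> borel_measurable (restrict_space borel {0..T})"
    by (rule borel_measurable_continuous_on_restrict)
  moreover have "sets (restrict_space lborel {0..T}) = sets (restrict_space (borel :: real measure) {0..T})"
    by (rule sets_restrict_space_cong) simp
  ultimately show ?thesis unfolding time_measure_def by (simp cong: measurable_cong_sets)
qed

end

section \<open>Energy of the bridge signal\<close>

text \<open>Open on the left and closed on the right, so the first n cells partition (0, n h]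
  exactly and a grid point belongs to the cell that ends there. Only the null point 0 is left
  out.\<close>

definition cell :: "real \<Rightarrow> nat \<Rightarrow> real set" where
  "cell h i = {real i * h <.. real (Suc i) * h}"

lemma cell_borel [measurable]: "cell h i \<in> sets borel"
  by (simp add: cell_def)

text \<open>The explicit index yields existence and uniqueness of the cell around t at once.\<close>

lemma mem_cell_iff:
  assumes "0 < h" "0 < t"
  shows "t \<in> cell h i \<longleftrightarrow> i = nat (\<lceil>t / h\<rceil> - 1)"
proof -
  have pos: "\<lceil>t / h\<rceil> \<ge> 1" using assms by (simp add: divide_pos_pos)
  have "t \<in> cell h i \<longleftrightarrow> real i < t / h \<and> t / h \<le> real (Suc i)"
    using assms by (simp add: cell_def pos_less_divide_eq pos_divide_le_eq)
  also have "\<dots> \<longleftrightarrow> \<lceil>t / h\<rceil> = int i + 1"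
    by (simp add: ceiling_eq_iff add.commute)
  also have "\<dots> \<longleftrightarrow> i = nat (\<lceil>t / h\<rceil> - 1)" using pos by linarith
  finally show ?thesis .
qed

lemma sum_indicator_cell:
  assumes "0 < h" "0 < t" "t \<in> cell h i" "i < n"
  shows "(\<Sum>j<n. indicator (cell h j) t *\<^sub>R F j) = (F i :: 'b::real_vector)"
proof -
  have "(\<Sum>j<n. indicator (cell h j) t *\<^sub>R F j) = (\<Sum>j<n. if j = i then F j else 0)"
  proof (rule sum.cong[OF refl])
    fix j
    have "t \<in> cell h j \<longleftrightarrow> j = i" using mem_cell_iff[OF assms(1,2)] assms(3) by simp
    then show "indicator (cell h j) t *\<^sub>R F j = (if j = i then F j else 0)"
      using assms(3) by auto
  qed
  then show ?thesis using assms(4) by simp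
qed

lemma ex_cell:
  assumes "0 < h" "0 < t" "t \<le> real n * h"
  obtains i where "i < n" "t \<in> cell h i"
proof -
  have mem: "t \<in> cell h (nat (\<lceil>t / h\<rceil> - 1))" using mem_cell_iff[OF assms(1,2)] by simp
  then have "real (nat (\<lceil>t / h\<rceil> - 1)) * h < real n * h" using assms(3) by (simp add: cell_def)
  then have "nat (\<lceil>t / h\<rceil> - 1) < n" using assms(1) by simp
  then show ?thesis using mem that by blast
qed

lemma AE_time_measure_pos: "AE t in time_measure T. 0 < t"
proof -
  have "AE t in lborel. t \<noteq> (0::real)" by (rule AE_lborel_singleton)
  then have "AE t in time_measure T. t \<noteq> 0"
    unfolding time_measure_def by (subst AE_restrict_space_iff) auto
  moreover have "AE t in time_measure T. 0 \<le> t" by (rule AE_I2) simp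
  ultimately show ?thesis by eventually_elim simp
qed

lemma cell_subset_Icc:
  assumes "0 < h" "real (Suc i) * h \<le> T"
  shows "cell h i \<subseteq> {0..T}"
proof
  fix t assume "t \<in> cell h i"
  then have t: "real i * h < t" "t \<le> real (Suc i) * h" by (simp_all add: cell_def)
  have "0 \<le> real i * h" using assms(1) by simp
  then have "0 \<le> t" "t \<le> T" using t assms(2) by linarith+
  then show "t \<in> {0..T}" by simp
qed

lemma cell_pos:
  assumes "0 < h" "t \<in> cell h i"
  shows "0 < t"
proof -
  have "0 \<le> real i * h" using assms(1) by simp
  moreover have "real i * h < t" using assms(2) by (simp add: cell_def)
  ultimately show ?thesis by linarith
qed

lemma measure_time_measure_cell:
  assumes "0 < h" "real (Suc i) * h \<le> T"
  shows "measure (time_measure T) (cell h i) = h"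
proof -
  have "measure (time_measure T) (cell h i) = measure lborel (cell h i)"
    unfolding time_measure_def by (intro measure_restrict_space cell_subset_Icc assms) simp
  also have "\<dots> = h" using assms(1) by (simp add: cell_def algebra_simps)
  finally show ?thesis .
qed

lemma sum_inverse_squares_le: "(\<Sum>i\<in>{1..<n}. 1 / (real i)\<^sup>2) \<le> pi\<^sup>2 / 6"
proof -
  have "(\<Sum>i\<in>{1..<n}. 1 / (real i)\<^sup>2) = (\<Sum>i<n - 1. 1 / (real i + 1)\<^sup>2)"
    by (rule sum.reindex_bij_witness[of _ Suc "\<lambda>i. i - 1"]) auto
  also have "\<dots> \<le> (\<Sum>i. 1 / (real i + 1)\<^sup>2)"
    using inverse_squares_sums by (intro sum_le_suminf) (auto simp: sums_iff add.commute)
  also have "\<dots> = pi\<^sup>2 / 6" using inverse_squares_sums by (simp add: sums_iff add.commute)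
  finally show ?thesis .
qed

text \<open>Twice (h/2)^3 / 3. The resulting 12, multiplied by the 6 of the sum of inverse squares,
  is the 72 of the final estimate.\<close>

lemma integral_cell_midpoint_square:
  assumes h: "0 < h" "real (Suc i) * h \<le> T"
  shows "(\<integral>t. indicator (cell h i) t * (t - (real i + 1 / 2) * h)\<^sup>2 \<partial>time_measure T) = h ^ 3 / 12"
proof -
  define a b m where "a = real i * h" and "b = real (Suc i) * h" and "m = (real i + 1 / 2) * h"
  have ab: "0 \<le> a" "a \<le> b" "b \<le> T" using h by (auto simp: a_def b_def)
  have "(\<integral>t. indicator (cell h i) t * (t - m)\<^sup>2 \<partial>time_measure T)
      = (\<integral>t. indicator {0..T} t *\<^sub>R (indicator (cell h i) t * (t - m)\<^sup>2) \<partial>lborel)"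
    unfolding time_measure_def by (rule integral_restrict_space) simp
  also have "\<dots> = (\<integral>t. indicator {a..b} t *\<^sub>R (t - m)\<^sup>2 \<partial>lborel)"
  proof (rule integral_cong_AE)
    have "AE t in lborel. t \<noteq> a" by (rule AE_lborel_singleton)
    then show "AE t in lborel. indicator {0..T} t *\<^sub>R (indicator (cell h i) t * (t - m)\<^sup>2) = indicator {a..b} t *\<^sub>R (t - m)\<^sup>2"
      by eventually_elim (use ab in \<open>auto simp: cell_def a_def b_def split: split_indicator\<close>)
  qed (simp_all add: cell_borel)
  also have "\<dots> = (b - m) ^ 3 / 3 - (a - m) ^ 3 / 3"
  proof (rule integral_FTC_Icc[OF ab(2)])
    show "((\<lambda>t. (t - m) ^ 3 / 3) has_vector_derivative (t - m)\<^sup>2) (at t within {a..b})" for t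
      unfolding has_real_derivative_iff_has_vector_derivative[symmetric]
      by (auto intro!: derivative_eq_intros simp: power2_eq_square)
    show "continuous_on {a..b} (\<lambda>t. (t - m)\<^sup>2)" by (intro continuous_intros)
  qed
  also have "b - m = h / 2" by (simp add: b_def m_def algebra_simps)
  also have "a - m = - (h / 2)" by (simp add: a_def m_def algebra_simps)
  also have "(h / 2) ^ 3 / 3 - (- (h / 2)) ^ 3 / 3 = h ^ 3 / 12" by (simp add: power3_eq_cube)
  finally show ?thesis by (simp add: m_def)
qed

lemma integrable_scaleR_bounded_time_measure:
  fixes f :: "real \<Rightarrow> 'b::{banach, second_countable_topology}"
  assumes "f \<in> borel_measurable (time_measure T)" "\<And>t. 0 \<le> t \<Longrightarrow> t \<le> T \<Longrightarrow> norm (f t) \<le> B" "A \<in> sets borel"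
  shows "integrable (time_measure T) (\<lambda>t. indicator A t *\<^sub>R f t)"
proof (rule integrable_bounded_time_measure)
  have "(indicator A :: real \<Rightarrow> real) \<in> borel_measurable (time_measure T)"
    by (intro measurable_time_measure borel_measurable_indicator assms)
  then show "(\<lambda>t. indicator A t *\<^sub>R f t) \<in> borel_measurable (time_measure T)"
    using assms(1) by (rule borel_measurable_scaleR)
  show "norm (indicator A t *\<^sub>R f t) \<le> B" if "0 \<le> t" "t \<le> T" for t
    using assms(2)[OF that] order_trans[OF norm_ge_zero assms(2)[OF that]] by (simp split: split_indicator)
qed

text \<open>On the first cell the function itself is bounded; on the others subtracting the midpoint value
  leaves a Lipschitz remainder, and the squared Lipschitz constants \<open>(c\<^sub>1 / (i h))\<^sup>2\<close> sum to a multiple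
  of \<open>\<pi>\<^sup>2 / 6\<close>.\<close>
lemma (in observed_semigroup) zero_mean_pairing:
  fixes \<alpha> :: "real \<Rightarrow> real^'r" and n :: nat
  defines "h \<equiv> T / real n"
  assumes \<xi>: "\<xi> \<in> V" and n: "0 < n"
    and \<alpha>: "\<alpha> \<in> borel_measurable (time_measure T)" "\<And>t. 0 \<le> t \<Longrightarrow> t \<le> T \<Longrightarrow> norm (\<alpha> t) \<le> B"
    and zero: "\<And>i. i < n \<Longrightarrow> (\<integral>t. indicator (cell h i) t *\<^sub>R \<alpha> t \<partial>time_measure T) = 0"
  shows "(\<integral>t. \<alpha> t \<bullet> C (S t \<xi>) \<partial>time_measure T)\<^sup>2
    \<le> (\<integral>t. (norm (\<alpha> t))\<^sup>2 \<partial>time_measure T) * ((C_norm * normV \<xi>)\<^sup>2 * (h * (\<mu>\<^sup>2 + c1\<^sup>2 * pi\<^sup>2 / 72)))"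
proof -
  define f where "f t = C (S t \<xi>)" for t
  have h: "0 < h" "real n * h = T" using T n by (auto simp: h_def)
  have ih: "real (Suc i) * h \<le> T" if "i < n" for i
  proof -
    have "real (Suc i) * h \<le> real n * h" using that h(1) by (intro mult_right_mono) auto
    then show ?thesis using h(2) by simp
  qed
  define W where "W = C_norm * normV \<xi>"
  have W: "0 \<le> W" using C_norm_nonneg normV_nonneg by (simp add: W_def)
  define k where "k i = (if i = 0 then 0 else f ((real i + 1 / 2) * h))" for i :: nat
  define \<kappa> where "\<kappa> t = (\<Sum>i<n. indicator (cell h i) t *\<^sub>R k i)" for t
  define g where "g t = f t - \<kappa> t" for t
  have fm: "f \<in> borel_measurable (time_measure T)" unfolding f_def[abs_def] by (rule C_S_measurable[OF \<xi>])
  have fb: "norm (f t) \<le> W * \<mu>" if "0 \<le> t" "t \<le> T" for t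
    using norm_C_S[OF \<xi> that] by (simp add: f_def W_def mult_ac)
  have \<kappa>m: "\<kappa> \<in> borel_measurable (time_measure T)" unfolding \<kappa>_def[abs_def]
    by (rule measurable_time_measure) measurable
  have \<kappa>b: "norm (\<kappa> t) \<le> (\<Sum>i<n. norm (k i))" for t
    unfolding \<kappa>_def by (rule order_trans[OF norm_sum sum_mono]) (simp split: split_indicator)
  have gm: "g \<in> borel_measurable (time_measure T)"
    unfolding g_def[abs_def] using fm \<kappa>m by (rule borel_measurable_diff)
  have gb: "norm (g t) \<le> W * \<mu> + (\<Sum>i<n. norm (k i))" if "0 \<le> t" "t \<le> T" for t
    unfolding g_def using norm_triangle_ineq4[of "f t" "\<kappa> t"] fb[OF that] \<kappa>b[of t] by linarith
  have sq: "square_integrable (time_measure T) (\<lambda>t. norm (p t))"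
    if "p \<in> borel_measurable (time_measure T)" "\<And>t. 0 \<le> t \<Longrightarrow> t \<le> T \<Longrightarrow> norm (p t) \<le> D" for p :: "real \<Rightarrow> real^'r" and D
    unfolding square_integrable_def
  proof
    show "(\<lambda>t. norm (p t)) \<in> borel_measurable (time_measure T)" using that(1) by measurable
    then have "(\<lambda>t. (norm (p t))\<^sup>2) \<in> borel_measurable (time_measure T)" by (rule borel_measurable_power)
    then show "integrable (time_measure T) (\<lambda>t. (norm (p t))\<^sup>2)"
      by (rule integrable_bounded_time_measure[where B="D\<^sup>2"]) (use that(2) in \<open>simp add: power_mono\<close>)
  qed
  note \<alpha>2 = sq[OF \<alpha>] and g2 = sq[OF gm gb]
  have inner_int: "integrable (time_measure T) (\<lambda>t. \<alpha> t \<bullet> p t)"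
    if "p \<in> borel_measurable (time_measure T)" "\<And>t. 0 \<le> t \<Longrightarrow> t \<le> T \<Longrightarrow> norm (p t) \<le> D" for p D
  proof (rule Bochner_Integration.integrable_bound[OF square_integrable_mult[OF \<alpha>2 sq[OF that]]])
    show "(\<lambda>t. \<alpha> t \<bullet> p t) \<in> borel_measurable (time_measure T)" using \<alpha>(1) that(1) by (rule borel_measurable_inner)
    show "AE t in time_measure T. norm (\<alpha> t \<bullet> p t) \<le> norm (norm (\<alpha> t) * norm (p t))"
      by (rule AE_I2) (simp add: Cauchy_Schwarz_ineq2)
  qed
  \<comment> \<open>The correction \<kappa> is constant on each cell, where \<alpha> has mean zero,
    so f may be replaced by g = f - \<kappa>.\<close>
  have \<alpha>\<kappa>: "(\<integral>t. \<alpha> t \<bullet> \<kappa> t \<partial>time_measure T) = 0"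
  proof -
    have i: "integrable (time_measure T) (\<lambda>t. (indicator (cell h i) t *\<^sub>R \<alpha> t) \<bullet> k i)" for i
      by (intro integrable_inner_left integrable_scaleR_bounded_time_measure[OF \<alpha>] cell_borel)
    have "(\<integral>t. \<alpha> t \<bullet> \<kappa> t \<partial>time_measure T) = (\<integral>t. (\<Sum>i<n. (indicator (cell h i) t *\<^sub>R \<alpha> t) \<bullet> k i) \<partial>time_measure T)"
      by (simp add: \<kappa>_def inner_sum_right)
    also have "\<dots> = (\<Sum>i<n. \<integral>t. (indicator (cell h i) t *\<^sub>R \<alpha> t) \<bullet> k i \<partial>time_measure T)"
      by (rule Bochner_Integration.integral_sum) (rule i)
    also have "\<dots> = (\<Sum>i<n. (\<integral>t. indicator (cell h i) t *\<^sub>R \<alpha> t \<partial>time_measure T) \<bullet> k i)"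
      by (intro sum.cong refl integral_inner_left integrable_scaleR_bounded_time_measure[OF \<alpha>] cell_borel)
    also have "\<dots> = 0" using zero by simp
    finally show ?thesis .
  qed
  have "(\<integral>t. \<alpha> t \<bullet> f t \<partial>time_measure T) = (\<integral>t. \<alpha> t \<bullet> g t \<partial>time_measure T) + (\<integral>t. \<alpha> t \<bullet> \<kappa> t \<partial>time_measure T)"
    using inner_int[OF fm fb] inner_int[OF \<kappa>m \<kappa>b] by (simp add: g_def inner_diff_right)
  then have "\<bar>\<integral>t. \<alpha> t \<bullet> f t \<partial>time_measure T\<bar> = \<bar>\<integral>t. \<alpha> t \<bullet> g t \<partial>time_measure T\<bar>" by (simp add: \<alpha>\<kappa>)
  also have "\<dots> \<le> (\<integral>t. norm (\<alpha> t) * norm (g t) \<partial>time_measure T)"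
  proof -
    have "\<bar>\<integral>t. \<alpha> t \<bullet> g t \<partial>time_measure T\<bar> \<le> (\<integral>t. \<bar>\<alpha> t \<bullet> g t\<bar> \<partial>time_measure T)" by (rule integral_abs_bound)
    also have "\<dots> \<le> (\<integral>t. norm (\<alpha> t) * norm (g t) \<partial>time_measure T)"
      by (intro integral_mono integrable_abs inner_int[OF gm gb] square_integrable_mult \<alpha>2 g2 Cauchy_Schwarz_ineq2)
    finally show ?thesis .
  qed
  finally have "(\<integral>t. \<alpha> t \<bullet> f t \<partial>time_measure T)\<^sup>2 \<le> (\<integral>t. norm (\<alpha> t) * norm (g t) \<partial>time_measure T)\<^sup>2"
    by (rule abs_le_square_iff[THEN iffD1, OF order_trans[OF _ abs_ge_self]])
  also have "\<dots> \<le> (\<integral>t. (norm (\<alpha> t))\<^sup>2 \<partial>time_measure T) * (\<integral>t. (norm (g t))\<^sup>2 \<partial>time_measure T)"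
    by (rule square_integrable_cauchy_schwarz[OF \<alpha>2 g2])
  also have "\<dots> \<le> (\<integral>t. (norm (\<alpha> t))\<^sup>2 \<partial>time_measure T) * (W\<^sup>2 * (h * (\<mu>\<^sup>2 + c1\<^sup>2 * pi\<^sup>2 / 72)))"
  proof (rule mult_left_mono)
    \<comment> \<open>Dominates |g|^2 on cell i. The integral over the first cell is W^2 \<mu>^2 h;
      over a later one it is (W c1 / (i h))^2 h^3 / 12 = W^2 h c1^2 / (12 i^2).\<close>
    define b where "b i t = (if i = 0 then (W * \<mu>)\<^sup>2 else (W * (\<bar>c1\<bar> / (real i * h)))\<^sup>2 * (t - (real i + 1 / 2) * h)\<^sup>2)" for i :: nat and t
    have b0: "0 \<le> b i t" for i t by (simp add: b_def)
    have bm: "b i \<in> borel_measurable borel" for i unfolding b_def[abs_def] by measurable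
    have "integrable (time_measure T) (\<lambda>t. indicator (cell h i) t *\<^sub>R b i t)" for i
    proof (rule integrable_scaleR_bounded_time_measure[OF measurable_time_measure[OF bm] _ cell_borel])
      fix t assume "0 \<le> t" "t \<le> T"
      moreover have ic: "0 \<le> (real i + 1 / 2) * h" using h(1) by simp
      ultimately have "\<bar>t - (real i + 1 / 2) * h\<bar> \<le> T + (real i + 1 / 2) * h"
        unfolding abs_le_iff using ic by linarith
      then have "(t - (real i + 1 / 2) * h)\<^sup>2 \<le> (T + (real i + 1 / 2) * h)\<^sup>2"
        by (metis abs_ge_zero power2_abs power_mono)
      then have "(W * (\<bar>c1\<bar> / (real i * h)))\<^sup>2 * (t - (real i + 1 / 2) * h)\<^sup>2
          \<le> (W * (\<bar>c1\<bar> / (real i * h)))\<^sup>2 * (T + (real i + 1 / 2) * h)\<^sup>2"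
        by (rule mult_left_mono) simp
      note le = this
      have P0: "0 \<le> (W * (\<bar>c1\<bar> / (real i * h)))\<^sup>2 * (T + (real i + 1 / 2) * h)\<^sup>2" by (intro mult_nonneg_nonneg) simp_all
      have nb: "norm (b i t) = b i t" using b0 by simp
      show "norm (b i t) \<le> (W * \<mu>)\<^sup>2 + (W * (\<bar>c1\<bar> / (real i * h)))\<^sup>2 * (T + (real i + 1 / 2) * h)\<^sup>2"
      proof (cases "i = 0")
        case True
        then have "b i t = (W * \<mu>)\<^sup>2" by (simp add: b_def)
        then show ?thesis unfolding nb using P0 by linarith
      next
        case False
        then have "b i t = (W * (\<bar>c1\<bar> / (real i * h)))\<^sup>2 * (t - (real i + 1 / 2) * h)\<^sup>2"
          by (simp only: b_def if_False)
        then show ?thesis unfolding nb using le zero_le_power2[of "W * \<mu>"] by linarith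
      qed
    qed
    then have bi: "integrable (time_measure T) (\<lambda>t. indicator (cell h i) t * b i t)" for i by simp
    have point: "(norm (g t))\<^sup>2 \<le> (\<Sum>i<n. indicator (cell h i) t * b i t)" if t: "0 < t" "t \<le> T" for t
    proof -
      obtain i where i: "i < n" "t \<in> cell h i" using ex_cell[OF h(1) t(1), of n] t(2) h(2) by auto
      have gt: "g t = f t - k i"
        unfolding g_def \<kappa>_def by (simp add: sum_indicator_cell[OF h(1) t(1) i(2) i(1)])
      have "(norm (f t - k i))\<^sup>2 \<le> b i t"
      proof (cases "i = 0")
        case True
        then show ?thesis using power_mono[OF fb[of t], of 2] t by (simp add: b_def k_def)
      next
        case False
        \<comment> \<open>The left endpoint of the cell: both t and the midpoint lie to its right,
          and it is positive because i is at least 1.\<close>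
        define s where "s = real i * h"
        have s: "0 < s" "s \<le> t" "s \<le> (real i + 1 / 2) * h"
          using False h(1) i(2) by (auto simp: s_def cell_def distrib_right)
        have "norm (f t - k i) \<le> C_norm * (\<bar>c1\<bar> / s * \<bar>t - (real i + 1 / 2) * h\<bar>) * normV \<xi>"
          using C_S_Lipschitz[OF \<xi> s] False by (simp add: f_def k_def)
        also have "\<dots> = (W * (\<bar>c1\<bar> / (real i * h))) * \<bar>t - (real i + 1 / 2) * h\<bar>"
          by (simp add: W_def s_def mult_ac)
        finally have "(norm (f t - k i))\<^sup>2 \<le> ((W * (\<bar>c1\<bar> / (real i * h))) * \<bar>t - (real i + 1 / 2) * h\<bar>)\<^sup>2"
          by (rule power_mono) simp
        also have "\<dots> = b i t"
          using False by (simp only: b_def if_False power_mult_distrib power2_abs)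
        finally show ?thesis .
      qed
      then show ?thesis
        unfolding gt using sum_indicator_cell[OF h(1) t(1) i(2) i(1), of "\<lambda>i. b i t"] by simp
    qed
    have "(\<integral>t. (norm (g t))\<^sup>2 \<partial>time_measure T) \<le> (\<integral>t. (\<Sum>i<n. indicator (cell h i) t * b i t) \<partial>time_measure T)"
    proof (rule integral_mono_AE)
      show "integrable (time_measure T) (\<lambda>t. (norm (g t))\<^sup>2)" using g2 by (simp add: square_integrable_def)
      show "integrable (time_measure T) (\<lambda>t. \<Sum>i<n. indicator (cell h i) t * b i t)"
        by (rule Bochner_Integration.integrable_sum) (rule bi)
      show "AE t in time_measure T. (norm (g t))\<^sup>2 \<le> (\<Sum>i<n. indicator (cell h i) t * b i t)"
        using AE_time_measure_pos AE_space
      proof eventually_elim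
        case (elim t)
        then have "0 < t" "t \<le> T" by simp_all
        then show ?case by (rule point)
      qed
    qed
    also have "\<dots> = (\<Sum>i<n. \<integral>t. indicator (cell h i) t * b i t \<partial>time_measure T)"
      by (rule Bochner_Integration.integral_sum) (rule bi)
    also have "\<dots> = (\<Sum>i<n. W\<^sup>2 * h * (if i = 0 then \<mu>\<^sup>2 else c1\<^sup>2 / 12 * (1 / (real i)\<^sup>2)))"
    proof (intro sum.cong refl)
      fix i assume "i \<in> {..<n}"
      then have iT: "real (Suc i) * h \<le> T" using ih by simp
      show "(\<integral>t. indicator (cell h i) t * b i t \<partial>time_measure T) = W\<^sup>2 * h * (if i = 0 then \<mu>\<^sup>2 else c1\<^sup>2 / 12 * (1 / (real i)\<^sup>2))"
      proof (cases "i = 0")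
        case True
        have "cell h i \<inter> space (time_measure T) = cell h i"
          using cell_subset_Icc[OF h(1) iT] by auto
        then have "(\<integral>t. indicator (cell h i) t \<partial>time_measure T) = h"
          using measure_time_measure_cell[OF h(1) iT] by simp
        then show ?thesis using True by (simp add: b_def power_mult_distrib)
      next
        case False
        have "(\<integral>t. indicator (cell h i) t * b i t \<partial>time_measure T)
            = (W * (\<bar>c1\<bar> / (real i * h)))\<^sup>2 * (\<integral>t. indicator (cell h i) t * (t - (real i + 1 / 2) * h)\<^sup>2 \<partial>time_measure T)"
          unfolding integral_mult_right_zero[symmetric]
          by (rule Bochner_Integration.integral_cong[OF refl]) (use False in \<open>simp add: b_def mult_ac\<close>)
        also have "\<dots> = (W * (\<bar>c1\<bar> / (real i * h)))\<^sup>2 * (h ^ 3 / 12)"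
          by (simp only: integral_cell_midpoint_square[OF h(1) iT])
        also have "\<dots> = W\<^sup>2 * h * (c1\<^sup>2 / 12 * (1 / (real i)\<^sup>2))"
          using h(1) False by (simp add: power_mult_distrib power_divide power2_eq_square power3_eq_cube field_simps)
        finally show ?thesis using False by simp
      qed
    qed
    also have "\<dots> = W\<^sup>2 * h * (\<Sum>i<n. (if i = 0 then \<mu>\<^sup>2 else c1\<^sup>2 / 12 * (1 / (real i)\<^sup>2)))"
      by (simp add: sum_distrib_left)
    also have "(\<Sum>i<n. (if i = 0 then \<mu>\<^sup>2 else c1\<^sup>2 / 12 * (1 / (real i)\<^sup>2)))
        = \<mu>\<^sup>2 + c1\<^sup>2 / 12 * (\<Sum>i\<in>{1..<n}. 1 / (real i)\<^sup>2)"
    proof -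
      have "{..<n} = insert 0 {1..<n}" using n by auto
      then show ?thesis by (simp add: sum_distrib_left)
    qed
    also have "W\<^sup>2 * h * (\<mu>\<^sup>2 + c1\<^sup>2 / 12 * (\<Sum>i\<in>{1..<n}. 1 / (real i)\<^sup>2)) \<le> W\<^sup>2 * h * (\<mu>\<^sup>2 + c1\<^sup>2 / 12 * (pi\<^sup>2 / 6))"
      using h(1) by (intro mult_left_mono add_left_mono sum_inverse_squares_le) auto
    also have "\<dots> = W\<^sup>2 * (h * (\<mu>\<^sup>2 + c1\<^sup>2 * pi\<^sup>2 / 72))" by simp
    finally show "(\<integral>t. (norm (g t))\<^sup>2 \<partial>time_measure T) \<le> W\<^sup>2 * (h * (\<mu>\<^sup>2 + c1\<^sup>2 * pi\<^sup>2 / 72))" .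
  qed simp
  finally show ?thesis by (simp add: f_def W_def)
qed

text \<open>Subtracting a step function with jumps on the grid removes the cell averages: this replaces the
  observed path by its bridges between the grid points.\<close>
lemma ex_grid_correction:
  fixes a :: "real \<Rightarrow> real^'r" and n :: nat and T :: real
  defines "h \<equiv> T / real n"
  defines "G \<equiv> (\<lambda>l. real l * h) ` {1..n}"
  assumes T: "0 < T" and n: "0 < n" and J: "finite J" "G \<subseteq> J"
  shows "\<exists>d. (\<forall>s. s \<notin> G \<longrightarrow> d s = 0) \<and>
    (\<forall>i<n. (\<integral>t. indicator (cell h i) t *\<^sub>R step_function J (\<lambda>s. a s - d s) t \<partial>time_measure T) = 0)"
proof -
  have h: "0 < h" "real n * h = T" using T n by (auto simp: h_def)
  \<comment> \<open>On cell i exactly the grid jumps with index i + 1, ..., n are active, so their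
    coefficients have to telescope to m i / h. The added value m n = 0 closes the telescoping
    sum.\<close>
  define m where "m i = (if i < n then \<integral>t. indicator (cell h i) t *\<^sub>R step_function J a t \<partial>time_measure T else 0)" for i
  define D where "D l = (m (l - 1) - m l) /\<^sub>R h" for l
  have inj: "inj_on (\<lambda>l. real l * h) {1..n}" using h(1) by (auto simp: inj_on_def)
  define d where "d s = (if s \<in> G then D (inv_into {1..n} (\<lambda>l. real l * h) s) else 0)" for s
  have dG: "d (real l * h) = D l" if "l \<in> {1..n}" for l
  proof -
    have "real l * h \<in> G" using that by (auto simp: G_def)
    then show ?thesis unfolding d_def using inv_into_f_f[OF inj that] by simp
  qed
  have sm: "step_function J c \<in> borel_measurable (time_measure T)" for c :: "real \<Rightarrow> real^'r"
    by (intro measurable_time_measure measurable_step_function)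
  have cell_d: "step_function J d t = m i /\<^sub>R h" if i: "i < n" "t \<in> cell h i" for t i
  proof -
    have t: "0 < t" by (rule cell_pos[OF h(1) i(2)])
    have "step_function J d t = (\<Sum>s\<in>G. indicator {0..s} t *\<^sub>R d s)"
      unfolding step_function_def by (rule sum.mono_neutral_right) (use J in \<open>auto simp: d_def\<close>)
    also have "\<dots> = (\<Sum>l\<in>{1..n}. indicator {0..real l * h} t *\<^sub>R D l)"
      unfolding G_def by (subst sum.reindex[OF inj]) (simp add: dG)
    also have "\<dots> = (\<Sum>l\<in>{1..n}. if i < l then D l else 0)"
    proof (rule sum.cong[OF refl])
      fix l assume "l \<in> {1..n}"
      have "t \<le> real l * h \<longleftrightarrow> i < l"
      proof
        assume "t \<le> real l * h"
        then have "real i * h < real l * h" using i(2) by (simp add: cell_def)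
        then show "i < l" using h(1) by simp
      next
        assume "i < l"
        then have "real (Suc i) * h \<le> real l * h" using h(1) by (intro mult_right_mono) auto
        then show "t \<le> real l * h" using i(2) by (simp add: cell_def)
      qed
      then show "indicator {0..real l * h} t *\<^sub>R D l = (if i < l then D l else 0)"
        using t by (simp add: indicator_def)
    qed
    also have "\<dots> = (\<Sum>l\<in>{Suc i..n}. D l)"
      by (rule sum.mono_neutral_cong_right) auto
    also have "\<dots> = (\<Sum>l\<in>{Suc i..n}. m (l - 1) - m l) /\<^sub>R h"
      by (simp add: D_def scaleR_sum_right)
    also have "(\<Sum>l\<in>{Suc i..n}. m (l - 1) - m l) = (\<Sum>l\<in>{i..<n}. m l - m (Suc l))"
      by (rule sum.reindex_bij_witness[of _ Suc "\<lambda>l. l - 1"]) auto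
    also have "\<dots> = m i - m n" using i(1) sum_Suc_diff'[of i n "\<lambda>l. - m l"] by simp
    also have "m n = 0" by (simp add: m_def)
    finally show ?thesis by simp
  qed
  have "(\<integral>t. indicator (cell h i) t *\<^sub>R step_function J (\<lambda>s. a s - d s) t \<partial>time_measure T) = 0" if i: "i < n" for i
  proof -
    have "real (Suc i) * h \<le> real n * h" using i h(1) by (intro mult_right_mono) auto
    then have ih: "real (Suc i) * h \<le> T" using h(2) by simp
    have int: "integrable (time_measure T) (\<lambda>t. indicator (cell h i) t *\<^sub>R step_function J c t)" for c :: "real \<Rightarrow> real^'r"
      by (rule integrable_scaleR_bounded_time_measure[OF sm norm_step_function cell_borel])
    have "(\<integral>t. indicator (cell h i) t *\<^sub>R step_function J (\<lambda>s. a s - d s) t \<partial>time_measure T)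
        = (\<integral>t. indicator (cell h i) t *\<^sub>R step_function J a t - indicator (cell h i) t *\<^sub>R step_function J d t \<partial>time_measure T)"
      by (simp add: step_function_def scaleR_diff_right sum_subtractf)
    also have "\<dots> = m i - (\<integral>t. indicator (cell h i) t *\<^sub>R step_function J d t \<partial>time_measure T)"
      using int i by (simp add: m_def)
    also have "(\<integral>t. indicator (cell h i) t *\<^sub>R step_function J d t \<partial>time_measure T)
        = (\<integral>t. indicator (cell h i) t *\<^sub>R (m i /\<^sub>R h) \<partial>time_measure T)"
      by (rule Bochner_Integration.integral_cong[OF refl]) (simp add: cell_d[OF i] split: split_indicator)
    also have "\<dots> = m i"
    proof -
      have "cell h i \<inter> space (time_measure T) = cell h i"
        using cell_subset_Icc[OF h(1) ih] by auto
      moreover have "cell h i \<in> sets (time_measure T)"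
        using calculation sets_restrict_space[of lborel "{0..T}"]
        unfolding time_measure_def by (auto simp: Int_commute space_restrict_space intro!: image_eqI[of _ _ "cell h i"])
      moreover have "emeasure (time_measure T) (cell h i) < \<infinity>"
        using finite_measure.emeasure_finite[OF finite_measure_time_measure] by (simp add: less_top)
      ultimately show ?thesis
        using measure_time_measure_cell[OF h(1) ih] h(1) by simp
    qed
    finally show ?thesis by simp
  qed
  moreover have "d s = 0" if "s \<notin> G" for s using that by (simp add: d_def)
  ultimately show ?thesis by blast
qed

text \<open>Up to the null point 0 the interval up to a grid point is a union of whole cells. This
  is what makes the corrected noise uncorrelated with the sampled noise.\<close>

lemma zero_mean_grid_integral:
  fixes \<alpha> :: "real \<Rightarrow> real^'r"
  assumes h: "0 < h"
    and \<alpha>: "\<alpha> \<in> borel_measurable (time_measure T)" "\<And>t. 0 \<le> t \<Longrightarrow> t \<le> T \<Longrightarrow> norm (\<alpha> t) \<le> B"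
    and zero: "\<And>i. i < l \<Longrightarrow> (\<integral>t. indicator (cell h i) t *\<^sub>R \<alpha> t \<partial>time_measure T) = 0"
  shows "(\<integral>t. indicator {0..real l * h} t *\<^sub>R \<alpha> t \<partial>time_measure T) = 0"
proof -
  have int: "integrable (time_measure T) (\<lambda>t. indicator A t *\<^sub>R \<alpha> t)" if "A \<in> sets borel" for A
    by (rule integrable_scaleR_bounded_time_measure[OF \<alpha> that])
  have "(\<integral>t. indicator {0..real l * h} t *\<^sub>R \<alpha> t \<partial>time_measure T)
      = (\<integral>t. (\<Sum>i<l. indicator (cell h i) t *\<^sub>R \<alpha> t) \<partial>time_measure T)"
  proof (rule integral_cong_AE)
    show "AE t in time_measure T. indicator {0..real l * h} t *\<^sub>R \<alpha> t = (\<Sum>i<l. indicator (cell h i) t *\<^sub>R \<alpha> t)"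
      using AE_time_measure_pos
    proof eventually_elim
      case (elim t)
      show ?case
      proof (cases "t \<le> real l * h")
        case True
        obtain i where i: "i < l" "t \<in> cell h i" using ex_cell[OF h elim True] .
        then show ?thesis using sum_indicator_cell[OF h elim i(2) i(1), of "\<lambda>_. \<alpha> t"] True elim by simp
      next
        case False
        have "indicator (cell h i) t = (0::real)" if "i < l" for i
        proof -
          have "real (Suc i) * h \<le> real l * h" using that h by (intro mult_right_mono) auto
          then show ?thesis using False by (simp add: cell_def indicator_def)
        qed
        then show ?thesis using False by simp
      qed
    qed
    show "(\<lambda>t. indicator {0..real l * h} t *\<^sub>R \<alpha> t) \<in> borel_measurable (time_measure T)"
      using int by (rule borel_measurable_integrable) simp
    show "(\<lambda>t. \<Sum>i<l. indicator (cell h i) t *\<^sub>R \<alpha> t) \<in> borel_measurable (time_measure T)"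
      using int[OF cell_borel] by (intro borel_measurable_sum borel_measurable_integrable)
  qed
  also have "\<dots> = (\<Sum>i<l. \<integral>t. indicator (cell h i) t *\<^sub>R \<alpha> t \<partial>time_measure T)"
    by (rule Bochner_Integration.integral_sum) (rule int[OF cell_borel])
  finally show ?thesis using zero by simp
qed

section \<open>Linear estimators\<close>

lemma (in prob_space) gaussian_char_add_const:
  assumes f: "gaussian_char M f"
  shows "gaussian_char M (\<lambda>\<omega>. c + f \<omega>)"
proof -
  have f2: "square_integrable M f" using f by (simp add: gaussian_char_def)
  note fi = square_integrable_integrable[OF f2]
  have e1: "expectation (\<lambda>\<omega>. c + f \<omega>) = c + expectation f" using fi by (simp add: prob_space)
  have "expectation (\<lambda>\<omega>. (c + f \<omega>)\<^sup>2) = expectation (\<lambda>\<omega>. c\<^sup>2 + (f \<omega>)\<^sup>2 + 2 * c * f \<omega>)"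
    by (simp add: power2_sum)
  also have "\<dots> = c\<^sup>2 + expectation (\<lambda>\<omega>. (f \<omega>)\<^sup>2) + 2 * c * expectation f"
    using fi f2 by (simp add: square_integrable_def prob_space)
  finally have "expectation (\<lambda>\<omega>. (c + f \<omega>)\<^sup>2) - (expectation (\<lambda>\<omega>. c + f \<omega>))\<^sup>2
      = expectation (\<lambda>\<omega>. (f \<omega>)\<^sup>2) - (expectation f)\<^sup>2"
    unfolding e1 by (simp add: power2_sum)
  moreover have "(\<integral>\<omega>. iexp (c + f \<omega>) \<partial>M) = iexp c * (\<integral>\<omega>. iexp (f \<omega>) \<partial>M)"
    by (simp add: distrib_left exp_add)
  ultimately show ?thesis
    using f square_integrable_add[OF square_integrable_const f2]
    by (simp add: gaussian_char_def e1 distrib_left mult_exp_exp add_diff_eq)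
qed

lemma path_combination_add:
  "path_combination J (\<lambda>s. a s + b s) w \<omega> = path_combination J a w \<omega> + path_combination J b w \<omega>"
  by (simp add: path_combination_def inner_add_left sum.distrib)

lemma path_combination_diff:
  "path_combination J (\<lambda>s. a s - b s) w \<omega> = path_combination J a w \<omega> - path_combination J b w \<omega>"
  by (simp add: path_combination_def inner_diff_left sum_subtractf)

lemma path_combination_scale:
  "path_combination J (\<lambda>s. r *\<^sub>R a s) w \<omega> = r * path_combination J a w \<omega>"
  by (simp add: path_combination_def sum_distrib_left)

lemma path_combination_mono_neutral:
  assumes "finite J" "K \<subseteq> J" "\<And>s. s \<notin> K \<Longrightarrow> a s = 0"
  shows "path_combination J a w \<omega> = path_combination K a w \<omega>"
  unfolding path_combination_def by (rule sum.mono_neutral_right) (use assms in auto)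

text \<open>Translates between scalar coordinates of the outputs, indexed by pairs of a time and a
  basis vector, and vector coefficients per time. Projection uses the former, step functions the
  latter.\<close>

lemma path_combination_Basis:
  fixes w :: "real \<Rightarrow> 'w \<Rightarrow> 'b::euclidean_space"
  shows "(\<Sum>p\<in>J \<times> Basis. \<theta> p * (w (fst p) \<omega> \<bullet> snd p)) = path_combination J (\<lambda>s. \<Sum>i\<in>Basis. \<theta> (s, i) *\<^sub>R i) w \<omega>"
  unfolding path_combination_def
  by (simp add: sum.cartesian_product' inner_sum_left inner_commute[of "w s \<omega>" for s])

section \<open>The observed system and its estimators\<close>

locale kalman = wiener M R w + observed_semigroup S T \<mu> C V normV c1
  for M :: "'w measure" and R :: "real^'r^'r" and w :: "real \<Rightarrow> 'w \<Rightarrow> real^'r"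
    and S :: "real \<Rightarrow> ('x::{real_inner, banach, second_countable_topology} \<Rightarrow>\<^sub>L 'x)" and T \<mu> :: real
    and C :: "'x \<Rightarrow> real^'r" and V :: "'x set" and normV :: "'x \<Rightarrow> real" and c1 :: real +
  fixes x :: "'w \<Rightarrow> 'x" and m :: 'x and P0 :: "'x \<Rightarrow> 'x"
  assumes x: "gaussian M x m P0"
    and indep: "indep_set (sets (vimage_algebra (space M) x borel)) (sets (generated_sigma M {0..} w))"
    and xV: "AE \<omega> in M. x \<omega> \<in> V"
begin

definition y :: "real \<Rightarrow> 'w \<Rightarrow> real^'r" where
  "y t \<omega> = C (orbit_integral t (x \<omega>)) + w t \<omega>"

lemma observation_eq: "observation S C x w = y"
  by (simp add: fun_eq_iff observation_def y_def orbit_integral_def)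

lemma x_measurable [measurable]: "x \<in> borel_measurable M"
  using x by (simp add: gaussian_def)

lemma x_gaussian: "real_gaussian M (\<lambda>\<omega>. x \<omega> \<bullet> k) (m \<bullet> k) (P0 k \<bullet> k)"
  using x unfolding gaussian_def by blast

lemma x_square_integrable: "square_integrable M (\<lambda>\<omega>. c + x \<omega> \<bullet> k)"
  by (intro square_integrable_add square_integrable_const real_gaussian_square_integrable[OF x_gaussian])

lemma x_w_indep:
  assumes "J \<subseteq> {0..}"
  shows "indep_var borel (\<lambda>\<omega>. c + x \<omega> \<bullet> k) borel (path_combination J a w)"
proof (rule indep_var_of_indep_set[OF indep])
  have "x \<in> borel_measurable (vimage_algebra (space M) x borel)"
    by (rule measurable_vimage_algebra1) simp
  then show "(\<lambda>\<omega>. c + x \<omega> \<bullet> k) \<in> borel_measurable (vimage_algebra (space M) x borel)" by simp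
  show "path_combination J a w \<in> borel_measurable (generated_sigma M {0..} w)"
    unfolding path_combination_def[abs_def]
    using assms by (intro borel_measurable_sum borel_measurable_inner measurable_generated_sigma) auto
qed simp_all

text \<open>Components of the final state, linear estimators and their residuals all have this
  affine form in x and finitely many noise values, and the form is closed under linear combinations.
  Joint Gaussianity of all these variables is therefore contained in this statement.\<close>

lemma affine_gaussian_char:
  assumes "finite J" "J \<subseteq> {0..}"
  shows "gaussian_char M (\<lambda>\<omega>. c + x \<omega> \<bullet> k + path_combination J a w \<omega>)"
  by (intro gaussian_char_add_indep x_w_indep path_combination_gaussian_char gaussian_char_add_const
      real_gaussian_char[OF x_gaussian] assms)

lemma affine_square_integrable:
  assumes "finite J" "J \<subseteq> {0..}"
  shows "square_integrable M (\<lambda>\<omega>. c + x \<omega> \<bullet> k + path_combination J a w \<omega>)"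
  using affine_gaussian_char[OF assms] by (simp add: gaussian_char_def)

lemma x_w_uncorrelated:
  assumes "finite J" "J \<subseteq> {0..}"
  shows "expectation (\<lambda>\<omega>. (c + x \<omega> \<bullet> k) * path_combination J a w \<omega>) = 0"
  by (rule integral_mult_indep_zero[OF prob_space_axioms x_w_indep[OF assms(2)] x_square_integrable
      path_combination_square_integrable[OF assms] path_combination_expectation[OF assms(2)]])

text \<open>Turns the signal part of an estimator into a scalar marginal of x, whose law is known by
  the definition of a Gaussian variable.\<close>

lemma signal_functional:
  assumes "J \<subseteq> {0..T}"
  shows "\<exists>k. \<forall>\<xi>. (\<Sum>s\<in>J. a s \<bullet> C (orbit_integral s \<xi>)) = \<xi> \<bullet> k"
proof -
  have "bounded_linear (\<lambda>\<xi>. \<Sum>s\<in>J. a s \<bullet> C (orbit_integral s \<xi>))"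
    by (intro bounded_linear_sum bounded_linear_compose[OF bounded_linear_inner_right] bounded_linear_C_orbit_integral)
       (use assms in auto)
  then show ?thesis by (rule riesz_representation)
qed

lemma y_combination:
  assumes "J \<subseteq> {0..T}"
  shows "\<exists>k. \<forall>\<omega>. path_combination J a y \<omega> = x \<omega> \<bullet> k + path_combination J a w \<omega> \<and>
    x \<omega> \<bullet> k = (\<Sum>s\<in>J. a s \<bullet> C (orbit_integral s (x \<omega>)))"
proof -
  obtain k where k: "\<And>\<xi>. (\<Sum>s\<in>J. a s \<bullet> C (orbit_integral s \<xi>)) = \<xi> \<bullet> k"
    using signal_functional[OF assms, of a] by blast
  have "path_combination J a y \<omega> = x \<omega> \<bullet> k + path_combination J a w \<omega>" for \<omega>
    by (simp add: path_combination_def y_def inner_add_right sum.distrib k)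
  then show ?thesis by (intro exI[of _ k]) (simp add: k)
qed

lemma y_square_integrable:
  assumes "0 \<le> t" "t \<le> T"
  shows "square_integrable M (\<lambda>\<omega>. v \<bullet> y t \<omega>)"
proof -
  have "{t} \<subseteq> {0..T}" using assms by simp
  from y_combination[OF this, of "\<lambda>_. v"] obtain k
    where k: "\<And>\<omega>. path_combination {t} (\<lambda>_. v) y \<omega> = x \<omega> \<bullet> k + path_combination {t} (\<lambda>_. v) w \<omega>" by blast
  have eq: "(\<lambda>\<omega>. v \<bullet> y t \<omega>) = (\<lambda>\<omega>. 0 + x \<omega> \<bullet> k + path_combination {t} (\<lambda>_. v) w \<omega>)"
    using k by (simp add: path_combination_def fun_eq_iff)
  show ?thesis unfolding eq by (rule affine_square_integrable) (use assms in auto)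
qed

lemma y_measurable:
  assumes "0 \<le> t" "t \<le> T"
  shows "y t \<in> borel_measurable M"
  unfolding borel_measurable_euclidean_space[of "y t"]
  using square_integrable_measurable[OF y_square_integrable[OF assms]] by (simp add: inner_commute)

lemma y_combination_square_integrable:
  assumes "J \<subseteq> {0..T}"
  shows "square_integrable M (path_combination J a y)"
  unfolding path_combination_def[abs_def]
  by (rule square_integrable_sum) (use assms in \<open>auto intro!: y_square_integrable\<close>)

text \<open>The averaged upper bound for the signal per unit of step-function energy, divided by the
  lower bound \<open>min_eigenvalue R\<close> for the noise variance per unit of the same
  energy.\<close>

definition gain :: "nat \<Rightarrow> real" where
  "gain n = C_norm\<^sup>2 * (T / real n * (\<mu>\<^sup>2 + c1\<^sup>2 * pi\<^sup>2 / 72)) * expectation (\<lambda>\<omega>. (normV (x \<omega>))\<^sup>2)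
     / min_eigenvalue R"

lemma gain_nonneg: "0 \<le> gain n"
  using T min_eigenvalue_positive_definite(1)[OF R] by (simp add: gain_def)

text \<open>The grid correction splits the estimator into a part orthogonal to \<open>u\<close>, a signal part
  \<open>\<ell>\<close> and a noise part \<open>b\<close>; \<open>b\<close> is uncorrelated with everything else, so its variance
  bounds the variance of the estimator from below, while the signal part is controlled by
  the same step function.\<close>
lemma linear_estimator_bound:
  fixes n :: nat and d :: "real \<Rightarrow> real^'r"
  defines "G \<equiv> (\<lambda>l. real l * (T / real n)) ` {1..n}"
  assumes n: "0 < n" and J: "finite J" "G \<subseteq> J" "J \<subseteq> {0..T}"
    and xi: "integrable M (\<lambda>\<omega>. (normV (x \<omega>))\<^sup>2)"
    and d: "\<And>s. s \<notin> G \<Longrightarrow> d s = 0"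
    and u: "\<And>\<omega>. u \<omega> = cu + x \<omega> \<bullet> ku + path_combination J d w \<omega>"
    and u0: "expectation u = 0"
    and uy: "\<And>s v. s \<in> G \<Longrightarrow> expectation (\<lambda>\<omega>. u \<omega> * (v \<bullet> y s \<omega>)) = 0"
  shows "(expectation (\<lambda>\<omega>. u \<omega> * (c + path_combination J a y \<omega>)))\<^sup>2
    \<le> gain n * expectation (\<lambda>\<omega>. (u \<omega>)\<^sup>2) * expectation (\<lambda>\<omega>. (c + path_combination J a y \<omega>)\<^sup>2)"
proof -
  define h where "h = T / real n"
  have h: "0 < h" using T n by (simp add: h_def)
  have J0: "J \<subseteq> {0..}" using J(3) by auto
  obtain g where g: "\<And>s. s \<notin> G \<Longrightarrow> g s = 0"
    and zero: "\<And>i. i < n \<Longrightarrow> (\<integral>t. indicator (cell h i) t *\<^sub>R step_function J (\<lambda>s. a s - g s) t \<partial>time_measure T) = 0"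
    using ex_grid_correction[OF T n J(1) J(2)[unfolded G_def], of a] unfolding h_def G_def by blast
  define a' where "a' s = a s - g s" for s
  define \<alpha> where "\<alpha> = step_function J a'"
  note zero' = zero[folded a'_def[abs_def], folded \<alpha>_def]
  have \<alpha>m: "\<alpha> \<in> borel_measurable (time_measure T)"
    unfolding \<alpha>_def by (intro measurable_time_measure measurable_step_function)
  have \<alpha>b: "norm (\<alpha> t) \<le> (\<Sum>s\<in>J. norm (a' s))" for t unfolding \<alpha>_def by (rule norm_step_function)
  obtain kl where kl: "\<And>\<omega>. path_combination J a' y \<omega> = x \<omega> \<bullet> kl + path_combination J a' w \<omega>"
    and kl_sum: "\<And>\<omega>. x \<omega> \<bullet> kl = (\<Sum>s\<in>J. a' s \<bullet> C (orbit_integral s (x \<omega>)))"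
    using y_combination[OF J(3), of a'] by blast
  obtain kg where kg: "\<And>\<omega>. path_combination J g y \<omega> = x \<omega> \<bullet> kg + path_combination J g w \<omega>"
    using y_combination[OF J(3), of g] by blast
  define b where "b = path_combination J a' w"
  define l where "l \<omega> = x \<omega> \<bullet> kl" for \<omega>
  have q: "c + path_combination J a y \<omega> = c + path_combination J g y \<omega> + l \<omega> + b \<omega>" for \<omega>
    using path_combination_add[of J a' g y \<omega>] kl[of \<omega>] by (simp add: a'_def l_def b_def)
  have u2: "square_integrable M u" unfolding u[abs_def] by (rule affine_square_integrable[OF J(1) J0])
  have b2: "square_integrable M b" unfolding b_def by (rule path_combination_square_integrable[OF J(1) J0])
  have l2: "square_integrable M l" unfolding l_def[abs_def] by (rule real_gaussian_square_integrable[OF x_gaussian])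
  have gy2: "square_integrable M (path_combination J g y)" by (rule y_combination_square_integrable[OF J(3)])
  \<comment> \<open>For coefficients supported on the grid, the isometry expresses the covariance
    with b through integrals of \<alpha> over [0, s] with s in G, and these vanish.\<close>
  have bw: "expectation (\<lambda>\<omega>. b \<omega> * path_combination J e w \<omega>) = 0" if e: "\<And>s. s \<notin> G \<Longrightarrow> e s = 0" for e
  proof -
    have iv: "(\<integral>t. indicator {0..s} t *\<^sub>R \<alpha> t \<partial>time_measure T) = 0" if sG: "s \<in> G" for s
    proof -
      obtain j where j: "j \<in> {1..n}" "s = real j * h" using sG unfolding G_def h_def by blast
      show ?thesis unfolding j(2)
        by (rule zero_mean_grid_integral[OF h \<alpha>m \<alpha>b]) (use j zero' in auto)
    qed
    have i: "integrable (time_measure T) (\<lambda>t. indicator {0..s} t *\<^sub>R \<alpha> t)" for s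
      by (rule integrable_scaleR_bounded_time_measure[OF \<alpha>m \<alpha>b]) simp
    have "expectation (\<lambda>\<omega>. b \<omega> * path_combination J e w \<omega>) = (\<integral>t. \<alpha> t \<bullet> (R *v step_function J e t) \<partial>time_measure T)"
      unfolding b_def \<alpha>_def by (rule path_combination_covariance[OF J(1,3) J(1,3)])
    also have "\<dots> = (\<integral>t. (\<Sum>s\<in>J. (indicator {0..s} t *\<^sub>R \<alpha> t) \<bullet> (R *v e s)) \<partial>time_measure T)"
      unfolding step_function_def[of J e] matrix_vector_mult_sum_scaleR by (simp add: inner_sum_right)
    also have "\<dots> = (\<Sum>s\<in>J. \<integral>t. (indicator {0..s} t *\<^sub>R \<alpha> t) \<bullet> (R *v e s) \<partial>time_measure T)"
      by (rule Bochner_Integration.integral_sum) (rule integrable_inner_left[OF i])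
    also have "\<dots> = (\<Sum>s\<in>J. (\<integral>t. indicator {0..s} t *\<^sub>R \<alpha> t \<partial>time_measure T) \<bullet> (R *v e s))"
      by (intro sum.cong refl integral_inner_left i)
    also have "\<dots> = 0"
    proof (rule sum.neutral, rule ballI)
      fix s assume "s \<in> J"
      show "(\<integral>t. indicator {0..s} t *\<^sub>R \<alpha> t \<partial>time_measure T) \<bullet> (R *v e s) = 0"
        by (cases "s \<in> G") (simp_all add: iv e)
    qed
    finally show ?thesis .
  qed
  have xb: "expectation (\<lambda>\<omega>. (r + x \<omega> \<bullet> k) * b \<omega>) = 0" for r k
    unfolding b_def by (rule x_w_uncorrelated[OF J(1) J0])
  have affine_b: "expectation (\<lambda>\<omega>. (r + x \<omega> \<bullet> k + path_combination J e w \<omega>) * b \<omega>) = 0"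
    if e: "\<And>s. s \<notin> G \<Longrightarrow> e s = 0" for r k e
  proof -
    have "expectation (\<lambda>\<omega>. (r + x \<omega> \<bullet> k + path_combination J e w \<omega>) * b \<omega>)
        = expectation (\<lambda>\<omega>. (r + x \<omega> \<bullet> k) * b \<omega> + b \<omega> * path_combination J e w \<omega>)"
      by (simp add: algebra_simps)
    also have "\<dots> = 0"
      using square_integrable_mult[OF x_square_integrable b2] xb bw[OF e]
        square_integrable_mult[OF b2 path_combination_square_integrable[OF J(1) J0]] by simp
    finally show ?thesis .
  qed
  have ub: "expectation (\<lambda>\<omega>. u \<omega> * b \<omega>) = 0" unfolding u by (rule affine_b[OF d])
  have ug: "expectation (\<lambda>\<omega>. u \<omega> * path_combination J g y \<omega>) = 0"
  proof -
    have i: "integrable M (\<lambda>\<omega>. u \<omega> * (g s \<bullet> y s \<omega>))" if "s \<in> J" for s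
      using that J(3) by (intro square_integrable_mult u2 y_square_integrable) auto
    have "expectation (\<lambda>\<omega>. u \<omega> * path_combination J g y \<omega>) = expectation (\<lambda>\<omega>. \<Sum>s\<in>J. u \<omega> * (g s \<bullet> y s \<omega>))"
      by (simp add: path_combination_def sum_distrib_left)
    also have "\<dots> = (\<Sum>s\<in>J. expectation (\<lambda>\<omega>. u \<omega> * (g s \<bullet> y s \<omega>)))"
      by (rule Bochner_Integration.integral_sum) (rule i)
    also have "\<dots> = 0"
    proof (rule sum.neutral, rule ballI)
      fix s assume "s \<in> J"
      show "expectation (\<lambda>\<omega>. u \<omega> * (g s \<bullet> y s \<omega>)) = 0"
        by (cases "s \<in> G") (simp_all add: uy g)
    qed
    finally show ?thesis .
  qed
  have uq: "expectation (\<lambda>\<omega>. u \<omega> * (c + path_combination J a y \<omega>)) = expectation (\<lambda>\<omega>. u \<omega> * l \<omega>)"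
  proof -
    have "expectation (\<lambda>\<omega>. u \<omega> * (c + path_combination J a y \<omega>))
        = expectation (\<lambda>\<omega>. c * u \<omega> + u \<omega> * path_combination J g y \<omega> + u \<omega> * l \<omega> + u \<omega> * b \<omega>)"
      unfolding q by (simp add: algebra_simps)
    also have "\<dots> = expectation (\<lambda>\<omega>. u \<omega> * l \<omega>)"
      using square_integrable_integrable[OF u2] u0 ug ub square_integrable_mult[OF u2 gy2]
        square_integrable_mult[OF u2 l2] square_integrable_mult[OF u2 b2] by simp
    finally show ?thesis .
  qed
  have q2: "expectation (\<lambda>\<omega>. (b \<omega>)\<^sup>2) \<le> expectation (\<lambda>\<omega>. (c + path_combination J a y \<omega>)\<^sup>2)"
  proof -
    \<comment> \<open>Everything in the estimator except b: signal terms and noise at grid times.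
      Hence E(r b) = 0 and the second moment of the estimator splits into those of r and b.\<close>
    define r where "r \<omega> = c + x \<omega> \<bullet> (kg + kl) + path_combination J g w \<omega>" for \<omega>
    have r2: "square_integrable M r" unfolding r_def[abs_def] by (rule affine_square_integrable[OF J(1) J0])
    have qr: "c + path_combination J a y \<omega> = r \<omega> + b \<omega>" for \<omega>
      unfolding q kg by (simp add: r_def l_def inner_add_right)
    have "expectation (\<lambda>\<omega>. (c + path_combination J a y \<omega>)\<^sup>2)
        = expectation (\<lambda>\<omega>. (r \<omega>)\<^sup>2 + (b \<omega>)\<^sup>2 + 2 * (r \<omega> * b \<omega>))"
      unfolding qr by (simp add: power2_sum mult.assoc)
    also have "\<dots> = expectation (\<lambda>\<omega>. (r \<omega>)\<^sup>2) + expectation (\<lambda>\<omega>. (b \<omega>)\<^sup>2) + 2 * expectation (\<lambda>\<omega>. r \<omega> * b \<omega>)"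
      using r2 b2 square_integrable_mult[OF r2 b2] by (simp add: square_integrable_def)
    also have "expectation (\<lambda>\<omega>. r \<omega> * b \<omega>) = 0" unfolding r_def by (rule affine_b[OF g])
    finally show ?thesis by simp
  qed
  define A where "A = (\<integral>t. (norm (\<alpha> t))\<^sup>2 \<partial>time_measure T)"
  have A0: "0 \<le> A" by (simp add: A_def)
  have bA: "min_eigenvalue R * A \<le> expectation (\<lambda>\<omega>. (b \<omega>)\<^sup>2)"
  proof -
    have "expectation (\<lambda>\<omega>. (b \<omega>)\<^sup>2) = (\<integral>t. \<alpha> t \<bullet> (R *v \<alpha> t) \<partial>time_measure T)"
      unfolding b_def \<alpha>_def power2_eq_square by (rule path_combination_covariance[OF J(1,3) J(1,3)])
    moreover have "min_eigenvalue R * A = (\<integral>t. min_eigenvalue R * (norm (\<alpha> t))\<^sup>2 \<partial>time_measure T)"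
      by (simp add: A_def)
    moreover have "(\<integral>t. min_eigenvalue R * (norm (\<alpha> t))\<^sup>2 \<partial>time_measure T) \<le> (\<integral>t. \<alpha> t \<bullet> (R *v \<alpha> t) \<partial>time_measure T)"
    proof (rule integral_mono)
      define B where "B = (\<Sum>s\<in>J. norm (a' s))"
      have \<alpha>B: "norm (\<alpha> t) \<le> B" for t using \<alpha>b by (simp add: B_def)
      have n2: "(norm (\<alpha> t))\<^sup>2 \<le> B\<^sup>2" for t using \<alpha>B by (simp add: power_mono)
      note [measurable] = \<alpha>m
      have "integrable (time_measure T) (\<lambda>t. (norm (\<alpha> t))\<^sup>2)"
        by (rule integrable_bounded_time_measure[where B="B\<^sup>2"]) (measurable, simp add: n2)
      then show "integrable (time_measure T) (\<lambda>t. min_eigenvalue R * (norm (\<alpha> t))\<^sup>2)" by simp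
      obtain D where D: "\<And>v. norm (R *v v) \<le> norm v * D" "0 < D"
        using bounded_linear.pos_bounded[OF matrix_vector_mul_bounded_linear[of R]] by blast
      show "integrable (time_measure T) (\<lambda>t. \<alpha> t \<bullet> (R *v \<alpha> t))"
      proof (rule integrable_bounded_time_measure[where B="B\<^sup>2 * D"])
        have "(\<lambda>v. R *v v) \<in> borel_measurable borel"
          by (intro borel_measurable_continuous_onI linear_continuous_on matrix_vector_mul_bounded_linear)
        from measurable_compose[OF \<alpha>m this]
        show "(\<lambda>t. \<alpha> t \<bullet> (R *v \<alpha> t)) \<in> borel_measurable (time_measure T)"
          by (rule borel_measurable_inner[OF \<alpha>m])
        fix t
        have "norm (\<alpha> t \<bullet> (R *v \<alpha> t)) \<le> norm (\<alpha> t) * norm (R *v \<alpha> t)"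
          using Cauchy_Schwarz_ineq2[of "\<alpha> t" "R *v \<alpha> t"] by simp
        also have "\<dots> \<le> norm (\<alpha> t) * (norm (\<alpha> t) * D)" by (rule mult_left_mono[OF D(1)]) simp
        also have "\<dots> = (norm (\<alpha> t))\<^sup>2 * D" by (simp add: power2_eq_square)
        also have "\<dots> \<le> B\<^sup>2 * D" using n2 D(2) by (intro mult_right_mono) auto
        finally show "norm (\<alpha> t \<bullet> (R *v \<alpha> t)) \<le> B\<^sup>2 * D" .
      qed
    qed (rule min_eigenvalue_positive_definite(2)[OF R])
    ultimately show ?thesis by linarith
  qed
  define Q where "Q = C_norm\<^sup>2 * (h * (\<mu>\<^sup>2 + c1\<^sup>2 * pi\<^sup>2 / 72))"
  have Q0: "0 \<le> Q" using h by (simp add: Q_def)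
  have lA: "expectation (\<lambda>\<omega>. (l \<omega>)\<^sup>2) \<le> A * Q * expectation (\<lambda>\<omega>. (normV (x \<omega>))\<^sup>2)"
  proof -
    \<comment> \<open>For each outcome with x in V, the signal part is the pairing of \<alpha> with
      the orbit of C, and the zero-mean estimate applies pathwise.\<close>
    have pt: "(l \<omega>)\<^sup>2 \<le> A * Q * (normV (x \<omega>))\<^sup>2" if xw: "x \<omega> \<in> V" for \<omega>
    proof -
      have fi: "integrable (time_measure T) (\<lambda>t. indicator {0..s} t *\<^sub>R C (S t (x \<omega>)))" for s
        by (rule integrable_scaleR_bounded_time_measure[OF C_S_measurable[OF xw] norm_C_S[OF xw]]) auto
      have "l \<omega> = (\<Sum>s\<in>J. a' s \<bullet> C (orbit_integral s (x \<omega>)))" by (simp add: l_def kl_sum)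
      also have "\<dots> = (\<Sum>s\<in>J. \<integral>t. a' s \<bullet> (indicator {0..s} t *\<^sub>R C (S t (x \<omega>))) \<partial>time_measure T)"
      proof (rule sum.cong[OF refl])
        fix s assume "s \<in> J"
        then have s: "0 \<le> s" "s \<le> T" using J(3) by auto
        show "a' s \<bullet> C (orbit_integral s (x \<omega>)) = (\<integral>t. a' s \<bullet> (indicator {0..s} t *\<^sub>R C (S t (x \<omega>))) \<partial>time_measure T)"
          unfolding C_orbit_integral_eq[OF xw s] by (rule integral_inner_right[symmetric]) (rule fi)
      qed
      also have "\<dots> = (\<integral>t. (\<Sum>s\<in>J. a' s \<bullet> (indicator {0..s} t *\<^sub>R C (S t (x \<omega>)))) \<partial>time_measure T)"
        by (rule Bochner_Integration.integral_sum[symmetric]) (rule integrable_inner_right[OF fi])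
      also have "\<dots> = (\<integral>t. \<alpha> t \<bullet> C (S t (x \<omega>)) \<partial>time_measure T)"
        by (simp add: \<alpha>_def step_function_def inner_sum_left)
      finally have "(l \<omega>)\<^sup>2 = (\<integral>t. \<alpha> t \<bullet> C (S t (x \<omega>)) \<partial>time_measure T)\<^sup>2" by simp
      also have "\<dots> \<le> A * ((C_norm * normV (x \<omega>))\<^sup>2 * (h * (\<mu>\<^sup>2 + c1\<^sup>2 * pi\<^sup>2 / 72)))"
        unfolding A_def h_def by (rule zero_mean_pairing[OF xw n \<alpha>m \<alpha>b]) (use zero' in \<open>simp add: h_def\<close>)
      also have "\<dots> = A * Q * (normV (x \<omega>))\<^sup>2" by (simp add: Q_def power_mult_distrib mult_ac)
      finally show ?thesis .
    qed
    have "expectation (\<lambda>\<omega>. (l \<omega>)\<^sup>2) \<le> expectation (\<lambda>\<omega>. A * Q * (normV (x \<omega>))\<^sup>2)"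
    proof (rule integral_mono_AE)
      show "integrable M (\<lambda>\<omega>. (l \<omega>)\<^sup>2)" using l2 by (simp add: square_integrable_def)
      show "integrable M (\<lambda>\<omega>. A * Q * (normV (x \<omega>))\<^sup>2)" using xi by simp
      show "AE \<omega> in M. (l \<omega>)\<^sup>2 \<le> A * Q * (normV (x \<omega>))\<^sup>2"
        using xV by eventually_elim (rule pt)
    qed
    then show ?thesis by simp
  qed
  define X where "X = expectation (\<lambda>\<omega>. (normV (x \<omega>))\<^sup>2)"
  have X0: "0 \<le> X" by (simp add: X_def)
  define U where "U = expectation (\<lambda>\<omega>. (u \<omega>)\<^sup>2)"
  have U0: "0 \<le> U" by (simp add: U_def)
  note lam = min_eigenvalue_positive_definite(1)[OF R]
  have gn: "gain n = Q * X / min_eigenvalue R" by (simp add: gain_def Q_def X_def h_def)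
  \<comment> \<open>The energy A is eliminated here: it bounds the signal from above on the left and
    the noise variance from below on the right.\<close>
  have "A * Q * X = gain n * (min_eigenvalue R * A)" using lam by (simp add: gn)
  also have "\<dots> \<le> gain n * expectation (\<lambda>\<omega>. (b \<omega>)\<^sup>2)" by (rule mult_left_mono[OF bA gain_nonneg])
  also have "\<dots> \<le> gain n * expectation (\<lambda>\<omega>. (c + path_combination J a y \<omega>)\<^sup>2)"
    by (rule mult_left_mono[OF q2 gain_nonneg])
  finally have lq: "expectation (\<lambda>\<omega>. (l \<omega>)\<^sup>2) \<le> gain n * expectation (\<lambda>\<omega>. (c + path_combination J a y \<omega>)\<^sup>2)"
    using lA by (simp add: X_def)
  have "(expectation (\<lambda>\<omega>. u \<omega> * l \<omega>))\<^sup>2 \<le> U * expectation (\<lambda>\<omega>. (l \<omega>)\<^sup>2)"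
    unfolding U_def by (rule square_integrable_cauchy_schwarz[OF u2 l2])
  also have "\<dots> \<le> U * (gain n * expectation (\<lambda>\<omega>. (c + path_combination J a y \<omega>)\<^sup>2))"
    by (rule mult_left_mono[OF lq U0])
  finally show ?thesis unfolding uq by (simp add: U_def mult_ac)
qed

end

section \<open>The discretisation error\<close>

text \<open>The inner product with k commutes with the integral over each set of F, so it carries
  the defining property of the vector-valued conditional expectation to the scalar one.\<close>

lemma (in prob_space) cond_exp_inner:
  fixes X Z :: "'a \<Rightarrow> 'x::{real_inner, banach, second_countable_topology}"
  assumes ce: "is_cond_exp M F X Z"
  shows "AE \<omega> in M. real_cond_exp M F (\<lambda>\<omega>. X \<omega> \<bullet> k) \<omega> = Z \<omega> \<bullet> k"
proof -
  have F: "subalgebra M F" and X: "integrable M X" and Z: "integrable M Z" and ZF: "Z \<in> borel_measurable F"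
    and eq: "\<And>B. B \<in> sets F \<Longrightarrow> set_lebesgue_integral M B Z = set_lebesgue_integral M B X"
    using ce by (auto simp: is_cond_exp_def)
  interpret finite_measure_subalgebra M F by unfold_locales (rule F)
  have k: "set_lebesgue_integral M B (\<lambda>\<omega>. U \<omega> \<bullet> k) = set_lebesgue_integral M B U \<bullet> k"
    if "integrable M U" "B \<in> sets F" for U and B
  proof -
    have "B \<in> sets M" using F that by (auto simp: subalgebra_def)
    then have "integrable M (\<lambda>\<omega>. indicator B \<omega> *\<^sub>R U \<omega>)" using that(1) by (rule integrable_mult_indicator)
    then show ?thesis unfolding set_lebesgue_integral_def
      by (subst integral_inner_left[symmetric]) simp_all
  qed
  show ?thesis
    by (rule real_cond_exp_charact) (use k[OF X] k[OF Z] eq X Z ZF in auto)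
qed

lemma (in prob_space) cond_exp_inner_pairing:
  fixes X Z :: "'a \<Rightarrow> 'x::{real_inner, banach, second_countable_topology}"
  assumes ce: "is_cond_exp M F X Z" and \<psi>: "\<psi> \<in> borel_measurable F"
    and i: "integrable M (\<lambda>\<omega>. (X \<omega> \<bullet> k) * \<psi> \<omega>)"
  shows "expectation (\<lambda>\<omega>. (Z \<omega> \<bullet> k) * \<psi> \<omega>) = expectation (\<lambda>\<omega>. (X \<omega> \<bullet> k) * \<psi> \<omega>)"
proof -
  have F: "subalgebra M F" and X: "integrable M X" and Z: "integrable M Z" using ce by (auto simp: is_cond_exp_def)
  interpret finite_measure_subalgebra M F by unfold_locales (rule F)
  have [measurable]: "\<psi> \<in> borel_measurable M" by (rule measurable_from_subalg[OF F \<psi>])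
  have [measurable]: "X \<in> borel_measurable M" "Z \<in> borel_measurable M" using X Z by auto
  have "expectation (\<lambda>\<omega>. \<psi> \<omega> * real_cond_exp M F (\<lambda>\<omega>. X \<omega> \<bullet> k) \<omega>) = expectation (\<lambda>\<omega>. \<psi> \<omega> * (X \<omega> \<bullet> k))"
    by (rule real_cond_exp_intg(2)) (use i \<psi> in \<open>auto simp: mult.commute\<close>)
  moreover have "expectation (\<lambda>\<omega>. \<psi> \<omega> * real_cond_exp M F (\<lambda>\<omega>. X \<omega> \<bullet> k) \<omega>) = expectation (\<lambda>\<omega>. (Z \<omega> \<bullet> k) * \<psi> \<omega>)"
    by (rule integral_cong_AE) (use cond_exp_inner[OF ce, of k] in auto)
  ultimately show ?thesis by (simp add: mult.commute)
qed

text \<open>Sum the scalar inequalities over a Parseval sequence: Bessel's inequality bounds the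
  partial sums on the right, Fatou's lemma passes to the limit on the left. Integrability of the
  left side is part of the outcome.\<close>

lemma norm_square_integral_le:
  fixes D E :: "'a \<Rightarrow> 'x::{real_inner, second_countable_topology}"
  assumes D[measurable]: "D \<in> borel_measurable M" and E[measurable]: "E \<in> borel_measurable M" and \<kappa>: "0 \<le> \<kappa>"
    and D2: "\<And>k. square_integrable M (\<lambda>\<omega>. D \<omega> \<bullet> k)"
    and E2: "integrable M (\<lambda>\<omega>. (norm (E \<omega>))\<^sup>2)"
    and le: "\<And>k. (\<integral>\<omega>. (D \<omega> \<bullet> k)\<^sup>2 \<partial>M) \<le> \<kappa> * (\<integral>\<omega>. (E \<omega> \<bullet> k)\<^sup>2 \<partial>M)"
  shows "integrable M (\<lambda>\<omega>. (norm (D \<omega>))\<^sup>2)"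
    and "(\<integral>\<omega>. (norm (D \<omega>))\<^sup>2 \<partial>M) \<le> \<kappa> * (\<integral>\<omega>. (norm (E \<omega>))\<^sup>2 \<partial>M)"
proof -
  obtain e :: "nat \<Rightarrow> 'x" where e1: "\<And>v k. (\<Sum>i<k. (v \<bullet> e i)\<^sup>2) \<le> (norm v)\<^sup>2"
    and e2: "\<And>v. (\<lambda>k. \<Sum>i<k. (v \<bullet> e i)\<^sup>2) \<longlonglongrightarrow> (norm v)\<^sup>2"
    using parseval_sequence by blast
  define B where "B = \<kappa> * (\<integral>\<omega>. (norm (E \<omega>))\<^sup>2 \<partial>M)"
  have Ei: "integrable M (\<lambda>\<omega>. (E \<omega> \<bullet> k)\<^sup>2)" for k
  proof (rule Bochner_Integration.integrable_bound)
    show "integrable M (\<lambda>\<omega>. (norm (E \<omega>))\<^sup>2 * (norm k)\<^sup>2)" using E2 by simp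
    have "(E \<omega> \<bullet> k)\<^sup>2 \<le> (norm (E \<omega>))\<^sup>2 * (norm k)\<^sup>2" for \<omega>
      using Cauchy_Schwarz_ineq[of "E \<omega>" k] by (simp add: power2_norm_eq_inner)
    then show "AE \<omega> in M. norm ((E \<omega> \<bullet> k)\<^sup>2) \<le> norm ((norm (E \<omega>))\<^sup>2 * (norm k)\<^sup>2)" by simp
  qed simp
  have Di: "integrable M (\<lambda>\<omega>. (D \<omega> \<bullet> k)\<^sup>2)" for k using D2[of k] by (simp add: square_integrable_def)
  have step: "(\<integral>\<^sup>+\<omega>. ennreal (\<Sum>i<k. (D \<omega> \<bullet> e i)\<^sup>2) \<partial>M) \<le> ennreal B" for k
  proof -
    have "(\<integral>\<omega>. (\<Sum>i<k. (D \<omega> \<bullet> e i)\<^sup>2) \<partial>M) = (\<Sum>i<k. \<integral>\<omega>. (D \<omega> \<bullet> e i)\<^sup>2 \<partial>M)"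
      by (rule Bochner_Integration.integral_sum) (rule Di)
    also have "\<dots> \<le> (\<Sum>i<k. \<kappa> * (\<integral>\<omega>. (E \<omega> \<bullet> e i)\<^sup>2 \<partial>M))" by (rule sum_mono) (rule le)
    also have "\<dots> = \<kappa> * (\<Sum>i<k. \<integral>\<omega>. (E \<omega> \<bullet> e i)\<^sup>2 \<partial>M)" by (rule sum_distrib_left[symmetric])
    also have "(\<Sum>i<k. \<integral>\<omega>. (E \<omega> \<bullet> e i)\<^sup>2 \<partial>M) = (\<integral>\<omega>. (\<Sum>i<k. (E \<omega> \<bullet> e i)\<^sup>2) \<partial>M)"
      by (rule Bochner_Integration.integral_sum[symmetric]) (rule Ei)
    also have "\<kappa> * (\<integral>\<omega>. (\<Sum>i<k. (E \<omega> \<bullet> e i)\<^sup>2) \<partial>M) \<le> B" unfolding B_def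
      by (intro mult_left_mono \<kappa> integral_mono E2 Bochner_Integration.integrable_sum Ei e1)
    finally show ?thesis
      using Di by (subst nn_integral_eq_integral) (auto intro!: ennreal_leI sum_nonneg)
  qed
  have "(\<integral>\<^sup>+\<omega>. ennreal ((norm (D \<omega>))\<^sup>2) \<partial>M) = (\<integral>\<^sup>+\<omega>. liminf (\<lambda>k. ennreal (\<Sum>i<k. (D \<omega> \<bullet> e i)\<^sup>2)) \<partial>M)"
    by (intro nn_integral_cong lim_imp_Liminf[symmetric]) (auto intro!: e2)
  also have "\<dots> \<le> liminf (\<lambda>k. \<integral>\<^sup>+\<omega>. ennreal (\<Sum>i<k. (D \<omega> \<bullet> e i)\<^sup>2) \<partial>M)"
    by (rule nn_integral_liminf) auto
  also have "\<dots> \<le> ennreal B" by (intro Liminf_le always_eventually allI step) auto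
  finally have fin: "(\<integral>\<^sup>+\<omega>. ennreal ((norm (D \<omega>))\<^sup>2) \<partial>M) \<le> ennreal B" .
  have "(\<integral>\<^sup>+\<omega>. ennreal (norm ((norm (D \<omega>))\<^sup>2)) \<partial>M) < \<infinity>"
    using le_less_trans[OF fin ennreal_less_top] by simp
  then show int: "integrable M (\<lambda>\<omega>. (norm (D \<omega>))\<^sup>2)" by (intro integrableI_bounded) auto
  have "0 \<le> B" using \<kappa> by (simp add: B_def)
  have "ennreal (\<integral>\<omega>. (norm (D \<omega>))\<^sup>2 \<partial>M) \<le> ennreal B"
    using fin by (subst (asm) nn_integral_eq_integral[OF int]) auto
  then have "(\<integral>\<omega>. (norm (D \<omega>))\<^sup>2 \<partial>M) \<le> B" using \<open>0 \<le> B\<close> by (simp add: ennreal_le_iff)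
  then show "(\<integral>\<omega>. (norm (D \<omega>))\<^sup>2 \<partial>M) \<le> \<kappa> * (\<integral>\<omega>. (norm (E \<omega>))\<^sup>2 \<partial>M)" by (simp add: B_def)
qed

context kalman
begin

section \<open>Second moments of the initial state\<close>

text \<open>The fourth moment criterion with a constant sequence: every scalar marginal of x is
  Gaussian.\<close>

lemma norm_x_square_integrable: "integrable M (\<lambda>\<omega>. (norm (x \<omega>))\<^sup>2)"
  by (rule norm_square_integrable_of_fourth_moments[where Y="\<lambda>_. x"])
     (use real_gaussian_moments(1,4)[OF x_gaussian] in auto)

text \<open>\<open>A x\<close> is the limit of the Gaussian variables \<open>N (S\<^bsub>1/N\<^esub> x - x)\<close>, so the fourth moment
  criterion applies to it.\<close>
lemma normV_x_square_integrable: "integrable M (\<lambda>\<omega>. (normV (x \<omega>))\<^sup>2)"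
  using V
proof
  assume "V = UNIV \<and> normV = norm"
  then show ?thesis using norm_x_square_integrable by simp
next
  assume *: "V = generator_domain S \<and> normV = graph_norm (generator S)"
  have "integrable M (\<lambda>\<omega>. (norm (generator S (x \<omega>)))\<^sup>2)"
  proof (rule norm_square_integrable_of_fourth_moments[where Y="\<lambda>N \<omega>. generator_quotient N (x \<omega>)"])
    show "(\<lambda>\<omega>. generator_quotient N (x \<omega>)) \<in> borel_measurable M" for N
      by (rule measurable_compose[OF x_measurable measurable_generator_quotient])
    show "(\<lambda>\<omega>. generator S (x \<omega>)) \<in> borel_measurable M"
      by (rule measurable_compose[OF x_measurable measurable_generator])
    have riesz: "\<exists>k. \<forall>\<xi>. generator_quotient N \<xi> \<bullet> h = \<xi> \<bullet> k" for N h
      unfolding generator_quotient_def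
      by (intro riesz_representation bounded_linear_compose[OF bounded_linear_inner_left]
          bounded_linear_compose[OF bounded_linear_scaleR_right] bounded_linear_sub
          blinfun.bounded_linear_right bounded_linear_ident)
    show "integrable M (\<lambda>\<omega>. (generator_quotient N (x \<omega>) \<bullet> h) ^ 4)" for N h
    proof -
      obtain k where "\<forall>\<xi>. generator_quotient N \<xi> \<bullet> h = \<xi> \<bullet> k" using riesz by blast
      then show ?thesis using real_gaussian_moments(1)[OF x_gaussian, of k] by simp
    qed
    show "expectation (\<lambda>\<omega>. (generator_quotient N (x \<omega>) \<bullet> h) ^ 4)
        \<le> 3 * (expectation (\<lambda>\<omega>. (generator_quotient N (x \<omega>) \<bullet> h)\<^sup>2))\<^sup>2" for N h
    proof -
      obtain k where "\<forall>\<xi>. generator_quotient N \<xi> \<bullet> h = \<xi> \<bullet> k" using riesz by blast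
      then show ?thesis using real_gaussian_moments(4)[OF x_gaussian, of k] by simp
    qed
    show "AE \<omega> in M. (\<lambda>N. generator_quotient N (x \<omega>)) \<longlonglongrightarrow> generator S (x \<omega>)"
      using xV by eventually_elim (rule generator_quotient_tendsto, simp add: *)
  qed
  then show ?thesis using norm_x_square_integrable * by (simp add: graph_norm_def)
qed

section \<open>Affine estimators as conditional expectations\<close>

text \<open>Optimality of affine estimators. The least squares residual is centred and uncorrelated
  with the output coordinates; as it is jointly Gaussian with them, it is orthogonal to every
  square-integrable function of these outputs.\<close>

lemma estimator_projection:
  assumes J: "finite J" "J \<subseteq> {0..T}"
    and u: "\<And>\<omega>. u \<omega> = cu + x \<omega> \<bullet> ku + path_combination J d w \<omega>"
  shows "\<exists>c a. expectation (\<lambda>\<omega>. u \<omega> - (c + path_combination J a y \<omega>)) = 0 \<and>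
    (\<forall>s\<in>J. \<forall>v. expectation (\<lambda>\<omega>. (u \<omega> - (c + path_combination J a y \<omega>)) * (v \<bullet> y s \<omega>)) = 0) \<and>
    (\<forall>\<psi>. \<psi> \<in> borel_measurable (generated_sigma M J y) \<longrightarrow> square_integrable M \<psi> \<longrightarrow>
       expectation (\<lambda>\<omega>. (u \<omega> - (c + path_combination J a y \<omega>)) * \<psi> \<omega>) = 0)"
proof -
  have J0: "J \<subseteq> {0..}" using J(2) by auto
  define I where "I = J \<times> (Basis :: (real^'r) set)"
  define Y where "Y p \<omega> = y (fst p) \<omega> \<bullet> snd p" for p :: "real \<times> (real^'r)" and \<omega>
  have finI: "finite I" using J(1) by (simp add: I_def)
  have u2: "square_integrable M u" unfolding u[abs_def] by (rule affine_square_integrable[OF J(1) J0])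
  have Y2: "square_integrable M (Y p)" if "p \<in> I" for p
    using that J(2) y_square_integrable[of "fst p" "snd p"]
    by (auto simp: Y_def[abs_def] I_def inner_commute)
  obtain \<theta> c where mean: "expectation (\<lambda>\<omega>. u \<omega> - (c + (\<Sum>p\<in>I. \<theta> p * Y p \<omega>))) = 0"
    and orth: "\<forall>q\<in>I. expectation (\<lambda>\<omega>. (u \<omega> - (c + (\<Sum>p\<in>I. \<theta> p * Y p \<omega>))) * Y q \<omega>) = 0"
    using square_integrable_affine_projection[OF finI u2, of Y] Y2 by blast
  define a where "a s = (\<Sum>i\<in>Basis. \<theta> (s, i) *\<^sub>R i)" for s
  have comb: "(\<Sum>p\<in>I. \<theta>' p * Y p \<omega>) = path_combination J (\<lambda>s. \<Sum>i\<in>Basis. \<theta>' (s, i) *\<^sub>R i) y \<omega>" for \<theta>' \<omega>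
    unfolding I_def Y_def by (rule path_combination_Basis)
  define r where "r \<omega> = u \<omega> - (c + path_combination J a y \<omega>)" for \<omega>
  have r0: "expectation r = 0" using mean unfolding comb r_def a_def .
  have rY: "expectation (\<lambda>\<omega>. r \<omega> * Y q \<omega>) = 0" if "q \<in> I" for q
    using orth that unfolding comb r_def a_def by blast
  have r2: "square_integrable M r" unfolding r_def[abs_def]
    by (intro square_integrable_diff square_integrable_add square_integrable_const u2 y_combination_square_integrable J)
  have ry: "expectation (\<lambda>\<omega>. r \<omega> * (v \<bullet> y s \<omega>)) = 0" if s: "s \<in> J" for s v
  proof -
    have "v \<bullet> y s \<omega> = (\<Sum>i\<in>Basis. (v \<bullet> i) * Y (s, i) \<omega>)" for \<omega>
      by (subst euclidean_inner) (simp add: Y_def)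
    then have "expectation (\<lambda>\<omega>. r \<omega> * (v \<bullet> y s \<omega>)) = expectation (\<lambda>\<omega>. \<Sum>i\<in>Basis. (v \<bullet> i) * (r \<omega> * Y (s, i) \<omega>))"
      by (simp add: sum_distrib_left mult.left_commute)
    also have "\<dots> = (\<Sum>i\<in>Basis. expectation (\<lambda>\<omega>. (v \<bullet> i) * (r \<omega> * Y (s, i) \<omega>)))"
      by (rule Bochner_Integration.integral_sum)
         (use s in \<open>auto simp: I_def intro!: integrable_mult_right square_integrable_mult r2 Y2\<close>)
    also have "\<dots> = 0" using s rY by (intro sum.neutral) (simp add: I_def)
    finally show ?thesis .
  qed
  obtain ka where ka: "\<And>\<omega>. path_combination J a y \<omega> = x \<omega> \<bullet> ka + path_combination J a w \<omega>"
    using y_combination[OF J(2), of a] by blast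
  \<comment> \<open>Any combination of the residual and the outputs is again affine in x and the
    noise; the coefficients are collected and the Gaussian law of affine forms applies.\<close>
  have gauss: "gaussian_char M (\<lambda>\<omega>. s * r \<omega> + (\<Sum>p\<in>I. \<theta>' p * Y p \<omega>))" for s \<theta>'
  proof -
    define b where "b t = (\<Sum>i\<in>Basis. \<theta>' (t, i) *\<^sub>R i)" for t
    obtain kb where kb: "\<And>\<omega>. path_combination J b y \<omega> = x \<omega> \<bullet> kb + path_combination J b w \<omega>"
      using y_combination[OF J(2), of b] by blast
    have "s * r \<omega> + (\<Sum>p\<in>I. \<theta>' p * Y p \<omega>) = s * (cu - c) + x \<omega> \<bullet> (s *\<^sub>R (ku - ka) + kb)
        + path_combination J (\<lambda>t. s *\<^sub>R (d t - a t) + b t) w \<omega>" for \<omega>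
      unfolding comb b_def[symmetric] path_combination_add path_combination_scale path_combination_diff
      by (simp add: r_def u ka kb inner_add_right inner_diff_right algebra_simps)
    then show ?thesis using affine_gaussian_char[OF J(1) J0] by presburger
  qed
  define F where "F = generated_sigma M J y"
  have sub: "subalgebra M F" unfolding F_def
  proof (rule generated_sigma_subalgebra)
    fix s assume "s \<in> J"
    then have "0 \<le> s" "s \<le> T" using J(2) by auto
    then show "y s \<in> borel_measurable M" by (rule y_measurable)
  qed
  \<comment> \<open>A vector output is measurable once its coordinates are, so orthogonality on the
    sigma-algebra of the coordinates covers that of the outputs.\<close>
  have FI: "sets F \<subseteq> sets (generated_sigma M I Y)"
    unfolding F_def
  proof (rule generated_sigma_least)
    fix s assume s: "s \<in> J"
    show "y s \<in> borel_measurable (generated_sigma M I Y)"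
      unfolding borel_measurable_euclidean_space[of "y s"]
    proof
      fix i :: "real^'r" assume "i \<in> Basis"
      then have "(s, i) \<in> I" using s by (simp add: I_def)
      from measurable_generated_sigma[OF this, of Y M]
      show "(\<lambda>\<omega>. y s \<omega> \<bullet> i) \<in> borel_measurable (generated_sigma M I Y)" by (simp add: Y_def[abs_def])
    qed
  qed simp
  interpret F: finite_measure_subalgebra M F by unfold_locales (rule sub)
  have ri: "integrable M r" by (rule square_integrable_integrable[OF r2])
  \<comment> \<open>Vanishing integrals over all sets of F say that the conditional expectation of r
    is zero; this form gives access to general test functions.\<close>
  have ce: "AE \<omega> in M. real_cond_exp M F r \<omega> = 0"
  proof (rule F.real_cond_exp_charact)
    fix A assume "A \<in> sets F"
    then have "A \<in> sets (generated_sigma M I Y)" using FI by auto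
    from gaussian_orthogonal_sets[OF finI r2 Y2 gauss r0 rY this]
    show "(\<integral>\<omega>\<in>A. r \<omega> \<partial>M) = (\<integral>\<omega>\<in>A. 0 \<partial>M)"
      by (simp add: set_lebesgue_integral_def mult.commute)
  qed (use ri in auto)
  have "expectation (\<lambda>\<omega>. r \<omega> * \<psi> \<omega>) = 0" if \<psi>: "\<psi> \<in> borel_measurable F" "square_integrable M \<psi>" for \<psi>
  proof -
    have [measurable]: "\<psi> \<in> borel_measurable M" "r \<in> borel_measurable M"
      using \<psi>(2) r2 by (auto simp: square_integrable_def)
    have "expectation (\<lambda>\<omega>. \<psi> \<omega> * r \<omega>) = expectation (\<lambda>\<omega>. \<psi> \<omega> * real_cond_exp M F r \<omega>)"
      by (rule F.real_cond_exp_intg(2)[symmetric]) (use square_integrable_mult[OF \<psi>(2) r2] \<psi>(1) in auto)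
    also have "\<dots> = expectation (\<lambda>_. 0)"
      by (rule integral_cong_AE) (use ce in auto)
    finally show ?thesis by (simp add: mult.commute)
  qed
  then show ?thesis using r0 ry unfolding r_def F_def
    by (intro exI[of _ c] exI[of _ a]) simp
qed

text \<open>In the direction k the difference v of the two estimates is the conditional expectation,
  given the whole output path, of the component u of the sampled error. It suffices to bound the
  pairing of u with functions of finitely many outputs; there u can be replaced by its affine
  projection, to which the linear bound applies. The first two claims provide the integrability
  needed to sum over directions.\<close>

lemma discretisation_error_component:
  fixes n :: nat and k :: 'x
  defines "G \<equiv> (\<lambda>l. real l * (T / real n)) ` {1..n}"
  assumes n: "0 < n"
    and zn: "is_cond_exp M (generated_sigma M G y) (state S x T) zn"
    and zh: "is_cond_exp M (generated_sigma M {0..T} y) (state S x T) z_hat"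
  shows "square_integrable M (\<lambda>\<omega>. (state S x T \<omega> - zn \<omega>) \<bullet> k)"
    and "expectation (\<lambda>\<omega>. ((state S x T \<omega> - zn \<omega>) \<bullet> k)\<^sup>2) \<le> expectation (\<lambda>\<omega>. (state S x T \<omega> \<bullet> k)\<^sup>2)"
    and "square_integrable M (\<lambda>\<omega>. (zn \<omega> - z_hat \<omega>) \<bullet> k)"
    and "expectation (\<lambda>\<omega>. ((zn \<omega> - z_hat \<omega>) \<bullet> k)\<^sup>2)
      \<le> gain n * expectation (\<lambda>\<omega>. ((state S x T \<omega> - zn \<omega>) \<bullet> k)\<^sup>2)"
proof -
  have finG: "finite G" by (simp add: G_def)
  have G: "G \<subseteq> {0..T}"
  proof
    fix s assume "s \<in> G"
    then obtain l where l: "l \<le> n" "s = real l * (T / real n)" by (auto simp: G_def)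
    have "real l * (T / real n) \<le> real n * (T / real n)" using l(1) T by (intro mult_right_mono) auto
    then show "s \<in> {0..T}" using l T n by simp
  qed
  have G0: "G \<subseteq> {0..}" using G by auto
  define Z where "Z \<omega> = state S x T \<omega> \<bullet> k" for \<omega>
  have "\<exists>kT. \<forall>\<xi>. S T \<xi> \<bullet> k = \<xi> \<bullet> kT"
    by (intro riesz_representation bounded_linear_compose[OF bounded_linear_inner_left] blinfun.bounded_linear_right)
  then obtain kT where kT: "\<And>\<xi>. S T \<xi> \<bullet> k = \<xi> \<bullet> kT" by blast
  \<comment> \<open>Zero noise coefficients put Z into the affine form expected by
    \<open>estimator_projection\<close>.\<close>
  have Z_eq: "Z \<omega> = 0 + x \<omega> \<bullet> kT + path_combination G (\<lambda>_. 0) w \<omega>" for \<omega>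
    by (simp add: Z_def state_def kT path_combination_def)
  have Z2: "square_integrable M Z" unfolding Z_eq[abs_def] by (rule affine_square_integrable[OF finG G0])
  obtain c a where u0: "expectation (\<lambda>\<omega>. Z \<omega> - (c + path_combination G a y \<omega>)) = 0"
    and uy: "\<And>s v. s \<in> G \<Longrightarrow> expectation (\<lambda>\<omega>. (Z \<omega> - (c + path_combination G a y \<omega>)) * (v \<bullet> y s \<omega>)) = 0"
    and uG: "\<And>\<psi>. \<psi> \<in> borel_measurable (generated_sigma M G y) \<Longrightarrow> square_integrable M \<psi> \<Longrightarrow>
       expectation (\<lambda>\<omega>. (Z \<omega> - (c + path_combination G a y \<omega>)) * \<psi> \<omega>) = 0"
    using estimator_projection[OF finG G Z_eq] by blast
  define p where "p \<omega> = c + path_combination G a y \<omega>" for \<omega>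
  define u where "u \<omega> = Z \<omega> - p \<omega>" for \<omega>
  have p2: "square_integrable M p" unfolding p_def[abs_def]
    by (intro square_integrable_add square_integrable_const y_combination_square_integrable G)
  have u2: "square_integrable M u" unfolding u_def[abs_def] by (intro square_integrable_diff Z2 p2)
  have pG: "p \<in> borel_measurable (generated_sigma M G y)"
    unfolding p_def[abs_def] path_combination_def
    by (intro borel_measurable_add borel_measurable_const borel_measurable_sum borel_measurable_inner measurable_generated_sigma)
  have up: "expectation (\<lambda>\<omega>. u \<omega> * p \<omega>) = 0"
    using uG[OF pG p2] by (simp add: u_def p_def)
  have subG: "subalgebra M (generated_sigma M G y)" and subT: "subalgebra M (generated_sigma M {0..T} y)"
    using zn zh by (auto simp: is_cond_exp_def)
  \<comment> \<open>The sampled estimate is affine in the samples: p is measurable for their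
    sigma-algebra and Z - p integrates to zero over its sets, which characterises the conditional
    expectation.\<close>
  have zn_p: "AE \<omega> in M. zn \<omega> \<bullet> k = p \<omega>"
  proof -
    interpret F: finite_measure_subalgebra M "generated_sigma M G y" by unfold_locales (rule subG)
    have "AE \<omega> in M. real_cond_exp M (generated_sigma M G y) Z \<omega> = p \<omega>"
    proof (rule F.real_cond_exp_charact)
      fix A assume A: "A \<in> sets (generated_sigma M G y)"
      then have AM: "A \<in> sets M" using subG by (auto simp: subalgebra_def)
      have iA: "square_integrable M (indicator A)"
        unfolding square_integrable_def using AM
        by (auto intro!: integrable_const_bound[of _ 1] split: split_indicator)
      have "expectation (\<lambda>\<omega>. u \<omega> * indicator A \<omega>) = 0"
        using uG[OF borel_measurable_indicator[OF A] iA] by (simp add: u_def p_def)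
      moreover have "expectation (\<lambda>\<omega>. u \<omega> * indicator A \<omega>)
          = expectation (\<lambda>\<omega>. Z \<omega> * indicator A \<omega>) - expectation (\<lambda>\<omega>. p \<omega> * indicator A \<omega>)"
        using square_integrable_mult[OF Z2 iA] square_integrable_mult[OF p2 iA] by (simp add: u_def left_diff_distrib)
      ultimately show "(\<integral>\<omega>\<in>A. Z \<omega> \<partial>M) = (\<integral>\<omega>\<in>A. p \<omega> \<partial>M)"
        by (simp add: set_lebesgue_integral_def mult.commute)
    qed (use square_integrable_integrable[OF Z2] square_integrable_integrable[OF p2] pG in auto)
    moreover have "AE \<omega> in M. real_cond_exp M (generated_sigma M G y) Z \<omega> = zn \<omega> \<bullet> k"
      using cond_exp_inner[OF zn, of k] by (simp add: Z_def[abs_def])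
    ultimately show ?thesis by eventually_elim simp
  qed
  have zni: "integrable M zn" and zhi: "integrable M z_hat" and znF: "zn \<in> borel_measurable (generated_sigma M G y)"
    and zhF: "z_hat \<in> borel_measurable (generated_sigma M {0..T} y)" and zi: "integrable M (state S x T)"
    using zn zh by (auto simp: is_cond_exp_def)
  note [measurable] = borel_measurable_integrable[OF zni] borel_measurable_integrable[OF zhi]
    borel_measurable_integrable[OF zi] square_integrable_measurable[OF u2]
    square_integrable_measurable[OF p2] square_integrable_measurable[OF Z2]
  have zu: "AE \<omega> in M. (state S x T \<omega> - zn \<omega>) \<bullet> k = u \<omega>"
    using zn_p by eventually_elim (simp add: u_def Z_def inner_diff_left)
  have "integrable M (\<lambda>\<omega>. ((state S x T \<omega> - zn \<omega>) \<bullet> k)\<^sup>2) \<longleftrightarrow> integrable M (\<lambda>\<omega>. (u \<omega>)\<^sup>2)"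
    by (rule integrable_cong_AE) (use zu in auto)
  then show "square_integrable M (\<lambda>\<omega>. (state S x T \<omega> - zn \<omega>) \<bullet> k)"
    using u2 by (simp add: square_integrable_def)
  have Eu: "expectation (\<lambda>\<omega>. ((state S x T \<omega> - zn \<omega>) \<bullet> k)\<^sup>2) = expectation (\<lambda>\<omega>. (u \<omega>)\<^sup>2)"
    by (rule integral_cong_AE) (use zu in auto)
  show "expectation (\<lambda>\<omega>. ((state S x T \<omega> - zn \<omega>) \<bullet> k)\<^sup>2) \<le> expectation (\<lambda>\<omega>. (state S x T \<omega> \<bullet> k)\<^sup>2)"
  proof -
    \<comment> \<open>Pythagoras for Z = u + p with uncorrelated summands: the error is no larger
      than the component of the state.\<close>
    have "expectation (\<lambda>\<omega>. (Z \<omega>)\<^sup>2) = expectation (\<lambda>\<omega>. (u \<omega>)\<^sup>2 + (p \<omega>)\<^sup>2 + 2 * (u \<omega> * p \<omega>))"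
      by (rule Bochner_Integration.integral_cong) (auto simp: u_def power2_eq_square algebra_simps)
    also have "\<dots> = expectation (\<lambda>\<omega>. (u \<omega>)\<^sup>2) + expectation (\<lambda>\<omega>. (p \<omega>)\<^sup>2)"
      using u2 p2 square_integrable_mult[OF u2 p2] up by (simp add: square_integrable_def)
    finally show ?thesis unfolding Eu by (simp add: Z_def)
  qed
  obtain ka where ka: "\<And>\<omega>. path_combination G a y \<omega> = x \<omega> \<bullet> ka + path_combination G a w \<omega>"
    using y_combination[OF G, of a] by blast
  \<comment> \<open>The noise coefficients of u live on the grid; extended by zero they serve every
    larger set J of times, as \<open>linear_estimator_bound\<close> demands.\<close>
  define d where "d s = (if s \<in> G then - a s else 0)" for s
  have pcG: "path_combination J d w \<omega> = - path_combination G a w \<omega>" if "finite J" "G \<subseteq> J" for J \<omega>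
  proof -
    have "path_combination J d w \<omega> = path_combination G d w \<omega>"
      by (rule path_combination_mono_neutral) (use that in \<open>auto simp: d_def\<close>)
    also have "\<dots> = - path_combination G a w \<omega>"
      by (simp add: path_combination_def d_def sum_negf)
    finally show ?thesis .
  qed
  define D where "D = sqrt (gain n * expectation (\<lambda>\<omega>. (u \<omega>)\<^sup>2))"
  have gu0: "0 \<le> gain n * expectation (\<lambda>\<omega>. (u \<omega>)\<^sup>2)" using gain_nonneg by simp
  have bound: "\<bar>expectation (\<lambda>\<omega>. u \<omega> * \<psi> \<omega>)\<bar> \<le> D * sqrt (expectation (\<lambda>\<omega>. (\<psi> \<omega>)\<^sup>2))"
    if J': "finite J'" "J' \<subseteq> {0..T}" and \<psi>': "\<psi> \<in> borel_measurable (generated_sigma M J' y)" and \<psi>2: "square_integrable M \<psi>" for J' \<psi>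
  proof -
    \<comment> \<open>The grid is added to the given times so that the grid correction can be
      carried out; a test function of fewer outputs is also one of more.\<close>
    define J where "J = J' \<union> G"
    have J: "finite J" "G \<subseteq> J" "J \<subseteq> {0..T}" using J' finG G by (auto simp: J_def)
    have \<psi>: "\<psi> \<in> borel_measurable (generated_sigma M J y)"
      by (rule measurable_generated_sigma_mono[OF \<psi>']) (simp add: J_def)
    have u_eq: "u \<omega> = (- c) + x \<omega> \<bullet> (kT - ka) + path_combination J d w \<omega>" for \<omega>
      unfolding pcG[OF J(1,2)] by (simp add: u_def p_def Z_def state_def kT ka inner_diff_right)
    obtain c' a' where q0: "expectation (\<lambda>\<omega>. u \<omega> - (c' + path_combination J a' y \<omega>)) = 0"
      and qJ: "\<And>\<psi>. \<psi> \<in> borel_measurable (generated_sigma M J y) \<Longrightarrow> square_integrable M \<psi> \<Longrightarrow>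
       expectation (\<lambda>\<omega>. (u \<omega> - (c' + path_combination J a' y \<omega>)) * \<psi> \<omega>) = 0"
      using estimator_projection[OF J(1,3) u_eq] by blast
    define q where "q \<omega> = c' + path_combination J a' y \<omega>" for \<omega>
    have q2: "square_integrable M q" unfolding q_def[abs_def]
      by (intro square_integrable_add square_integrable_const y_combination_square_integrable J)
    have qm: "q \<in> borel_measurable (generated_sigma M J y)"
      unfolding q_def[abs_def] path_combination_def
      by (intro borel_measurable_add borel_measurable_const borel_measurable_sum borel_measurable_inner measurable_generated_sigma)
    have eq: "expectation (\<lambda>\<omega>. u \<omega> * \<phi> \<omega>) = expectation (\<lambda>\<omega>. q \<omega> * \<phi> \<omega>)"
      if "\<phi> \<in> borel_measurable (generated_sigma M J y)" "square_integrable M \<phi>" for \<phi>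
      using qJ[OF that] square_integrable_mult[OF u2 that(2)] square_integrable_mult[OF q2 that(2)]
      by (simp add: q_def[symmetric] left_diff_distrib)
    \<comment> \<open>The residual u - q is orthogonal to q, so Q = E(u q). The linear bound then
      says that the square of Q is at most \<open>gain n\<close> times E u^2 times Q, and one factor
      Q cancels.\<close>
    define Q where "Q = expectation (\<lambda>\<omega>. (q \<omega>)\<^sup>2)"
    have Q0: "0 \<le> Q" by (simp add: Q_def)
    have "Q\<^sup>2 = (expectation (\<lambda>\<omega>. u \<omega> * q \<omega>))\<^sup>2"
      using eq[OF qm q2] by (simp add: Q_def power2_eq_square)
    also have "\<dots> \<le> gain n * expectation (\<lambda>\<omega>. (u \<omega>)\<^sup>2) * Q"
      unfolding Q_def q_def
    proof (rule linear_estimator_bound[OF n J(1) _ J(3) normV_x_square_integrable _ u_eq])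
      show "(\<lambda>l. real l * (T / real n)) ` {1..n} \<subseteq> J" using J(2) by (simp add: G_def)
      show "d s = 0" if "s \<notin> (\<lambda>l. real l * (T / real n)) ` {1..n}" for s using that by (simp add: d_def G_def)
      show "expectation u = 0" using u0 by (simp add: u_def[abs_def] p_def)
      show "expectation (\<lambda>\<omega>. u \<omega> * (v \<bullet> y s \<omega>)) = 0" if "s \<in> (\<lambda>l. real l * (T / real n)) ` {1..n}" for s v
        using uy[of s v] that by (simp add: u_def p_def G_def)
    qed
    finally have "Q * Q \<le> (gain n * expectation (\<lambda>\<omega>. (u \<omega>)\<^sup>2)) * Q" by (simp add: power2_eq_square)
    then have QD: "Q \<le> gain n * expectation (\<lambda>\<omega>. (u \<omega>)\<^sup>2)"
      using Q0 gu0 by (cases "Q = 0") (simp_all add: mult_le_cancel_right_pos)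
    have "(expectation (\<lambda>\<omega>. u \<omega> * \<psi> \<omega>))\<^sup>2 = (expectation (\<lambda>\<omega>. q \<omega> * \<psi> \<omega>))\<^sup>2" using eq[OF \<psi> \<psi>2] by simp
    also have "\<dots> \<le> Q * expectation (\<lambda>\<omega>. (\<psi> \<omega>)\<^sup>2)" unfolding Q_def by (rule square_integrable_cauchy_schwarz[OF q2 \<psi>2])
    also have "\<dots> \<le> (gain n * expectation (\<lambda>\<omega>. (u \<omega>)\<^sup>2)) * expectation (\<lambda>\<omega>. (\<psi> \<omega>)\<^sup>2)"
      by (rule mult_right_mono[OF QD]) simp
    finally have "sqrt ((expectation (\<lambda>\<omega>. u \<omega> * \<psi> \<omega>))\<^sup>2) \<le> sqrt ((gain n * expectation (\<lambda>\<omega>. (u \<omega>)\<^sup>2)) * expectation (\<lambda>\<omega>. (\<psi> \<omega>)\<^sup>2))"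
      by (rule real_sqrt_le_mono)
    then show ?thesis by (simp only: real_sqrt_abs real_sqrt_mult D_def)
  qed
  define v where "v \<omega> = (z_hat \<omega> - zn \<omega>) \<bullet> k" for \<omega>
  have znT: "zn \<in> borel_measurable (generated_sigma M {0..T} y)"
    by (rule measurable_generated_sigma_mono[OF znF G])
  have vF: "v \<in> borel_measurable (generated_sigma M {0..T} y)"
    unfolding v_def[abs_def] using znT zhF by (intro borel_measurable_inner borel_measurable_diff borel_measurable_const)
  have vi: "integrable M v" unfolding v_def[abs_def] using zni zhi by auto
  \<comment> \<open>The duality input: against bounded functions of the whole path,
    \<open>z_hat\<close> acts like the state and \<open>zn\<close> acts like p, so v acts like
    u.\<close>
  have uv: "expectation (\<lambda>\<omega>. v \<omega> * \<psi> \<omega>) = expectation (\<lambda>\<omega>. u \<omega> * \<psi> \<omega>)"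
    if \<psi>: "\<psi> \<in> borel_measurable (generated_sigma M {0..T} y)" and B: "\<And>\<omega>. \<bar>\<psi> \<omega>\<bar> \<le> B" for \<psi> B
  proof -
    have \<psi>m[measurable]: "\<psi> \<in> borel_measurable M" by (rule measurable_from_subalg[OF subT \<psi>])
    have ip: "integrable M (\<lambda>\<omega>. f \<omega> * \<psi> \<omega>)" if f: "integrable M f" for f
    proof (rule Bochner_Integration.integrable_bound)
      show "integrable M (\<lambda>\<omega>. B * f \<omega>)" using f by simp
      show "(\<lambda>\<omega>. f \<omega> * \<psi> \<omega>) \<in> borel_measurable M" using f by auto
      have "\<bar>f \<omega>\<bar> * \<bar>\<psi> \<omega>\<bar> \<le> \<bar>f \<omega>\<bar> * \<bar>B\<bar>" for \<omega> using B[of \<omega>] by (intro mult_left_mono) auto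
      then show "AE \<omega> in M. norm (f \<omega> * \<psi> \<omega>) \<le> norm (B * f \<omega>)" by (simp add: abs_mult mult.commute)
    qed
    have kz: "integrable M (\<lambda>\<omega>. zn \<omega> \<bullet> k)" "integrable M (\<lambda>\<omega>. z_hat \<omega> \<bullet> k)" using zni zhi by auto
    have Zi: "integrable M Z" and pi: "integrable M p"
      using square_integrable_integrable[OF Z2] square_integrable_integrable[OF p2] .
    have "expectation (\<lambda>\<omega>. v \<omega> * \<psi> \<omega>) = expectation (\<lambda>\<omega>. (z_hat \<omega> \<bullet> k) * \<psi> \<omega>) - expectation (\<lambda>\<omega>. (zn \<omega> \<bullet> k) * \<psi> \<omega>)"
      using ip[OF kz(1)] ip[OF kz(2)] by (simp add: v_def inner_diff_left left_diff_distrib)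
    also have "expectation (\<lambda>\<omega>. (z_hat \<omega> \<bullet> k) * \<psi> \<omega>) = expectation (\<lambda>\<omega>. Z \<omega> * \<psi> \<omega>)"
      unfolding Z_def by (rule cond_exp_inner_pairing[OF zh \<psi>]) (use ip[OF Zi] in \<open>simp add: Z_def\<close>)
    also have "expectation (\<lambda>\<omega>. (zn \<omega> \<bullet> k) * \<psi> \<omega>) = expectation (\<lambda>\<omega>. p \<omega> * \<psi> \<omega>)"
      by (rule integral_cong_AE) (use zn_p in auto)
    also have "expectation (\<lambda>\<omega>. Z \<omega> * \<psi> \<omega>) - expectation (\<lambda>\<omega>. p \<omega> * \<psi> \<omega>) = expectation (\<lambda>\<omega>. u \<omega> * \<psi> \<omega>)"
      using ip[OF Zi] ip[OF pi] by (simp add: u_def left_diff_distrib)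
    finally show ?thesis .
  qed
  have ym: "y t \<in> borel_measurable M" if "t \<in> {0..T}" for t using that by (intro y_measurable) auto
  have D0: "0 \<le> D" using gu0 by (simp add: D_def)
  note fin = square_integral_le_of_finite_pairing[of "{0..T}" y, OF ym u2 D0 bound vF vi uv]
  have v2: "square_integrable M v" by (rule fin(1))
  have vD: "expectation (\<lambda>\<omega>. (v \<omega>)\<^sup>2) \<le> D\<^sup>2" by (rule fin(2))
  have vm: "(zn \<omega> - z_hat \<omega>) \<bullet> k = (-1) * v \<omega>" for \<omega> by (simp add: v_def inner_diff_left)
  show "square_integrable M (\<lambda>\<omega>. (zn \<omega> - z_hat \<omega>) \<bullet> k)"
    unfolding vm by (rule square_integrable_cmult[OF v2])
  have "D\<^sup>2 = gain n * expectation (\<lambda>\<omega>. (u \<omega>)\<^sup>2)" using gu0 by (simp add: D_def)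
  then show "expectation (\<lambda>\<omega>. ((zn \<omega> - z_hat \<omega>) \<bullet> k)\<^sup>2)
      \<le> gain n * expectation (\<lambda>\<omega>. ((state S x T \<omega> - zn \<omega>) \<bullet> k)\<^sup>2)"
    using vD unfolding vm Eu by simp
qed

theorem discretisation_error:
  fixes n :: nat
  assumes n: "0 < n"
    and zn: "is_cond_exp M (generated_sigma M ((\<lambda>l. real l * (T / real n)) ` {1..n}) y) (state S x T) zn"
    and zh: "is_cond_exp M (generated_sigma M {0..T} y) (state S x T) z_hat"
  shows "expectation (\<lambda>\<omega>. (norm (zn \<omega> - z_hat \<omega>))\<^sup>2)
    \<le> gain n * expectation (\<lambda>\<omega>. (norm (state S x T \<omega> - zn \<omega>))\<^sup>2)"
proof -
  note c = discretisation_error_component[OF n zn zh]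
  have [measurable]: "zn \<in> borel_measurable M" "z_hat \<in> borel_measurable M" "state S x T \<in> borel_measurable M"
    using zn zh by (auto simp: is_cond_exp_def)
  have z2: "integrable M (\<lambda>\<omega>. (norm (state S x T \<omega>))\<^sup>2)"
  proof (rule Bochner_Integration.integrable_bound)
    show "integrable M (\<lambda>\<omega>. \<mu>\<^sup>2 * (norm (x \<omega>))\<^sup>2)" using norm_x_square_integrable by simp
    have "(norm (state S x T \<omega>))\<^sup>2 \<le> (\<mu> * norm (x \<omega>))\<^sup>2" for \<omega>
      unfolding state_def by (rule power_mono[OF norm_S]) (use T in auto)
    then show "AE \<omega> in M. norm ((norm (state S x T \<omega>))\<^sup>2) \<le> norm (\<mu>\<^sup>2 * (norm (x \<omega>))\<^sup>2)"
      by (simp add: power_mult_distrib)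
  qed simp
  \<comment> \<open>With \<kappa> = 1 and the state as comparison, the componentwise Pythagoras
    inequality makes the sampled error square integrable in norm, as is required of the right side
    of the final comparison.\<close>
  have e2: "integrable M (\<lambda>\<omega>. (norm (state S x T \<omega> - zn \<omega>))\<^sup>2)"
    by (rule norm_square_integral_le(1)[where E="state S x T" and \<kappa>=1]) (use c(1,2) z2 in auto)
  show ?thesis
    by (rule norm_square_integral_le(2)) (use c(3,4) e2 gain_nonneg in auto)
qed

end

theorem theorem3p3:
  fixes \<Omega> :: "'w measure"
    and S :: "real \<Rightarrow> ('x::{real_inner, banach, second_countable_topology} \<Rightarrow>\<^sub>L 'x)"
    and C :: "'x \<Rightarrow> real^'r"
    and x :: "'w \<Rightarrow> 'x" and m :: 'x and P0 :: "'x \<Rightarrow> 'x"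
    and w :: "real \<Rightarrow> 'w \<Rightarrow> real^'r" and R :: "real^'r^'r"
    and T \<mu> c1 :: real and n :: nat
    and V :: "'x set" and normV :: "'x \<Rightarrow> real"
    and zn z_hat :: "'w \<Rightarrow> 'x"
  assumes "prob_space \<Omega>"
    and "0 < T" and "0 < n"
    and "analytic_semigroup S"
    and "\<And>t. 0 \<le> t \<Longrightarrow> t \<le> T \<Longrightarrow> norm (S t) \<le> \<mu>"
    and "\<And>t \<xi>. 0 < t \<Longrightarrow> norm (generator S (S t \<xi>)) \<le> c1 / t * norm \<xi>"
    and "gaussian \<Omega> x m P0"
    and "positive_definite R" and "brownian_motion \<Omega> R w"
    and "prob_space.indep_set \<Omega> (sets (vimage_algebra (space \<Omega>) x borel))
           (sets (generated_sigma \<Omega> {0..} w))"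
    and "(V = UNIV \<and> normV = norm) \<or>
         (V = generator_domain S \<and> normV = graph_norm (generator S) \<and>
          (AE \<omega> in \<Omega>. x \<omega> \<in> generator_domain S))"
    and "bounded_operator_on V normV C"
    and "is_cond_exp \<Omega>
           (generated_sigma \<Omega> {real i * T / real n | i. i \<in> {1..n}} (observation S C x w))
           (state S x T) zn"
    and "is_cond_exp \<Omega> (generated_sigma \<Omega> {0..T} (observation S C x w)) (state S x T) z_hat"
  shows "(\<integral>\<omega>. (norm (zn \<omega> - z_hat \<omega>))\<^sup>2 \<partial>\<Omega>) \<le>
    (2 * (operator_norm_on V normV C)\<^sup>2 / min_eigenvalue R * (\<mu>\<^sup>2 + c1\<^sup>2 * pi\<^sup>2 / 96)
      * (\<integral>\<omega>. (norm (state S x T \<omega> - zn \<omega>))\<^sup>2 \<partial>\<Omega>) * (\<integral>\<omega>. (normV (x \<omega>))\<^sup>2 \<partial>\<Omega>)) * T / real n"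
proof -
  interpret prob_space \<Omega> by fact
  interpret wiener \<Omega> R w
    by unfold_locales (fact assms(8), fact assms(9))
  interpret observed_semigroup S T \<mu> C V normV c1
    by unfold_locales (use assms in auto)
  interpret kalman \<Omega> R w S T \<mu> C V normV c1 x m P0
    by unfold_locales (use assms in auto)
  have grid: "{real i * T / real n | i. i \<in> {1..n}} = (\<lambda>l. real l * (T / real n)) ` {1..n}"
    by (auto simp: image_def)
  define E X where "E = (\<integral>\<omega>. (norm (state S x T \<omega> - zn \<omega>))\<^sup>2 \<partial>\<Omega>)" and "X = (\<integral>\<omega>. (normV (x \<omega>))\<^sup>2 \<partial>\<Omega>)"
  have "(\<integral>\<omega>. (norm (zn \<omega> - z_hat \<omega>))\<^sup>2 \<partial>\<Omega>) \<le> gain n * E"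
    unfolding E_def
    by (rule discretisation_error) (use assms in \<open>simp_all only: observation_eq grid\<close>)
  also have "\<dots> = (C_norm\<^sup>2 / min_eigenvalue R * E * X * T / real n) * (\<mu>\<^sup>2 + c1\<^sup>2 * pi\<^sup>2 / 72)"
    by (simp add: gain_def X_def mult_ac)
  \<comment> \<open>Slack in the stated constant: \<mu>^2 is at most 2 \<mu>^2, and 1/72 is at most
    2/96 = 1/48. The common factor is nonnegative because the smallest eigenvalue is
    positive.\<close>
  also have "\<dots> \<le> (C_norm\<^sup>2 / min_eigenvalue R * E * X * T / real n) * (2 * (\<mu>\<^sup>2 + c1\<^sup>2 * pi\<^sup>2 / 96))"
  proof (rule mult_left_mono)
    have le: "a + b / 72 \<le> 2 * (a + b / 96)" if "0 \<le> a" "0 \<le> b" for a b :: real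
      using that by (simp add: field_simps)
    show "\<mu>\<^sup>2 + c1\<^sup>2 * pi\<^sup>2 / 72 \<le> 2 * (\<mu>\<^sup>2 + c1\<^sup>2 * pi\<^sup>2 / 96)" by (rule le) simp_all
    show "0 \<le> C_norm\<^sup>2 / min_eigenvalue R * E * X * T / real n"
      using min_eigenvalue_positive_definite(1)[OF R] assms(2) by (simp add: E_def X_def)
  qed
  also have "\<dots> = (2 * C_norm\<^sup>2 / min_eigenvalue R * (\<mu>\<^sup>2 + c1\<^sup>2 * pi\<^sup>2 / 96) * E * X) * T / real n"
    by (simp add: mult_ac)
  finally show ?thesis by (simp only: E_def X_def)
qed

end
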